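(* Let $k\ge 2$ be an integer and let $G=G_1*\cdots*G_k$ be a free product of groups such that (i) each $G_i$, $1\le i\le k$, is freely indecomposable, and (ii) for $i=1,2$, the group $G_i$ has a proper characteristic subgroup of finite index. Then $G$ has the $R_\infty$-property.
   Context: A group is called freely indecomposable if it is nontrivial and cannot be expressed as a free product of two nontrivial groups (so the infinite cyclic group $\mathbb Z$ is freely indecomposable). The groups are not assumed to be finitely generated. A subgroup is proper if it is not the whole group (the trivial subgroup of a nontrivial group is allowed). For an automorphism $\phi:G\to G$ of a group $G$, the $\phi$-twisted conjugation action of $G$ on itself is $g\cdot x=gx\phi(g^{-1})$; its orbits are the $\phi$-twisted conjugacy classes. The Reidemeister number $R(\phi)$ is the number of $\phi$-twisted conjugacy classes if this is finite, and $R(\phi)=\infty$ otherwise. A group $G$ has the $R_\infty$-property if $R(\phi)=\infty$ for every automorphism $\phi$ of $G$. *)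

theory Defs
  imports "HOL-Algebra.Group_Action" "HOL-Algebra.Elementary_Groups" "HOL-Library.Extended_Nat"
begin

section \<open>Free products\<close>

text \<open>
  The free product of a family of groups is built from reduced words. A letter is a pair
  \<open>(i, x)\<close> of an index and an element of the \<open>i\<close>-th group. All factors share one element type;
  this is no restriction, since \<open>'a\<close> is arbitrary and the letters carry their index.
\<close>

definition reduced_words :: "'i set \<Rightarrow> ('i \<Rightarrow> 'a monoid) \<Rightarrow> ('i \<times> 'a) list set"
  where "reduced_words I G =
    {w. set w \<subseteq> (SIGMA i:I. carrier (G i) - {\<one>\<^bsub>G i\<^esub>}) \<and> distinct_adj (map fst w)}"

text \<open>The reduced form of a letter followed by a reduced word; the letter may be trivial here.\<close>

fun letter_mult :: "('i \<Rightarrow> 'a monoid) \<Rightarrow> 'i \<times> 'a \<Rightarrow> ('i \<times> 'a) list \<Rightarrow> ('i \<times> 'a) list"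
  where
    "letter_mult G (i, x) [] = (if x = \<one>\<^bsub>G i\<^esub> then [] else [(i, x)])"
  | "letter_mult G (i, x) ((j, y) # w) =
      (if x = \<one>\<^bsub>G i\<^esub> then (j, y) # w
       else if i \<noteq> j then (i, x) # (j, y) # w
       else if x \<otimes>\<^bsub>G i\<^esub> y = \<one>\<^bsub>G i\<^esub> then w
       else (i, x \<otimes>\<^bsub>G i\<^esub> y) # w)"

definition free_product :: "'i set \<Rightarrow> ('i \<Rightarrow> 'a monoid) \<Rightarrow> ('i \<times> 'a) list monoid"
  where "free_product I G =
    \<lparr>carrier = reduced_words I G, mult = (\<lambda>u v. foldr (letter_mult G) u v), one = []\<rparr>"

definition free_product_incl :: "('i \<Rightarrow> 'a monoid) \<Rightarrow> 'i \<Rightarrow> 'a \<Rightarrow> ('i \<times> 'a) list"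
  where "free_product_incl G i x = letter_mult G (i, x) []"

abbreviation binary_free_product :: "'a monoid \<Rightarrow> 'a monoid \<Rightarrow> (nat \<times> 'a) list monoid"
  where "binary_free_product A B \<equiv> free_product {1, 2} (\<lambda>i. if i = 1 then A else B)"

lemma letter_mult_closed:
  assumes "\<And>i. i \<in> I \<Longrightarrow> group (G i)" "i \<in> I" "x \<in> carrier (G i)" "w \<in> reduced_words I G"
  shows "letter_mult G (i, x) w \<in> reduced_words I G"
proof -
  interpret group "G i" using assms by blast
  show ?thesis
  proof (cases w)
    case Nil
    then show ?thesis using assms(2-) by (simp add: reduced_words_def)
  next
    case (Cons p w')
    obtain j y where p: "p = (j, y)" by fastforce
    have "y \<in> carrier (G j)" and "w' \<in> reduced_words I G"
      using assms(4) by (auto simp: Cons p reduced_words_def distinct_adj_Cons)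
    then show ?thesis
      using assms(2-) m_closed[OF assms(3), of y] by (cases "i = j") (simp_all add: Cons p reduced_words_def distinct_adj_Cons)
  qed
qed

lemma letter_mult_one: "letter_mult G (i, \<one>\<^bsub>G i\<^esub>) w = w"
  by (cases w) auto

lemma letter_mult_mult:
  assumes "\<And>i. i \<in> I \<Longrightarrow> group (G i)" "i \<in> I" "x \<in> carrier (G i)" "y \<in> carrier (G i)"
    "w \<in> reduced_words I G"
  shows "letter_mult G (i, x) (letter_mult G (i, y) w) = letter_mult G (i, x \<otimes>\<^bsub>G i\<^esub> y) w"
proof -
  interpret group "G i" using assms by blast
  show ?thesis
  proof (cases w)
    case Nil
    then show ?thesis using assms(2-) by auto
  next
    case (Cons p w')
    obtain j z where p: "p = (j, z)" by fastforce
    show ?thesis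
    proof (cases "j = i")
      case False
      then show ?thesis using assms(2-) Cons p by auto
    next
      case True
      then have z: "z \<in> carrier (G i)" "z \<noteq> \<one>\<^bsub>G i\<^esub>" and w': "w' = [] \<or> fst (hd w') \<noteq> i"
        using assms Cons p by (auto simp: reduced_words_def distinct_adj_Cons hd_map)
      have a: "x \<otimes>\<^bsub>G i\<^esub> (y \<otimes>\<^bsub>G i\<^esub> z) = (x \<otimes>\<^bsub>G i\<^esub> y) \<otimes>\<^bsub>G i\<^esub> z"
        using z assms by (simp add: m_assoc)
      have b: "letter_mult G (i, t) w' = (if t = \<one>\<^bsub>G i\<^esub> then w' else (i, t) # w')" for t
        using w' by (cases w') auto
      have c: "letter_mult G (i, t) w = letter_mult G (i, t \<otimes>\<^bsub>G i\<^esub> z) w'"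
        if "t \<in> carrier (G i)" for t
        using True p Cons z that by (auto simp: b)
      have d: "letter_mult G (i, s) (letter_mult G (i, t) w') = letter_mult G (i, s \<otimes>\<^bsub>G i\<^esub> t) w'"
        if "t \<in> carrier (G i)" "s \<in> carrier (G i)" for s t
        using that by (auto simp: b)
      show ?thesis using assms z by (simp add: c d a)
    qed
  qed
qed

lemma free_product_simps:
  "carrier (free_product I G) = reduced_words I G"
  "\<one>\<^bsub>free_product I G\<^esub> = []"
  "u \<otimes>\<^bsub>free_product I G\<^esub> v = foldr (letter_mult G) u v"
  by (simp_all add: free_product_def)

lemma reduced_words_Cons:
  assumes "(i, x) # w \<in> reduced_words I G"
  shows "i \<in> I" "x \<in> carrier (G i)" "w \<in> reduced_words I G"
    "letter_mult G (i, x) w = (i, x) # w"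
proof -
  show "i \<in> I" "x \<in> carrier (G i)" "w \<in> reduced_words I G"
    using assms by (auto simp: reduced_words_def distinct_adj_Cons)
  show "letter_mult G (i, x) w = (i, x) # w"
    using assms by (cases w) (auto simp: reduced_words_def distinct_adj_Cons split: if_splits)
qed

lemma foldr_letter_mult_closed:
  assumes "\<And>i. i \<in> I \<Longrightarrow> group (G i)" "u \<in> reduced_words I G" "v \<in> reduced_words I G"
  shows "foldr (letter_mult G) u v \<in> reduced_words I G"
  using assms(2)
proof (induction u)
  case (Cons p u)
  then show ?case
    by (cases p) (auto intro!: letter_mult_closed assms(1) dest: reduced_words_Cons)
qed (use assms in auto)

lemma foldr_letter_mult_one:
  "u \<in> reduced_words I G \<Longrightarrow> foldr (letter_mult G) u [] = u"
proof (induction u)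
  case (Cons p u)
  obtain i x where p: "p = (i, x)" by fastforce
  show ?case using Cons.IH reduced_words_Cons[OF Cons.prems[unfolded p]] by (simp add: p)
qed auto

lemma foldr_letter_mult_letter:
  assumes G: "\<And>i. i \<in> I \<Longrightarrow> group (G i)" and i: "i \<in> I" "x \<in> carrier (G i)"
    and v: "v \<in> reduced_words I G" and w: "w \<in> reduced_words I G"
  shows "foldr (letter_mult G) (letter_mult G (i, x) v) w
       = letter_mult G (i, x) (foldr (letter_mult G) v w)"
proof (cases v)
  case Nil
  then show ?thesis by (simp add: letter_mult_one)
next
  case (Cons p v')
  obtain j y where p: "p = (j, y)" by fastforce
  note v' = reduced_words_Cons[OF v[unfolded Cons p]]
  note mm = letter_mult_mult[OF G i _ foldr_letter_mult_closed[OF G v'(3) w]]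
  show ?thesis
  proof (cases "i = j")
    case True
    have "letter_mult G (i, x) (letter_mult G (i, y) (foldr (letter_mult G) v' w))
        = letter_mult G (i, x \<otimes>\<^bsub>G i\<^esub> y) (foldr (letter_mult G) v' w)"
      using mm v'(2) True by auto
    then show ?thesis using True Cons p by (auto simp: letter_mult_one)
  next
    case False
    then show ?thesis using Cons p by (auto simp: letter_mult_one)
  qed
qed

lemma foldr_letter_mult_assoc:
  assumes "\<And>i. i \<in> I \<Longrightarrow> group (G i)" "u \<in> reduced_words I G" "v \<in> reduced_words I G"
    "w \<in> reduced_words I G"
  shows "foldr (letter_mult G) (foldr (letter_mult G) u v) w
       = foldr (letter_mult G) u (foldr (letter_mult G) v w)"
  using assms(2)
proof (induction u)
  case (Cons p u)
  obtain i x where p: "p = (i, x)" by fastforce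
  note u = reduced_words_Cons[OF Cons.prems[unfolded p]]
  show ?case
    using Cons.IH[OF u(3)]
      foldr_letter_mult_letter[OF assms(1) u(1,2) foldr_letter_mult_closed[OF assms(1) u(3) assms(3)]
        assms(4)]
    by (simp add: p)
qed auto

lemma foldr_letter_mult_inverse:
  assumes "\<And>i. i \<in> I \<Longrightarrow> group (G i)" "w \<in> reduced_words I G"
  shows "\<exists>u\<in>reduced_words I G. foldr (letter_mult G) u w = []"
  using assms(2)
proof (induction w)
  case Nil
  then show ?case by (auto intro: bexI[of _ "[]"])
next
  case (Cons p w)
  obtain i x where p: "p = (i, x)" by fastforce
  note w = reduced_words_Cons[OF Cons.prems[unfolded p]]
  interpret group "G i" using assms(1) w by blast
  obtain u where u: "u \<in> reduced_words I G" "foldr (letter_mult G) u w = []"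
    using Cons.IH w by blast
  define l where "l = letter_mult G (i, inv\<^bsub>G i\<^esub> x) []"
  have nil: "[] \<in> reduced_words I G" by (simp add: reduced_words_def)
  have l: "l \<in> reduced_words I G"
    unfolding l_def by (rule letter_mult_closed[OF assms(1) w(1) inv_closed[OF w(2)] nil])
  have "foldr (letter_mult G) l (p # w) = letter_mult G (i, inv\<^bsub>G i\<^esub> x) (p # w)"
    unfolding l_def
    using foldr_letter_mult_letter[OF assms(1) w(1) _ nil Cons.prems, of "inv\<^bsub>G i\<^esub> x"] w(2)
    by simp
  also have "\<dots> = letter_mult G (i, inv\<^bsub>G i\<^esub> x) (letter_mult G (i, x) w)"
    unfolding w(4) p ..
  also have "\<dots> = w"
    using letter_mult_mult[OF assms(1) w(1) inv_closed[OF w(2)] w(2,3)] w(2)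
    by (simp add: letter_mult_one)
  finally have "foldr (letter_mult G) (foldr (letter_mult G) u l) (p # w) = []"
    using foldr_letter_mult_assoc[OF assms(1) u(1) l Cons.prems] u by simp
  then show ?case using foldr_letter_mult_closed[OF assms(1) u(1) l] by blast
qed

lemma group_free_product:
  assumes "\<And>i. i \<in> I \<Longrightarrow> group (G i)"
  shows "group (free_product I G)"
proof (rule groupI, goal_cases)
  case (1 x y)
  then show ?case using assms by (simp add: free_product_simps foldr_letter_mult_closed)
next
  case 2
  then show ?case by (simp add: free_product_simps reduced_words_def)
next
  case (3 x y z)
  then show ?case using assms by (simp add: free_product_simps foldr_letter_mult_assoc[OF assms])
next
  case (4 x)
  then show ?case by (simp add: free_product_simps)
next
  case (5 x)
  then show ?case using foldr_letter_mult_inverse[OF assms] by (simp add: free_product_simps)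
qed

lemma free_product_incl_hom:
  assumes "\<And>i. i \<in> I \<Longrightarrow> group (G i)" "i \<in> I"
  shows "free_product_incl G i \<in> hom (G i) (free_product I G)"
    and "inj_on (free_product_incl G i) (carrier (G i))"
proof -
  interpret group "G i" using assms by blast
  show "free_product_incl G i \<in> hom (G i) (free_product I G)"
    using assms(2) letter_mult_closed[OF assms(1,2), where w = "[]"]
    by (auto simp: hom_def free_product_simps free_product_incl_def reduced_words_def)
  show "inj_on (free_product_incl G i) (carrier (G i))"
    by (auto simp: inj_on_def free_product_incl_def split: if_splits)
qed

text \<open>The universal property.\<close>

lemma free_product_universal:
  fixes K :: "('b, 'c) monoid_scheme"
  assumes G: "\<And>i. i \<in> I \<Longrightarrow> group (G i)" and K: "group K"
    and f: "\<And>i. i \<in> I \<Longrightarrow> f i \<in> hom (G i) K"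
  shows "\<exists>h. h \<in> hom (free_product I G) K \<and>
      (\<forall>i\<in>I. \<forall>x\<in>carrier (G i). h (free_product_incl G i x) = f i x)" (is ?ex)
    and "\<lbrakk>h \<in> hom (free_product I G) K; h' \<in> hom (free_product I G) K;
      \<And>i x. \<lbrakk>i \<in> I; x \<in> carrier (G i)\<rbrakk> \<Longrightarrow> h (free_product_incl G i x) = h' (free_product_incl G i x);
      w \<in> carrier (free_product I G)\<rbrakk> \<Longrightarrow> h w = h' w"
proof -
  interpret K: group K by (fact K)
  define h where "h w = foldr (\<lambda>(i, x) k. f i x \<otimes>\<^bsub>K\<^esub> k) w \<one>\<^bsub>K\<^esub>" for w
  have f_in: "f i x \<in> carrier K" if "i \<in> I" "x \<in> carrier (G i)" for i x
    using f[OF that(1)] that by (auto simp: hom_def)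
  have f_mult: "f i (x \<otimes>\<^bsub>G i\<^esub> y) = f i x \<otimes>\<^bsub>K\<^esub> f i y"
    if "i \<in> I" "x \<in> carrier (G i)" "y \<in> carrier (G i)" for i x y
    using f[OF that(1)] that by (auto simp: hom_def)
  have f_one: "f i \<one>\<^bsub>G i\<^esub> = \<one>\<^bsub>K\<^esub>" if "i \<in> I" for i
    using hom_one[OF f[OF that] G[OF that] K] .
  have h_in: "h w \<in> carrier K" if "w \<in> reduced_words I G" for w
    using that
  proof (induction w)
    case (Cons p w)
    then show ?case by (cases p) (auto simp: h_def dest: reduced_words_Cons intro!: f_in)
  qed (simp add: h_def)
  have h_letter: "h (letter_mult G (i, x) w) = f i x \<otimes>\<^bsub>K\<^esub> h w"
    if i: "i \<in> I" "x \<in> carrier (G i)" and w: "w \<in> reduced_words I G" for i x w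
  proof (cases w)
    case Nil
    then show ?thesis using i f_one f_in by (simp add: h_def)
  next
    case (Cons p w')
    obtain j y where p: "p = (j, y)" by fastforce
    note w' = reduced_words_Cons[OF w[unfolded Cons p]]
    have hw: "h w = f j y \<otimes>\<^bsub>K\<^esub> h w'" by (simp add: Cons p h_def)
    note c = h_in[OF w'(3)] h_in[OF w] f_in[OF i] f_in[OF w'(1,2)]
    show ?thesis
    proof (cases "x = \<one>\<^bsub>G i\<^esub> \<or> i \<noteq> j")
      case True
      then show ?thesis using Cons p c i f_one by (auto simp: h_def)
    next
      case False
      then have ij: "j = i" and x: "x \<noteq> \<one>\<^bsub>G i\<^esub>" by auto
      have "f i x \<otimes>\<^bsub>K\<^esub> h w = f i (x \<otimes>\<^bsub>G i\<^esub> y) \<otimes>\<^bsub>K\<^esub> h w'"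
        using c hw i w' ij by (simp add: f_mult K.m_assoc)
      moreover have "h (letter_mult G (i, x) w) = f i (x \<otimes>\<^bsub>G i\<^esub> y) \<otimes>\<^bsub>K\<^esub> h w'"
        using Cons p ij x c f_one[OF i(1)] by (auto simp: h_def)
      ultimately show ?thesis by simp
    qed
  qed
  have h_mult: "h (foldr (letter_mult G) u v) = h u \<otimes>\<^bsub>K\<^esub> h v"
    if "u \<in> reduced_words I G" "v \<in> reduced_words I G" for u v
    using that(1)
  proof (induction u)
    case Nil
    then show ?case using h_in[OF that(2)] by (simp add: h_def)
  next
    case (Cons p u)
    obtain i x where p: "p = (i, x)" by fastforce
    note u = reduced_words_Cons[OF Cons.prems[unfolded p]]
    have "h (p # u) = f i x \<otimes>\<^bsub>K\<^esub> h u" by (simp add: p h_def)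
    then show ?case
      using Cons.IH[OF u(3)] u h_letter[OF u(1,2) foldr_letter_mult_closed[OF G u(3) that(2)]]
        h_in[OF u(3)] h_in[OF that(2)] f_in[OF u(1,2)]
      by (simp add: p K.m_assoc)
  qed
  show ?ex
  proof (intro exI conjI ballI)
    show "h \<in> hom (free_product I G) K"
      using h_in h_mult by (auto simp: hom_def free_product_simps)
    show "h (free_product_incl G i x) = f i x" if "i \<in> I" "x \<in> carrier (G i)" for i x
      using that f_in f_one by (auto simp: free_product_incl_def h_def)
  qed
next
  assume h: "h \<in> hom (free_product I G) K" and h': "h' \<in> hom (free_product I G) K"
    and eq: "\<And>i x. \<lbrakk>i \<in> I; x \<in> carrier (G i)\<rbrakk> \<Longrightarrow>
      h (free_product_incl G i x) = h' (free_product_incl G i x)"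
    and w: "w \<in> carrier (free_product I G)"
  interpret F: group "free_product I G" using G by (rule group_free_product)
  have "w \<in> reduced_words I G" using w by (simp add: free_product_simps)
  then show "h w = h' w"
  proof (induction w)
    case Nil
    show ?case using hom_one[OF h F.group_axioms K] hom_one[OF h' F.group_axioms K]
      by (simp add: free_product_simps)
  next
    case (Cons p w)
    obtain i x where p: "p = (i, x)" by fastforce
    note w = reduced_words_Cons[OF Cons.prems[unfolded p]]
    have c: "free_product_incl G i x \<in> carrier (free_product I G)" "w \<in> carrier (free_product I G)"
      using free_product_incl_hom(1)[of I G, OF G w(1)] w by (auto simp: hom_def free_product_simps)
    have "p # w = free_product_incl G i x \<otimes>\<^bsub>free_product I G\<^esub> w"
      using w p by (auto simp: free_product_simps free_product_incl_def letter_mult_one)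
    then show ?case
      using hom_mult[OF h c] hom_mult[OF h' c] eq[OF w(1,2)] Cons.IH[OF w(3)] by simp
  qed
qed

lemma free_product_cong_iso:
  assumes A: "\<And>i. i \<in> I \<Longrightarrow> group (A i)" and B: "\<And>i. i \<in> I \<Longrightarrow> group (B i)"
    and f: "\<And>i. i \<in> I \<Longrightarrow> f i \<in> iso (A i) (B i)"
  shows "free_product I A \<cong> free_product I B"
proof -
  define h where "h = map (\<lambda>(i, x). (i, f i x))"
  define h' where "h' = map (\<lambda>(i, x). (i, inv_into (carrier (A i)) (f i) x))"
  have bij: "bij_betw (f i) (carrier (A i)) (carrier (B i))" and hom: "f i \<in> hom (A i) (B i)"
    if "i \<in> I" for i using f[OF that] by (auto simp: iso_def)
  have one: "f i \<one>\<^bsub>A i\<^esub> = \<one>\<^bsub>B i\<^esub>" if "i \<in> I" for i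
    using hom_one[OF hom A B] that by blast
  have oneA: "\<one>\<^bsub>A i\<^esub> \<in> carrier (A i)" if "i \<in> I" for i
    using A[OF that] by (simp add: group.is_monoid)
  have eq_one: "f i x = \<one>\<^bsub>B i\<^esub> \<longleftrightarrow> x = \<one>\<^bsub>A i\<^esub>" if "i \<in> I" "x \<in> carrier (A i)" for i x
    using bij_betw_imp_inj_on[OF bij[OF that(1)]] oneA[OF that(1)] one[OF that(1)] that(2)
    by (metis inj_on_contraD)
  have in_B: "f i x \<in> carrier (B i)" if "i \<in> I" "x \<in> carrier (A i)" for i x
    using bij_betwE[OF bij] that by blast
  have [simp]: "map fst (h w) = map fst w" "map fst (h' v) = map fst v" for w v
    by (auto simp: h_def h'_def)
  have h_in: "h w \<in> reduced_words I B" if "w \<in> reduced_words I A" for w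
  proof -
    have "set (h w) \<subseteq> (SIGMA i:I. carrier (B i) - {\<one>\<^bsub>B i\<^esub>})"
      using that unfolding h_def by (auto simp: reduced_words_def subset_iff eq_one in_B)
    then show ?thesis using that by (simp add: reduced_words_def)
  qed
  have inv_in: "inv_into (carrier (A i)) (f i) y \<in> carrier (A i)"
      "f i (inv_into (carrier (A i)) (f i) y) = y"
    if "i \<in> I" "y \<in> carrier (B i)" for i y
    using bij_betw_imp_surj_on[OF bij[OF that(1)]] that(2) by (auto intro: inv_into_into f_inv_into_f)
  have inv_one: "inv_into (carrier (A i)) (f i) y \<noteq> \<one>\<^bsub>A i\<^esub>"
    if "i \<in> I" "y \<in> carrier (B i)" "y \<noteq> \<one>\<^bsub>B i\<^esub>" for i y
    using inv_in[OF that(1,2)] one[OF that(1)] that(3) by force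
  have h'_in: "h' w \<in> reduced_words I A" if "w \<in> reduced_words I B" for w
  proof -
    have "set (h' w) \<subseteq> (SIGMA i:I. carrier (A i) - {\<one>\<^bsub>A i\<^esub>})"
      using that unfolding h'_def by (auto simp: reduced_words_def subset_iff inv_in inv_one)
    then show ?thesis using that by (simp add: reduced_words_def)
  qed
  have hh': "h (h' w) = w" if "w \<in> reduced_words I B" for w
    using that by (auto simp: h_def h'_def reduced_words_def inv_in intro!: map_idI)
  have h'h: "h' (h w) = w" if "w \<in> reduced_words I A" for w
    using that by (fastforce simp: h_def h'_def reduced_words_def intro!: map_idI
        inv_into_f_f[OF bij_betw_imp_inj_on[OF bij]])
  have letter: "h (letter_mult A (i, x) w) = letter_mult B (i, f i x) (h w)"
    if "i \<in> I" "x \<in> carrier (A i)" "w \<in> reduced_words I A" for i x w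
  proof (cases w)
    case Nil
    then show ?thesis using that by (simp add: h_def eq_one)
  next
    case (Cons p w')
    obtain j y where p: "p = (j, y)" by fastforce
    note w' = reduced_words_Cons[OF that(3)[unfolded Cons p]]
    interpret Ai: group "A i" using A that by blast
    have hw: "h w = (j, f j y) # h w'" by (simp add: Cons p h_def)
    show ?thesis
    proof (cases "x = \<one>\<^bsub>A i\<^esub> \<or> i \<noteq> j")
      case True
      then show ?thesis
      proof
        assume x: "x = \<one>\<^bsub>A i\<^esub>"
        show ?thesis by (simp only: x one[OF that(1)] letter_mult_one)
      next
        assume ij: "i \<noteq> j"
        have "letter_mult A (i, x) w = (if x = \<one>\<^bsub>A i\<^esub> then w else (i, x) # w)"
          using ij by (simp add: Cons p)
        moreover have "letter_mult B (i, f i x) (h w)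
            = (if f i x = \<one>\<^bsub>B i\<^esub> then h w else (i, f i x) # h w)"
          using ij by (simp add: hw)
        ultimately show ?thesis using eq_one[OF that(1,2)] by (simp add: h_def)
      qed
    next
      case False
      then have ij: "j = i" and x: "x \<noteq> \<one>\<^bsub>A i\<^esub>" by auto
      have y: "y \<in> carrier (A i)" using w'(2) ij by simp
      have fxy: "f i (x \<otimes>\<^bsub>A i\<^esub> y) = f i x \<otimes>\<^bsub>B i\<^esub> f i y"
        using hom_mult[OF hom[OF that(1)] that(2) y] .
      have "letter_mult A (i, x) w
          = (if x \<otimes>\<^bsub>A i\<^esub> y = \<one>\<^bsub>A i\<^esub> then w' else (i, x \<otimes>\<^bsub>A i\<^esub> y) # w')"
        using x by (simp add: Cons p ij)
      moreover have "letter_mult B (i, f i x) (h w)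
          = (if f i (x \<otimes>\<^bsub>A i\<^esub> y) = \<one>\<^bsub>B i\<^esub> then h w' else (i, f i (x \<otimes>\<^bsub>A i\<^esub> y)) # h w')"
        using x eq_one[OF that(1,2)] by (simp add: hw ij fxy)
      ultimately show ?thesis
        using eq_one[OF that(1) Ai.m_closed[OF that(2) y]] by (simp add: h_def)
    qed
  qed
  have mult: "h (foldr (letter_mult A) u v) = foldr (letter_mult B) (h u) (h v)"
    if "u \<in> reduced_words I A" "v \<in> reduced_words I A" for u v
    using that(1)
  proof (induction u)
    case (Cons p u)
    obtain i x where p: "p = (i, x)" by fastforce
    note u = reduced_words_Cons[OF Cons.prems[unfolded p]]
    show ?case
    proof -
      have hp: "h (p # u) = (i, f i x) # h u" by (simp add: p h_def)
      have "foldr (letter_mult A) (p # u) v = letter_mult A (i, x) (foldr (letter_mult A) u v)"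
        by (simp add: p)
      then have "h (foldr (letter_mult A) (p # u) v)
          = letter_mult B (i, f i x) (h (foldr (letter_mult A) u v))"
        using letter[OF u(1,2) foldr_letter_mult_closed[OF A u(3) that(2)]] by (simp only:)
      then show ?thesis by (simp only: Cons.IH[OF u(3)] hp foldr.simps o_apply)
    qed
  qed (simp add: h_def)
  have "bij_betw h (reduced_words I A) (reduced_words I B)"
    using hh' h'h h_in h'_in by (intro bij_betw_byWitness[of _ h']) blast+
  then have "h \<in> iso (free_product I A) (free_product I B)"
    unfolding iso_def hom_def free_product_simps using h_in mult by blast
  then show ?thesis by (rule is_isoI)
qed

section \<open>Freely indecomposable groups\<close>

text \<open>
  The factors range over groups on the element type of \<open>G\<close>. This loses nothing, since the
  factors of a free product embed into it; see \<open>freely_indecomposable_any_type\<close> below.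
\<close>

definition freely_indecomposable :: "'a monoid \<Rightarrow> bool"
  where "freely_indecomposable G \<longleftrightarrow> group G \<and> \<not> trivial_group G \<and>
    \<not> (\<exists>A B :: 'a monoid. group A \<and> group B \<and> \<not> trivial_group A \<and> \<not> trivial_group B \<and>
        G \<cong> binary_free_product A B)"

lemma freely_indecomposable_any_type:
  fixes G :: "'a monoid" and A B :: "'b monoid"
  assumes "freely_indecomposable G" "group A" "group B" "\<not> trivial_group A" "\<not> trivial_group B"
  shows "\<not> G \<cong> binary_free_product A B"
proof
  assume iso: "G \<cong> binary_free_product A B"
  let ?F = "\<lambda>i::nat. if i = 1 then A else B"
  have F: "group (?F i)" if "i \<in> {1, 2}" for i using assms by auto
  interpret G: group G using assms by (simp add: freely_indecomposable_def)
  have G_group: "group G" by (fact G.group_axioms)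
  obtain g where g: "g \<in> iso (binary_free_product A B) G"
    using G.iso_sym[OF iso] by (auto simp: is_iso_def)
  define f where "f i = g \<circ> free_product_incl ?F i" for i
  define H where "H i = G\<lparr>carrier := f i ` carrier (?F i)\<rparr>" for i
  have f_hom: "f i \<in> hom (?F i) G" if "i \<in> {1, 2}" for i
    unfolding f_def using free_product_incl_hom(1)[of "{1, 2}" ?F, OF F that] g
    by (intro hom_compose[of _ _ "binary_free_product A B"]) (auto simp: iso_def)
  have inj: "inj_on (f i) (carrier (?F i))" if "i \<in> {1, 2}" for i
    unfolding f_def
  proof (rule comp_inj_on)
    show "inj_on (free_product_incl ?F i) (carrier (?F i))"
      using free_product_incl_hom(2)[of "{1, 2}" ?F, OF F that] .
    have "free_product_incl ?F i ` carrier (?F i) \<subseteq> carrier (binary_free_product A B)"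
      using free_product_incl_hom(1)[of "{1, 2}" ?F, OF F that] by (auto simp: hom_def)
    then show "inj_on g (free_product_incl ?F i ` carrier (?F i))"
      using g by (auto simp: iso_def bij_betw_def intro: inj_on_subset)
  qed
  have H: "group (H i)" if "i \<in> {1, 2}" for i
  proof -
    interpret group_hom "?F i" G "f i"
      using F[OF that] f_hom[OF that] by (auto simp: group_hom_def group_hom_axioms_def G.group_axioms)
    show ?thesis unfolding H_def
      by (rule subgroup.subgroup_is_group[OF img_is_subgroup G_group])
  qed
  have f_iso: "f i \<in> iso (?F i) (H i)" if "i \<in> {1, 2}" for i
    using f_hom[OF that] inj[OF that] by (auto simp: iso_def hom_def H_def bij_betw_def)
  have nontriv: "\<not> trivial_group (H i)" if "i \<in> {1, 2}" for i
  proof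
    assume "trivial_group (H i)"
    then have "is_singleton (f i ` carrier (?F i))"
      by (auto simp: trivial_group_def H_def is_singleton_def)
    then obtain c where c: "f i ` carrier (?F i) = {c}" by (auto simp: is_singleton_def)
    have one: "\<one>\<^bsub>?F i\<^esub> \<in> carrier (?F i)" using F[OF that] by (simp add: group.is_monoid)
    have "x = \<one>\<^bsub>?F i\<^esub>" if "x \<in> carrier (?F i)" for x
      using c inj[OF \<open>i \<in> {1, 2}\<close>] that one by (metis imageI inj_onD singletonD)
    then have "trivial_group (?F i)" using F[OF that] one unfolding trivial_group_def by blast
    then show False using assms by (auto split: if_splits)
  qed
  have "binary_free_product A B \<cong> free_product {1, 2} H"
    by (rule free_product_cong_iso[of "{1, 2}" ?F H f, OF F H f_iso])
  moreover have "free_product {1, 2} H \<cong> binary_free_product (H 1) (H 2)"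
  proof (rule free_product_cong_iso[where f = "\<lambda>_ x. x"])
    fix i :: nat
    assume i: "i \<in> {1, 2}"
    then have eq: "(if i = 1 then H 1 else H 2) = H i" by auto
    show "group (H i)" by (rule H[OF i])
    show "group (if i = 1 then H 1 else H 2)" unfolding eq by (rule H[OF i])
    show "(\<lambda>x. x) \<in> iso (H i) (if i = 1 then H 1 else H 2)" unfolding eq by (rule iso_set_refl)
  qed
  ultimately have "G \<cong> binary_free_product (H 1) (H 2)"
    by (rule iso_trans[OF iso iso_trans])
  moreover have "group (H 1)" "group (H 2)" "\<not> trivial_group (H 1)" "\<not> trivial_group (H 2)"
    using H[of 1] H[of 2] nontriv[of 1] nontriv[of 2] by simp_all
  ultimately show False using assms(1) unfolding freely_indecomposable_def by blast
qed

section \<open>Characteristic subgroups and Reidemeister numbers\<close>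

definition characteristic_subgroup :: "'a set \<Rightarrow> ('a, 'b) monoid_scheme \<Rightarrow> bool"
  where "characteristic_subgroup H G \<longleftrightarrow> subgroup H G \<and> (\<forall>\<phi>\<in>iso G G. \<phi> ` H = H)"

definition twisted_conjugacy_classes ::
    "('a, 'b) monoid_scheme \<Rightarrow> ('a \<Rightarrow> 'a) \<Rightarrow> 'a set set"
  where "twisted_conjugacy_classes G \<phi> =
    orbits G (carrier G) (\<lambda>g x. g \<otimes>\<^bsub>G\<^esub> x \<otimes>\<^bsub>G\<^esub> \<phi> (inv\<^bsub>G\<^esub> g))"

definition reidemeister_number :: "('a, 'b) monoid_scheme \<Rightarrow> ('a \<Rightarrow> 'a) \<Rightarrow> enat"
  where "reidemeister_number G \<phi> =
    (if finite (twisted_conjugacy_classes G \<phi>)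
     then enat (card (twisted_conjugacy_classes G \<phi>)) else \<infinity>)"

definition R_infinity_property :: "('a, 'b) monoid_scheme \<Rightarrow> bool"
  where "R_infinity_property G \<longleftrightarrow> (\<forall>\<phi>\<in>iso G G. reidemeister_number G \<phi> = \<infinity>)"

end

theory Submission
  imports Defs "HOL-Algebra.Multiplicative_Group" "HOL-Algebra.Sylow"
    "HOL-Combinatorics.Permutations" "HOL-Library.Sublist"
begin

text \<open>
  An indecomposable subgroup of a free product that is not infinite cyclic lies in a conjugate
  of a factor. Hence an automorphism permutes the factors that are not infinite cyclic, up to
  conjugation, and the homomorphisms into a finite group that vanish on suitable subgroups of
  finite index (or on the whole factor, for factors not isomorphic to the first two) form a
  finite set that is invariant under composition with automorphisms. The intersection of their
  kernels is an invariant subgroup of finite index, and it suffices to find infinitely many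
  twisted classes under the action of such a subgroup \<open>K\<close>.

  Unless the relevant quotient of the free product is the infinite dihedral group, a suitable
  \<open>K\<close> maps onto the group generated by a \<open>p\<close>-cycle and a 3-cycle of degree \<open>p\<close>, for all large
  primes \<open>p\<close>. These groups are simple, and for none of their automorphisms is the
  twisted class of the identity the whole group. Since the kernels have finite orbits and
  different nonabelian simple quotients are independent, every such prime contributes a new
  twisted class. The infinite dihedral case is a direct computation.
\<close>

section \<open>Permutation groups of prime degree\<close>

text \<open>The factors need not be finitely generated, so a finite group may receive infinitely
  many homomorphisms from the free product. Vanishing on finite-index subgroups of the factors
  restores finiteness. Infinite cyclic factors carry no such condition, since automorphisms need not
  send them into conjugates of factors; there one value determines the homomorphism.

  In a finite group the twisted class of the identity is everything exactly when the automorphism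
  fixes only the identity. Prime degree is chosen because \<open>p\<close> then divides the group
  order exactly once, so a Sylow argument treats all automorphisms alike, whichever of them \<phi>
  induces.

  The simple quotients come from a finite permutation representation: every point is replaced by
  \<open>p\<close> copies, and loops at one point act on its copies as prescribed permutations. A
  single loop would yield a cyclic group, so two independent ones are needed. They exist if one of
  two nontrivial finite quotients of different factors has order at least three, or if three factors
  have quotients of order two; two factors with quotients of order two leave the dihedral
  case.\<close>

lemma (in group) inv_mult_cancel:
  assumes "x \<in> carrier G" "y \<in> carrier G"
  shows "inv x \<otimes> (x \<otimes> y) = y" "x \<otimes> (inv x \<otimes> y) = y"
  using assms by (simp_all flip: m_assoc)

lemma (in group) conj_hom:
  assumes "x \<in> carrier G"
  shows "(\<lambda>y. x \<otimes> y \<otimes> inv x) \<in> hom G G"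
proof (rule homI)
  fix y z assume yz: "y \<in> carrier G" "z \<in> carrier G"
  show "x \<otimes> (y \<otimes> z) \<otimes> inv x = x \<otimes> y \<otimes> inv x \<otimes> (x \<otimes> z \<otimes> inv x)"
    using assms yz by (simp add: m_assoc inv_mult_cancel)
qed (use assms in auto)

lemma (in group) int_pow_conj:
  assumes "x \<in> carrier G" "b \<in> carrier G"
  shows "(x \<otimes> b \<otimes> inv x) [^] (n::int) = x \<otimes> b [^] n \<otimes> inv x"
  using hom_int_pow[OF conj_hom[OF assms(1)] assms(2) is_group is_group] by simp

text \<open>This is Sylow conjugacy for subgroups of order \<open>p\<close>. If \<open>a\<close>
  were not conjugate to a power of \<open>b\<close>, all double cosets of the two cyclic subgroups
  would have \<open>p * p\<close> elements, and \<open>p * p\<close> would divide the group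
  order.\<close>

lemma (in group) conjugate_elements_of_prime_order:
  assumes fin: "finite (carrier G)" and p: "prime p" "\<not> p * p dvd order G"
    and a: "a \<in> carrier G" "ord a = p" and b: "b \<in> carrier G" "ord b = p"
  shows "\<exists>s\<in>carrier G. \<exists>m::int. a = s \<otimes> b [^] m \<otimes> inv s"
proof (rule ccontr)
  assume no: "\<not> ?thesis"
  define R where "R = {(x, y). x \<in> carrier G \<and> y \<in> carrier G \<and> (\<exists>(i::int) (j::int). y = a [^] i \<otimes> x \<otimes> b [^] j)}"
  have "refl_on (carrier G) R"
  proof (rule refl_onI)
    fix x assume "x \<in> carrier G"
    then have "\<exists>(i::int) (j::int). x = a [^] i \<otimes> x \<otimes> b [^] j" by (intro exI[of _ 0]) simp
    with \<open>x \<in> carrier G\<close> show "(x, x) \<in> R" by (auto simp: R_def)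
  qed
  moreover have "sym R"
  proof (rule symI)
    fix x y assume "(x, y) \<in> R"
    then obtain i j :: int where *: "x \<in> carrier G" "y \<in> carrier G" "y = a [^] i \<otimes> x \<otimes> b [^] j"
      unfolding R_def by blast
    have "a [^] (-i) \<otimes> y \<otimes> b [^] (-j) = (a [^] (-i) \<otimes> a [^] i) \<otimes> x \<otimes> (b [^] j \<otimes> b [^] (-j))"
      using * a b by (simp add: m_assoc)
    also have "\<dots> = x" using * a b by (simp flip: int_pow_mult)
    finally show "(y, x) \<in> R" unfolding R_def using * by force
  qed
  moreover have "trans R"
  proof (rule transI)
    fix x y z assume "(x, y) \<in> R" "(y, z) \<in> R"
    then obtain i j k l :: int where *: "x \<in> carrier G" "y \<in> carrier G" "z \<in> carrier G"
      "y = a [^] i \<otimes> x \<otimes> b [^] j" "z = a [^] k \<otimes> y \<otimes> b [^] l"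
      unfolding R_def by blast
    have "z = a [^] (k + i) \<otimes> x \<otimes> b [^] (j + l)"
      using * a b by (simp add: m_assoc int_pow_mult)
    then show "(x, z) \<in> R" unfolding R_def using * by blast
  qed
  moreover have "R \<subseteq> carrier G \<times> carrier G" by (auto simp: R_def)
  ultimately have equiv: "equiv (carrier G) R" by (simp add: equiv_def)
  have red: "c [^] i = c [^] (i mod int p)" if "c \<in> carrier G" "ord c = p" for c and i :: int
    using that mod_eq_dvd_iff[of "i mod int p" "int p" i] by (simp add: int_pow_eq)
  have "p * p dvd card X" if X: "X \<in> carrier G // R" for X
  proof -
    obtain x where x: "x \<in> carrier G" "X = R `` {x}" using X by (auto elim: quotientE)
    let ?f = "\<lambda>(i, j). a [^] (i::int) \<otimes> x \<otimes> b [^] (j::int)"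
    let ?I = "{0..<int p}"
    have "inj_on ?f (?I \<times> ?I)"
    proof (rule inj_onI, clarify)
      fix i j i' j'
      assume I: "i \<in> ?I" "j \<in> ?I" "i' \<in> ?I" "j' \<in> ?I"
        and eq: "a [^] i \<otimes> x \<otimes> b [^] j = a [^] i' \<otimes> x \<otimes> b [^] j'"
      have "a [^] (i - i') = a [^] (-i') \<otimes> (a [^] i \<otimes> x \<otimes> b [^] j) \<otimes> b [^] (-j) \<otimes> inv x"
      proof -
        have "a [^] (-i') \<otimes> (a [^] i \<otimes> x \<otimes> b [^] j) \<otimes> b [^] (-j) \<otimes> inv x
            = (a [^] (-i') \<otimes> a [^] i) \<otimes> (x \<otimes> (b [^] j \<otimes> b [^] (-j)) \<otimes> inv x)"
          using a b x by (simp add: m_assoc)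
        also have "\<dots> = a [^] (i - i')" using a b x by (simp flip: int_pow_mult)
        finally show ?thesis by simp
      qed
      also have "\<dots> = (a [^] (-i') \<otimes> a [^] i') \<otimes> x \<otimes> (b [^] j' \<otimes> b [^] (-j)) \<otimes> inv x"
        unfolding eq using a b x by (simp add: m_assoc)
      also have "\<dots> = x \<otimes> b [^] (j' - j) \<otimes> inv x"
        using a b x by (simp flip: int_pow_mult)
      finally have conj: "a [^] (i - i') = x \<otimes> b [^] (j' - j) \<otimes> inv x" .
      have i: "i = i'"
      proof (rule ccontr)
        assume "i \<noteq> i'"
        then have "i mod int p \<noteq> i' mod int p" using I by simp
        then have "\<not> int p dvd (i - i')" by (simp add: mod_eq_dvd_iff)
        then have "coprime (int p) (i - i')"
          using p(1) by (simp add: prime_imp_coprime)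
        then have "gcd (i - i') (int p) = 1" by (simp add: coprime_iff_gcd_eq_1 gcd.commute)
        \<comment> \<open>\<open>r\<close> inverts \<open>i - i'\<close> modulo \<open>p\<close>;
          raising \<open>conj\<close> to the \<open>r\<close>-th power exhibits \<open>a\<close>
          itself as a conjugate of a power of \<open>b\<close>.\<close>
        then obtain r v where "r * (i - i') + v * int p = 1" using bezout_int[of "i - i'" "int p"] by auto
        then have "(i - i') * r - 1 = int p * (- v)" by (simp add: algebra_simps)
        then have r: "(i - i') * r mod int p = 1 mod int p" by (simp add: mod_eq_dvd_iff)
        have "a = a [^] (1 mod int p)" using red[OF a, of 1] a by simp
        also have "\<dots> = a [^] ((i - i') * r)"
          using red[OF a, of "(i - i') * r"] r by simp
        also have "\<dots> = (a [^] (i - i')) [^] r"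
          using a by (simp add: int_pow_pow)
        also have "\<dots> = x \<otimes> b [^] ((j' - j) * r) \<otimes> inv x"
          unfolding conj using x b by (simp add: int_pow_conj int_pow_pow)
        finally show False using no x by blast
      qed
      then have one: "x \<otimes> b [^] (j' - j) \<otimes> inv x = \<one>" using conj by simp
      have "b [^] (j' - j) = inv x \<otimes> (x \<otimes> b [^] (j' - j) \<otimes> inv x) \<otimes> x"
        using x b by (simp add: m_assoc inv_mult_cancel)
      then have "b [^] (j' - j) = \<one>" using one x by simp
      then have "int p dvd j' - j" using b by (simp add: int_pow_eq_id)
      then have "j' mod int p = j mod int p" by (simp add: mod_eq_dvd_iff)
      then show "i = i' \<and> j = j'" using i I by auto
    qed
    moreover have "?f ` (?I \<times> ?I) = X"
    proof safe
      fix i j :: int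
      show "a [^] i \<otimes> x \<otimes> b [^] j \<in> X" using x a b by (auto simp: R_def)
    next
      fix y assume "y \<in> X"
      then obtain i j :: int where "y = a [^] i \<otimes> x \<otimes> b [^] j" using x by (auto simp: R_def)
      then have "y = ?f (i mod int p, j mod int p)" using red[OF a, of i] red[OF b, of j] by simp
      moreover have "(i mod int p, j mod int p) \<in> ?I \<times> ?I"
        using p(1) prime_gt_0_nat by auto
      ultimately show "y \<in> ?f ` (?I \<times> ?I)" by blast
    qed
    ultimately have "card X = card (?I \<times> ?I)" by (metis card_image)
    then show ?thesis by (simp add: card_cartesian_product)
  qed
  then have "p * p dvd card (carrier G)"
    using equiv_imp_dvd_card[OF fin equiv] by blast
  then show False using p by (simp add: order_def)
qed

lemma (in group) ord_subgroup:
  assumes "subgroup H G" "x \<in> H"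
  shows "group.ord (G\<lparr>carrier := H\<rparr>) x = ord x"
proof -
  interpret H: group "G\<lparr>carrier := H\<rparr>" using assms(1) by (rule subgroup_imp_group)
  have "x \<in> carrier G" using assms subgroup.subset by blast
  then show ?thesis
    using assms by (subst H.ord_unique) (auto simp: pow_eq_id nat_pow_consistent[symmetric])
qed

lemma (in group) cauchy_prime:
  assumes "finite (carrier G)" "prime p" "p dvd order G"
  shows "\<exists>x\<in>carrier G. ord x = p"
proof -
  obtain m where "order G = p ^ 1 * m" using assms by auto
  then obtain H where H: "subgroup H G" "card H = p"
    using sylow_thm[OF assms(2) is_group _ assms(1), of 1 m] by auto
  have "\<not> H \<subseteq> {\<one>}"
  proof
    assume "H \<subseteq> {\<one>}"
    then have "card H \<le> 1" using card_mono[of "{\<one>}" H] by simp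
    then show False using H prime_ge_2_nat[OF assms(2)] by simp
  qed
  then obtain x where x: "x \<in> H" "x \<noteq> \<one>" by blast
  interpret H: group "G\<lparr>carrier := H\<rparr>" using H subgroup_imp_group by blast
  have xG: "x \<in> carrier G" using x H subgroup.subset by blast
  have "H.ord x dvd p" using H.ord_dvd_group_order[of x] x H by (simp add: order_def)
  moreover have "H.ord x = ord x" by (rule ord_subgroup[OF H(1) x(1)])
  ultimately show ?thesis using x xG assms(2) ord_eq_1 by (metis prime_nat_iff)
qed

section \<open>Symmetric groups on arbitrary sets\<close>

definition perm_group :: "'b set \<Rightarrow> ('b \<Rightarrow> 'b) monoid"
  where "perm_group A = \<lparr>carrier = {f. f permutes A}, monoid.mult = (\<circ>), one = id\<rparr>"

lemma perm_group_simps [simp]: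
  "carrier (perm_group A) = {f. f permutes A}"
  "f \<otimes>\<^bsub>perm_group A\<^esub> g = f \<circ> g"
  "\<one>\<^bsub>perm_group A\<^esub> = id"
  by (simp_all add: perm_group_def)

lemma group_perm_group: "group (perm_group A)"
proof (rule groupI)
  fix f assume "f \<in> carrier (perm_group A)"
  then show "\<exists>g\<in>carrier (perm_group A). g \<otimes>\<^bsub>perm_group A\<^esub> f = \<one>\<^bsub>perm_group A\<^esub>"
    using permutes_inv[of f A] permutes_inv_o(2)[of f A] by auto
qed (auto simp: permutes_compose comp_assoc permutes_id)

lemma inv_perm_group:
  assumes "f permutes A"
  shows "inv\<^bsub>perm_group A\<^esub> f = inv_into UNIV f"
  by (rule group.inv_equality[OF group_perm_group])
    (use assms in \<open>simp_all add: permutes_inv permutes_inv_o\<close>)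

lemma order_perm_group: "finite A \<Longrightarrow> order (perm_group A) = fact (card A)"
  by (simp add: order_def card_permutations)

lemma finite_perm_group: "finite A \<Longrightarrow> finite (carrier (perm_group A))"
  by (simp add: finite_permutations)

section \<open>The alternating group of prime degree\<close>

locale prime_degree =
  fixes p :: nat
  assumes prime_p: "prime p" and p_ge_5: "p \<ge> 5"
begin

definition rot :: "nat \<Rightarrow> nat"
  where "rot x = (if x < p then (x + 1) mod p else x)"

definition tri :: "nat \<Rightarrow> nat"
  where "tri x = (if x = 0 then 1 else if x = 1 then 2 else if x = 2 then 0 else x)"

text \<open>This is the alternating group of degree \<open>p\<close>. The arguments below start from
  its transitivity, the exact divisibility of its order by \<open>p\<close>, and a relation between
  \<open>tri\<close> and its conjugate by \<open>rot\<close>.\<close>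

definition S :: "(nat \<Rightarrow> nat) set"
  where "S = generate (perm_group {..<p}) {rot, tri}"

definition SG :: "(nat \<Rightarrow> nat) monoid"
  where "SG = (perm_group {..<p})\<lparr>carrier := S\<rparr>"

lemma rot_pow: "(rot ^^ k) x = (if x < p then (x + k) mod p else x)"
  using p_ge_5 by (induction k) (simp_all add: rot_def mod_Suc_eq)

lemma rot_permutes: "rot permutes {..<p}"
proof (rule bij_imp_permutes)
  have "inj_on rot {..<p}"
  proof (rule inj_onI)
    fix x y assume *: "x \<in> {..<p}" "y \<in> {..<p}" "rot x = rot y"
    then have "(x + 1) mod p = (y + 1) mod p" by (simp add: rot_def)
    then have "(x + 1 + (p - 1)) mod p = (y + 1 + (p - 1)) mod p" by (metis mod_add_left_eq)
    then show "x = y" using * p_ge_5 by simp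
  qed
  moreover have "rot ` {..<p} \<subseteq> {..<p}" using p_ge_5 by (auto simp: rot_def)
  ultimately show "bij_betw rot {..<p} {..<p}"
    by (simp add: bij_betw_def endo_inj_surj)
qed (simp add: rot_def)

lemma tri_permutes: "tri permutes {..<p}"
proof (rule permutes_subset)
  show "tri permutes {0, 1, 2}"
    by (rule bij_imp_permutes) (auto simp: bij_betw_def inj_on_def tri_def)
qed (use p_ge_5 in auto)

sublocale P: group "perm_group {..<p}" by (rule group_perm_group)

lemma S_subgroup: "subgroup S (perm_group {..<p})"
  unfolding S_def using rot_permutes tri_permutes by (intro P.generate_is_subgroup) auto

sublocale SG: group SG
  unfolding SG_def using S_subgroup by (rule P.subgroup_imp_group)

lemma SG_simps [simp]:
  "carrier SG = S" "f \<otimes>\<^bsub>SG\<^esub> g = f \<circ> g" "\<one>\<^bsub>SG\<^esub> = id" "f [^]\<^bsub>SG\<^esub> (n::nat) = f ^^ n"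
  by (simp_all add: SG_def) (induction n; simp add: nat_pow_def perm_group_def funpow_swap1 fun_eq_iff)

lemma S_permutes: "f \<in> S \<Longrightarrow> f permutes {..<p}"
  using subgroup.subset[OF S_subgroup] by auto

lemma S_lt: "f \<in> S \<Longrightarrow> f x < p \<longleftrightarrow> x < p"
  using S_permutes permutes_in_image by fastforce

lemma rot_S: "rot \<in> S" and tri_S: "tri \<in> S"
  unfolding S_def by (auto intro: generate.incl)

lemma S_comp: "f \<in> S \<Longrightarrow> g \<in> S \<Longrightarrow> f \<circ> g \<in> S"
  using SG.m_closed by simp

lemma rot_pow_S: "rot ^^ k \<in> S"
  using SG.nat_pow_closed[of rot k] rot_S by simp

lemma inv_SG: "f \<in> S \<Longrightarrow> inv\<^bsub>SG\<^esub> f = inv_into UNIV f"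
  unfolding SG_def by (simp add: P.m_inv_consistent[OF S_subgroup] inv_perm_group S_permutes)

lemma finite_S: "finite S"
  using S_permutes finite_permutations[of "{..<p}"] by (auto intro: finite_subset[rotated])

lemma ord_rot: "SG.ord rot = p"
proof (subst SG.ord_unique)
  show "\<forall>n. (rot [^]\<^bsub>SG\<^esub> n = \<one>\<^bsub>SG\<^esub>) = (p dvd n)"
    using p_ge_5 by (auto simp: fun_eq_iff rot_pow mod_eq_0_iff_dvd dest: spec[of _ 0])
qed (simp add: rot_S)

text \<open>The order divides \<open>fact p\<close>, in which the prime \<open>p\<close> occurs only
  once.\<close>

lemma p_square_not_dvd: "\<not> p * p dvd order SG"
proof
  assume "p * p dvd order SG"
  moreover have "order SG dvd fact p"
    using P.lagrange[OF S_subgroup] order_perm_group[of "{..<p}"] by (metis SG_simps(1) card_lessThan dvd_triv_right finite_lessThan order_def)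
  ultimately have "p * p dvd p * fact (p - 1)"
    using p_ge_5 fact_reduce[of p, where 'a=nat] by (metis dvd_trans of_nat_id not_numeral_le_zero not_gr_zero)
  then have "p dvd fact (p - 1)" using p_ge_5 by simp
  then show False using prime_p p_ge_5 by (simp add: prime_dvd_fact_iff)
qed

text \<open>Powers of \<open>rot\<close> carry 0 to every point, so a map that commutes with them is
  determined by its value at 0.\<close>

lemma centralizer_rot:
  assumes "f \<in> S" "f \<circ> rot = rot \<circ> f"
  shows "f = rot ^^ f 0"
proof
  have comm: "f \<circ> rot ^^ k = rot ^^ k \<circ> f" for k
  proof (induction k)
    case (Suc k)
    then show ?case using assms(2) by (metis comp_assoc funpow_Suc_right)
  qed simp
  fix x
  show "f x = (rot ^^ f 0) x"
  proof (cases "x < p")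
    case True
    then have "f x = f ((rot ^^ x) 0)" using p_ge_5 by (simp add: rot_pow)
    also have "\<dots> = (rot ^^ x) (f 0)" using comm[of x] by (metis comp_apply)
    also have "\<dots> = (rot ^^ f 0) x" using True S_lt[OF assms(1), of 0] by (simp add: rot_pow add.commute)
    finally show ?thesis .
  next
    case False
    then show ?thesis using S_permutes[OF assms(1)] by (simp add: rot_pow permutes_not_in)
  qed
qed

definition U :: "(nat \<Rightarrow> nat) set" where "U = {f \<in> S. f 0 = 0}"

text \<open>The powers of \<open>rot\<close> represent the cosets of the point stabiliser
  \<open>U\<close>.\<close>

lemma card_S: "card S = card U * p"
proof -
  let ?f = "\<lambda>(u, k). rot ^^ k \<circ> u"
  have "inj_on ?f (U \<times> {..<p})"
  proof (rule inj_onI)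
    fix a b assume "a \<in> U \<times> {..<p}" "b \<in> U \<times> {..<p}" "?f a = ?f b"
    moreover obtain u k v l where ab: "a = (u, k)" "b = (v, l)" by fastforce
    ultimately have *: "u \<in> U" "k \<in> {..<p}" "v \<in> U" "l \<in> {..<p}" "rot ^^ k \<circ> u = rot ^^ l \<circ> v"
      by simp_all
    from *(5) have "(rot ^^ k) (u 0) = (rot ^^ l) (v 0)" by (metis comp_apply)
    then have kl: "k = l" using *(1-4) p_ge_5 by (simp add: U_def rot_pow)
    moreover have "u = v"
    proof
      fix x
      have "(rot ^^ k) (u x) = (rot ^^ k) (v x)" using *(5) kl by (metis comp_apply)
      then show "u x = v x" using permutes_inj[OF S_permutes[OF rot_pow_S[of k]]] by (simp add: inj_eq)
    qed
    ultimately show "a = b" using ab by simp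
  qed
  moreover have "?f ` (U \<times> {..<p}) = S"
  proof (intro equalityI subsetI)
    fix s assume "s \<in> ?f ` (U \<times> {..<p})"
    then show "s \<in> S" by (auto simp: U_def S_comp rot_pow_S)
  next
    fix s assume s: "s \<in> S"
    define k where "k = s 0"
    have k: "k < p" using S_lt[OF s, of 0] p_ge_5 by (simp add: k_def)
    have eq: "rot ^^ k \<circ> rot ^^ (p - k) = id"
      using k by (simp add: fun_eq_iff rot_pow flip: funpow_add)
    have "rot ^^ (p - k) \<circ> s \<in> U"
      using s k p_ge_5 by (simp add: U_def S_comp rot_pow_S rot_pow flip: k_def)
    moreover have "s = ?f (rot ^^ (p - k) \<circ> s, k)"
      by (simp add: eq flip: comp_assoc)
    ultimately show "s \<in> ?f ` (U \<times> {..<p})" using k by blast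
  qed
  ultimately show ?thesis by (metis card_image card_cartesian_product card_lessThan)
qed

text \<open>The orbits of a normal subgroup are blocks of equal size dividing \<open>p\<close>, so a
  nontrivial \<open>N\<close> is transitive. Then \<open>p\<close> divides its order, and
  \<open>rot\<close> is conjugate to a power of an element of order \<open>p\<close> in
  \<open>N\<close>.\<close>

lemma normal_contains_rot:
  assumes N: "N \<lhd> SG" "N \<noteq> {id}"
  shows "rot \<in> N"
proof -
  interpret N: normal N SG by (rule N)
  have NS: "N \<subseteq> S" using N.subset by simp
  define B where "B x = (\<lambda>n. n x) ` N" for x :: nat
  define N0 where "N0 = {n \<in> N. n 0 = 0}"
  have conj: "s \<circ> n \<circ> inv_into UNIV s \<in> N" if "s \<in> S" "n \<in> N" for s n
    using N.inv_op_closed2[of s n] that by (simp add: inv_SG)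
  have Bs: "B (s x) = s ` B x" if "s \<in> S" for s x
  proof -
    have *: "s ` B x \<subseteq> B (s x)" if s: "s \<in> S" for s x
    proof safe
      fix y assume "y \<in> B x"
      then obtain n where n: "n \<in> N" "y = n x" by (auto simp: B_def)
      have "s y = (s \<circ> n \<circ> inv_into UNIV s) (s x)"
        using n permutes_inverses(2)[OF S_permutes[OF s]] by simp
      then show "s y \<in> B (s x)" unfolding B_def using conj[OF s n(1)] by blast
    qed
    have "inv_into UNIV s \<in> S" using SG.inv_closed[of s] that by (simp add: inv_SG)
    from *[OF this, of "s x"] have "inv_into UNIV s ` B (s x) \<subseteq> B x"
      using permutes_inverses(2)[OF S_permutes[OF that]] by simp
    then have "s ` inv_into UNIV s ` B (s x) \<subseteq> s ` B x" by blast
    then have "B (s x) \<subseteq> s ` B x"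
      using permutes_inverses(1)[OF S_permutes[OF that]] by (simp add: image_image)
    with *[OF that, of x] show ?thesis by blast
  qed
  have rot0: "(rot ^^ x) 0 = x" if "x < p" for x using that by (simp add: rot_pow)
  have cardB: "card (B x) = card (B 0)" if "x < p" for x
    using Bs[OF rot_pow_S, of x 0] permutes_inj[OF S_permutes[OF rot_pow_S[of x]]] rot0[OF that]
    by (simp add: card_image inj_on_subset)
  have B_self: "x \<in> B x" for x unfolding B_def using N.one_closed by (intro image_eqI[of _ _ id]) simp_all
  have B_sub: "B x \<subseteq> {..<p}" if "x < p" for x using NS S_lt that by (auto simp: B_def)
  have B_eq: "B y = B x" if y: "y \<in> B x" for x y
  proof -
    obtain n where n: "n \<in> N" "y = n x" using y unfolding B_def by blast
    have "B y = (\<lambda>m. (m \<circ> n) x) ` N" using n by (simp add: B_def)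
    also have "\<dots> = (\<lambda>k. k x) ` ((\<lambda>m. m \<circ> n) ` N)" by (simp add: image_image)
    also have "(\<lambda>m. m \<circ> n) ` N = N"
    proof safe
      fix m assume "m \<in> N" then show "m \<circ> n \<in> N" using N.m_closed[of m n] n by simp
    next
      fix m assume m: "m \<in> N"
      have "m \<circ> inv_into UNIV n \<in> N"
        using N.m_closed[OF m N.m_inv_closed[OF n(1)]] NS n by (simp add: inv_SG subsetD)
      moreover have "m = (m \<circ> inv_into UNIV n) \<circ> n"
        using permutes_inv_o(2)[OF S_permutes] NS n by (simp add: comp_assoc subsetD)
      ultimately show "m \<in> (\<lambda>m. m \<circ> n) ` N" by blast
    qed
    finally show ?thesis by (simp add: B_def)
  qed
  have "card (B 0) * card (B ` {..<p}) = card (\<Union> (B ` {..<p}))"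
  proof (rule card_partition)
    show "finite (B ` {..<p})" by simp
    show "finite (\<Union> (B ` {..<p}))" using B_sub by (auto intro: finite_subset[of _ "{..<p}"])
    show "card c = card (B 0)" if "c \<in> B ` {..<p}" for c using that cardB by auto
    show "c1 \<inter> c2 = {}" if "c1 \<in> B ` {..<p}" "c2 \<in> B ` {..<p}" "c1 \<noteq> c2" for c1 c2
      using that B_eq by blast
  qed
  also have "\<Union> (B ` {..<p}) = {..<p}" using B_sub B_self by blast
  finally have "card (B 0) dvd p" by (metis card_lessThan dvd_triv_left)
  then have dis: "card (B 0) = 1 \<or> card (B 0) = p"
    by (rule prime_nat_iff[THEN iffD1, OF prime_p, THEN conjunct2, rule_format])
  show ?thesis
  proof (cases "card (B 0) = 1")
    case 1: True
    have "n = id" if n: "n \<in> N" for n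
    proof
      fix x
      show "n x = id x"
      proof (cases "x < p")
        case True
        then have "card (B x) = 1" using 1 cardB[OF True] by simp
        then obtain b where "B x = {b}" by (auto simp: card_1_singleton_iff)
        moreover have "n x \<in> B x" using n by (auto simp: B_def)
        ultimately show ?thesis using B_self[of x] by simp
      next
        case False
        then show ?thesis using permutes_not_in[OF S_permutes[of n], of x] n NS by auto
      qed
    qed
    then show ?thesis using N(2) N.one_closed by auto
  next
    case False
    then have 2: "card (B 0) = p" using dis by simp
    \<comment> \<open>Orbit-stabiliser count, with coset representatives \<open>r k\<close> chosen
      inside \<open>N\<close>, since \<open>rot\<close> is not yet known to belong to it.\<close>
    have "card N = card N0 * p"
    proof -
      have t: "\<exists>n\<in>N. n 0 = k" if "k < p" for k
      proof -
        have "B 0 = {..<p}" using 2 B_sub[of 0] p_ge_5 by (intro card_subset_eq) auto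
        then have "k \<in> B 0" using \<open>k < p\<close> by simp
        then show ?thesis unfolding B_def by blast
      qed
      define r where "r k = (SOME n. n \<in> N \<and> n 0 = k)" for k
      have r: "r k \<in> N" "r k 0 = k" if "k < p" for k
        using someI_ex[of "\<lambda>n. n \<in> N \<and> n 0 = k"] t[OF that] by (auto simp: r_def)
      let ?f = "\<lambda>(u, k). r k \<circ> u"
      have rinj: "inj (r k)" if "k < p" for k
        using permutes_inj[OF S_permutes] r(1)[OF that] NS by blast
      have "inj_on ?f (N0 \<times> {..<p})"
      proof (rule inj_onI, clarify)
        fix u k v l assume *: "u \<in> N0" "k < p" "v \<in> N0" "l < p" "r k \<circ> u = r l \<circ> v"
        from *(5) have "r k (u 0) = r l (v 0)" by (metis comp_apply)
        then have kl: "k = l" using *(1-4) r by (simp add: N0_def)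
        moreover have "u = v"
        proof
          fix x
          have "r k (u x) = r k (v x)" using *(5) kl by (metis comp_apply)
          then show "u x = v x" using rinj[of k] *(2) by (simp add: inj_eq)
        qed
        ultimately show "u = v \<and> k = l" by simp
      qed
      moreover have "?f ` (N0 \<times> {..<p}) = N"
      proof safe
        fix u k assume "u \<in> N0" "k < p"
        then show "r k \<circ> u \<in> N" using N.m_closed[of "r k" u] r by (simp add: N0_def)
      next
        fix n assume n: "n \<in> N"
        define k where "k = n 0"
        have k: "k < p" using S_lt[of n 0] n NS p_ge_5 by (auto simp: k_def)
        have rS: "r k \<in> S" using r k NS by blast
        have "inv_into UNIV (r k) \<circ> n \<in> N"
          using N.m_closed[OF N.m_inv_closed[OF r(1)[OF k]] n] rS by (simp add: inv_SG)
        moreover have "inv_into UNIV (r k) (n 0) = 0"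
          using r(2)[OF k] k_def permutes_inverses(2)[OF S_permutes[OF rS], of 0] by simp
        ultimately have "inv_into UNIV (r k) \<circ> n \<in> N0" by (simp add: N0_def)
        moreover have "n = ?f (inv_into UNIV (r k) \<circ> n, k)"
          using permutes_inv_o(1)[OF S_permutes[OF rS]] by (simp flip: comp_assoc)
        ultimately show "n \<in> ?f ` (N0 \<times> {..<p})" using k by blast
      qed
      ultimately show ?thesis by (metis card_image card_cartesian_product card_lessThan)
    qed
    then have "p dvd order (SG\<lparr>carrier := N\<rparr>)" by (simp add: order_def)
    interpret NG: group "SG\<lparr>carrier := N\<rparr>" by (rule SG.subgroup_imp_group[OF N.subgroup_axioms])
    obtain c where c: "c \<in> N" "NG.ord c = p"
      using NG.cauchy_prime[OF _ prime_p \<open>p dvd _\<close>] finite_subset[OF NS finite_S] by auto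
    have cS: "c \<in> S" using c NS by blast
    have "SG.ord c = NG.ord c"
      using SG.ord_subgroup[OF N.subgroup_axioms c(1)] by simp
    then obtain s and m :: int where s: "s \<in> S" "rot = s \<otimes>\<^bsub>SG\<^esub> c [^]\<^bsub>SG\<^esub> m \<otimes>\<^bsub>SG\<^esub> inv\<^bsub>SG\<^esub> s"
      using SG.conjugate_elements_of_prime_order[OF _ prime_p p_square_not_dvd, of rot c] rot_S cS c ord_rot finite_S
      by auto
    have "c [^]\<^bsub>SG\<^esub> m \<in> N" by (rule SG.subgroup_int_pow_closed[OF N.subgroup_axioms c(1)])
    then show ?thesis using N.inv_op_closed2[of s] s by simp
  qed
qed

text \<open>With \<open>rot\<close> in \<open>N\<close>, the map \<open>tri\<close> and its
  conjugate \<open>u\<close> agree modulo \<open>N\<close>. Since \<open>tri \<circ> u\<close> is an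
  involution, the fourth power of \<open>tri\<close> is trivial modulo \<open>N\<close>; its third
  power is trivial anyway, so \<open>tri\<close> lies in \<open>N\<close>.\<close>

lemma S_simple:
  assumes N: "N \<lhd> SG" "N \<noteq> {id}"
  shows "N = S"
proof -
  interpret N: normal N SG by (rule N)
  have rot: "rot \<in> N" by (rule normal_contains_rot[OF N])
  define r' where "r' = inv_into UNIV rot"
  have r': "r' \<in> N" using N.m_inv_closed[OF rot] rot_S by (simp add: inv_SG r'_def)
  have r'_rot: "r' (rot x) = x" for x
    using permutes_inverses(2)[OF rot_permutes] by (simp add: r'_def)
  define u where "u = rot \<circ> tri \<circ> r'"
  have u_rot: "u (rot y) = rot (tri y)" for y by (simp add: u_def r'_rot)
  have u: "u x = (if x = 1 then 2 else if x = 2 then 3 else if x = 3 then 1 else x)" for x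
  proof -
    obtain y where y: "x = rot y" using permutes_surj[OF rot_permutes] by (metis surjD)
    consider "y = 0" | "y = 1" | "y = 2" | "2 < y" "y < p - 1" | "y = p - 1" | "y \<ge> p" by linarith
    then have "rot (tri y) = (if rot y = 1 then 2 else if rot y = 2 then 3 else if rot y = 3 then 1 else rot y)"
      using p_ge_5 by cases (simp_all add: rot_def tri_def)
    then show ?thesis using u_rot[of y] y by simp
  qed
  have tri3: "tri \<circ> tri \<circ> tri = id" by (auto simp: fun_eq_iff tri_def)
  have rel: "tri \<circ> u \<circ> tri \<circ> u = id" by (auto simp: fun_eq_iff tri_def u)
  have inv_tri: "inv\<^bsub>SG\<^esub> tri = tri \<circ> tri"
    by (rule SG.inv_equality) (use tri3 tri_S S_comp in \<open>simp_all add: comp_assoc\<close>)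
  define m where "m = rot \<circ> (tri \<circ> r' \<circ> (tri \<circ> tri))"
  have m: "m \<in> N"
    using N.m_closed[OF rot N.inv_op_closed2[OF _ r', of tri]] tri_S by (simp add: inv_tri m_def)
  have "tri \<circ> m \<circ> (tri \<circ> tri) \<in> N"
    using N.inv_op_closed2[OF _ m, of tri] tri_S by (simp add: inv_tri)
  then have mm: "tri \<circ> m \<circ> (tri \<circ> tri) \<circ> m \<in> N" using N.m_closed[OF _ m] by simp
  have "u = m \<circ> tri" using tri3 by (simp add: m_def u_def comp_assoc)
  then have "(tri \<circ> m \<circ> (tri \<circ> tri) \<circ> m) \<circ> tri = id" using rel by (simp add: comp_assoc)
  then have "inv\<^bsub>SG\<^esub> tri = tri \<circ> m \<circ> (tri \<circ> tri) \<circ> m"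
    using N.subset mm tri_S by (intro SG.inv_equality) auto
  then have "tri \<in> N" using N.m_inv_closed[OF mm] tri_S SG.inv_inv[of tri] by simp
  moreover have "subgroup N (perm_group {..<p})"
    using P.incl_subgroup[OF S_subgroup] N.subgroup_axioms by (simp add: SG_def)
  ultimately have "S \<subseteq> N" unfolding S_def using rot by (intro P.generate_subgroup_incl) auto
  then show ?thesis using N.subset by auto
qed

lemma rot_tri_noncommute: "rot \<circ> tri \<noteq> tri \<circ> rot"
proof
  assume "rot \<circ> tri = tri \<circ> rot"
  then have "(rot \<circ> tri) 1 = (tri \<circ> rot) 1" by simp
  then show False using p_ge_5 by (simp add: rot_def tri_def)
qed

lemma commutes_rot_iff: "f \<in> S \<Longrightarrow> f \<circ> rot = rot \<circ> f \<longleftrightarrow> (\<exists>k::int. f = rot [^]\<^bsub>SG\<^esub> k)"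
proof
  assume "f \<in> S" "f \<circ> rot = rot \<circ> f"
  then have "f = rot ^^ f 0" by (rule centralizer_rot)
  then have "f = rot [^]\<^bsub>SG\<^esub> int (f 0)" by (simp add: int_pow_int)
  then show "\<exists>k::int. f = rot [^]\<^bsub>SG\<^esub> k" by blast
next
  assume "\<exists>k::int. f = rot [^]\<^bsub>SG\<^esub> k"
  then obtain k :: int where "f = rot [^]\<^bsub>SG\<^esub> k" by blast
  then show "f \<circ> rot = rot \<circ> f"
    using SG.int_pow_mult[of rot k 1] SG.int_pow_mult[of rot 1 k] rot_S by (simp add: add.commute)
qed

lemma rot_eq_power:
  assumes "\<not> int p dvd k"
  shows "\<exists>r::int. (rot [^]\<^bsub>SG\<^esub> k) [^]\<^bsub>SG\<^esub> r = rot"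
proof -
  have "coprime (int p) k" using prime_p assms by (simp add: prime_imp_coprime)
  then have "gcd k (int p) = 1" by (simp add: coprime_iff_gcd_eq_1 gcd.commute)
  then obtain r v where "r * k + v * int p = 1" using bezout_int[of k "int p"] by auto
  then have "k * r - 1 = int p * (- v)" by (simp add: algebra_simps)
  then have "rot [^]\<^bsub>SG\<^esub> (k * r) = rot [^]\<^bsub>SG\<^esub> (1::int)"
    using rot_S by (subst SG.int_pow_eq) (auto simp: ord_rot dvd_def algebra_simps intro: exI[of _ v])
  then show ?thesis using rot_S by (auto simp: SG.int_pow_pow)
qed

text \<open>
  If the normaliser of the Sylow subgroup generated by \<open>rot\<close> were that subgroup itself, its
  conjugates would leave room for no more than one point stabiliser.
\<close>

lemma exists_proper_normalizer:
  "\<exists>n\<in>S. (\<exists>k::int. n \<otimes>\<^bsub>SG\<^esub> rot \<otimes>\<^bsub>SG\<^esub> inv\<^bsub>SG\<^esub> n = rot [^]\<^bsub>SG\<^esub> k) \<and> n \<circ> rot \<noteq> rot \<circ> n"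
proof (rule ccontr)
  assume "\<not> ?thesis"
  then have self: "n \<circ> rot = rot \<circ> n"
    if "n \<in> S" "n \<otimes>\<^bsub>SG\<^esub> rot \<otimes>\<^bsub>SG\<^esub> inv\<^bsub>SG\<^esub> n = rot [^]\<^bsub>SG\<^esub> (k::int)" for n k
    using that by blast
  \<comment> \<open>These conjugates of nontrivial powers of \<open>rot\<close> have no fixed
    points. Under the assumption they are pairwise distinct, so together with \<open>U\<close> they
    account for all \<open>card U * p\<close> elements of \<open>S\<close>; but \<open>tri\<close>
    fixes 3 and moves 0, so it is one element too many.\<close>
  let ?f = "\<lambda>(u, k). u \<circ> rot ^^ k \<circ> inv_into UNIV u"
  let ?D = "U \<times> {1..<p}"
  have US: "u \<in> U \<Longrightarrow> u \<in> S" for u by (simp add: U_def)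
  have "inj_on ?f ?D"
  proof (rule inj_onI, clarify)
    fix u k v l assume D: "u \<in> U" "k \<in> {1..<p}" "v \<in> U" "l \<in> {1..<p}"
      and eq: "u \<circ> rot ^^ k \<circ> inv_into UNIV u = v \<circ> rot ^^ l \<circ> inv_into UNIV v"
    note uS = US[OF D(1)] and vS = US[OF D(3)]
    \<comment> \<open>\<open>w\<close> conjugates one nontrivial power of \<open>rot\<close> to
      another, hence normalises the group that \<open>rot\<close> generates. By the assumption it is
      then a power of \<open>rot\<close>, and since it fixes 0 it is the identity.\<close>
    define w where "w = inv\<^bsub>SG\<^esub> v \<otimes>\<^bsub>SG\<^esub> u"
    have wS: "w \<in> S" using SG.m_closed[OF SG.inv_closed[of v], of u] uS vS by (simp add: w_def)
    have eq': "u \<otimes>\<^bsub>SG\<^esub> rot [^]\<^bsub>SG\<^esub> k \<otimes>\<^bsub>SG\<^esub> inv\<^bsub>SG\<^esub> u = v \<otimes>\<^bsub>SG\<^esub> rot [^]\<^bsub>SG\<^esub> l \<otimes>\<^bsub>SG\<^esub> inv\<^bsub>SG\<^esub> v"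
      using eq uS vS by (simp add: inv_SG)
    have cl: "u \<in> carrier SG" "v \<in> carrier SG" "rot [^]\<^bsub>SG\<^esub> k \<in> carrier SG" "rot [^]\<^bsub>SG\<^esub> l \<in> carrier SG"
      using uS vS rot_pow_S by simp_all
    have "w \<otimes>\<^bsub>SG\<^esub> rot [^]\<^bsub>SG\<^esub> k \<otimes>\<^bsub>SG\<^esub> inv\<^bsub>SG\<^esub> w
        = inv\<^bsub>SG\<^esub> v \<otimes>\<^bsub>SG\<^esub> (u \<otimes>\<^bsub>SG\<^esub> rot [^]\<^bsub>SG\<^esub> k \<otimes>\<^bsub>SG\<^esub> inv\<^bsub>SG\<^esub> u) \<otimes>\<^bsub>SG\<^esub> v"
      using cl by (simp add: w_def SG.inv_mult_group SG.m_assoc del: SG_simps)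
    also have "\<dots> = rot [^]\<^bsub>SG\<^esub> l"
      unfolding eq' using cl by (simp add: SG.m_assoc SG.inv_mult_cancel del: SG_simps)
    finally have w: "w \<otimes>\<^bsub>SG\<^esub> rot [^]\<^bsub>SG\<^esub> int k \<otimes>\<^bsub>SG\<^esub> inv\<^bsub>SG\<^esub> w = rot [^]\<^bsub>SG\<^esub> int l"
      by (simp add: int_pow_int)
    have "\<not> int p dvd int k" using D by (auto dest: zdvd_imp_le)
    then obtain r :: int where r: "(rot [^]\<^bsub>SG\<^esub> int k) [^]\<^bsub>SG\<^esub> r = rot" using rot_eq_power by blast
    have "w \<otimes>\<^bsub>SG\<^esub> rot \<otimes>\<^bsub>SG\<^esub> inv\<^bsub>SG\<^esub> w = (rot [^]\<^bsub>SG\<^esub> int l) [^]\<^bsub>SG\<^esub> r"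
      using SG.int_pow_conj[of w "rot [^]\<^bsub>SG\<^esub> int k" r] wS rot_S SG.int_pow_closed[of rot "int k"]
      by (simp only: w r SG_simps(1))
    also have "\<dots> = rot [^]\<^bsub>SG\<^esub> (int l * r)" using rot_S by (simp add: SG.int_pow_pow)
    finally have "w \<circ> rot = rot \<circ> w" using self wS by blast
    then have "w = rot ^^ w 0" using centralizer_rot wS by blast
    moreover have "w 0 = 0"
      using D permutes_inverses(2)[OF S_permutes[OF vS], of 0] vS by (simp add: w_def inv_SG U_def)
    ultimately have "w = \<one>\<^bsub>SG\<^esub>" by simp
    then have uv: "u = v" using cl by (metis SG.inv_equality SG.inv_inv SG.inv_closed w_def)
    have *: "x = inv\<^bsub>SG\<^esub> u \<otimes>\<^bsub>SG\<^esub> (u \<otimes>\<^bsub>SG\<^esub> x \<otimes>\<^bsub>SG\<^esub> inv\<^bsub>SG\<^esub> u) \<otimes>\<^bsub>SG\<^esub> u" if "x \<in> carrier SG" for x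
      using cl that by (simp add: SG.m_assoc SG.inv_mult_cancel del: SG_simps)
    have "rot [^]\<^bsub>SG\<^esub> k = rot [^]\<^bsub>SG\<^esub> l" using *[OF cl(3)] *[OF cl(4)] eq' uv by metis
    then have "(rot ^^ k) 0 = (rot ^^ l) 0" by simp
    then show "u = v \<and> k = l" using uv D p_ge_5 by (simp add: rot_pow)
  qed
  then have card_im: "card (?f ` ?D) = card U * (p - 1)"
    by (simp add: card_image card_cartesian_product)
  have im_S: "?f ` ?D \<subseteq> S"
  proof clarify
    fix u k assume "u \<in> U"
    then show "u \<circ> rot ^^ k \<circ> inv_into UNIV u \<in> S"
      using SG.inv_closed[of u] US[of u] by (simp add: inv_SG S_comp rot_pow_S)
  qed
  have no_fix: "g x \<noteq> x" if gx: "g \<in> ?f ` ?D" "x < p" for g x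
  proof -
    obtain u k where uk: "u \<in> U" "k \<in> {1..<p}" "g = u \<circ> rot ^^ k \<circ> inv_into UNIV u"
      using gx(1) by auto
    define y where "y = inv_into UNIV u x"
    have uS: "u \<in> S" and uP: "u permutes {..<p}" using US uk S_permutes by auto
    have xy: "x = u y" using permutes_inverses(1)[OF uP] by (simp add: y_def)
    have y: "y < p" using S_lt[OF uS] gx xy by blast
    have "(rot ^^ k) y \<noteq> y"
    proof
      assume "(rot ^^ k) y = y"
      then have "(y + k) mod p = y mod p" using y by (simp add: rot_pow)
      then have "int p dvd int k" by (metis add_diff_cancel_left' int_ops(5) mod_eq_dvd_iff zmod_int)
      then show False using uk by (auto dest: zdvd_imp_le)
    qed
    then show ?thesis
      using uk xy permutes_inj[OF uP] permutes_inverses(2)[OF uP, of y] by (simp add: inj_eq)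
  qed
  have "finite U" using finite_S by (simp add: U_def)
  have "tri 3 = 3" "tri 0 \<noteq> 0" by (simp_all add: tri_def)
  moreover have "3 < p" using p_ge_5 by simp
  ultimately have tri: "tri \<notin> ?f ` ?D" "tri \<notin> U" using no_fix[of tri 3] unfolding U_def by blast+
  have "U \<inter> ?f ` ?D = {}"
  proof -
    have "g \<notin> ?f ` ?D" if "g 0 = 0" for g using no_fix[of g 0] that prime_gt_0_nat[OF prime_p] by blast
    then show ?thesis unfolding U_def by blast
  qed
  moreover have "tri \<notin> U \<union> ?f ` ?D" using tri by blast
  ultimately have "card (insert tri (U \<union> ?f ` ?D)) = card U + card U * (p - 1) + 1"
    using \<open>finite U\<close> card_im finite_subset[OF im_S finite_S]
    by (subst card_insert_disjoint) (simp_all add: card_Un_disjoint)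
  moreover have "card (insert tri (U \<union> ?f ` ?D)) \<le> card S"
    using im_S tri_S finite_S by (intro card_mono) (auto simp: U_def)
  moreover have "card U + card U * (p - 1) = card U * p"
    using p_ge_5 by (cases p) simp_all
  ultimately show False by (simp add: card_S)
qed

text \<open>
  After composition with an inner automorphism, \<open>\<alpha>\<close> preserves the group generated by \<open>rot\<close>.
  It then acts trivially on the quotient of the normaliser by this group, since it commutes with
  the action by conjugation on a group whose automorphism group is abelian.
\<close>

lemma twisted_one_class_not_everything:
  assumes \<alpha>: "\<alpha> \<in> iso SG SG"
  shows "\<exists>s\<in>carrier SG. \<forall>g\<in>carrier SG. s \<noteq> g \<otimes>\<^bsub>SG\<^esub> inv\<^bsub>SG\<^esub> (\<alpha> g)"
proof (rule ccontr)
  assume "\<not> ?thesis"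
  then have sur: "\<exists>g\<in>carrier SG. s = g \<otimes>\<^bsub>SG\<^esub> inv\<^bsub>SG\<^esub> (\<alpha> g)" if "s \<in> carrier SG" for s
    using that by blast
  have hom: "\<alpha> \<in> hom SG SG" and bij: "bij_betw \<alpha> (carrier SG) (carrier SG)"
    using \<alpha> by (auto simp: iso_def)
  interpret \<alpha>: group_hom SG SG \<alpha> using hom by unfold_locales
  have \<alpha>c: "\<alpha> g \<in> carrier SG" if "g \<in> carrier SG" for g using that by (rule \<alpha>.hom_closed)
  have fin: "finite (carrier SG)" using finite_S by simp
  have rotc: "rot \<in> carrier SG" using rot_S by simp
  define F where "F g = g \<otimes>\<^bsub>SG\<^esub> inv\<^bsub>SG\<^esub> (\<alpha> g)" for g
  have Fc: "F ` carrier SG \<subseteq> carrier SG" using \<alpha>c by (auto simp: F_def simp del: SG_simps)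
  moreover have "carrier SG \<subseteq> F ` carrier SG" using sur unfolding F_def by blast
  ultimately have "F ` carrier SG = carrier SG" by blast
  then have Finj: "inj_on F (carrier SG)" using fin by (simp add: finite_surj_inj)
  have "SG.ord (\<alpha> rot) = p"
    using \<alpha>.hom_nat_pow[OF rotc] \<alpha>.hom_one bij_betw_imp_inj_on[OF bij]
    by (subst SG.ord_unique[OF \<alpha>c[OF rotc]])
       (metis SG.nat_pow_closed SG.one_closed SG.pow_eq_id inj_onD ord_rot rotc)
  then obtain s and m :: int where s: "s \<in> carrier SG"
    and rot_eq: "rot = s \<otimes>\<^bsub>SG\<^esub> (\<alpha> rot) [^]\<^bsub>SG\<^esub> m \<otimes>\<^bsub>SG\<^esub> inv\<^bsub>SG\<^esub> s"
    using SG.conjugate_elements_of_prime_order[OF fin prime_p p_square_not_dvd rotc ord_rot \<alpha>c[OF rotc]]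
    by blast
  obtain h where h: "h \<in> carrier SG" "s = h \<otimes>\<^bsub>SG\<^esub> inv\<^bsub>SG\<^esub> (\<alpha> h)" using sur[OF s] by blast
  define \<beta> where "\<beta> g = s \<otimes>\<^bsub>SG\<^esub> \<alpha> g \<otimes>\<^bsub>SG\<^esub> inv\<^bsub>SG\<^esub> s" for g
  have "(\<lambda>g. s \<otimes>\<^bsub>SG\<^esub> g \<otimes>\<^bsub>SG\<^esub> inv\<^bsub>SG\<^esub> s) \<circ> \<alpha> \<in> hom SG SG"
    by (rule hom_compose[OF hom SG.conj_hom[OF s]])
  then have \<beta>_hom: "\<beta> \<in> hom SG SG" by (simp add: \<beta>_def[abs_def] comp_def del: SG_simps)
  interpret \<beta>: group_hom SG SG \<beta> using \<beta>_hom by unfold_locales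
  define F' where "F' g = g \<otimes>\<^bsub>SG\<^esub> inv\<^bsub>SG\<^esub> (\<beta> g)" for g
  \<comment> \<open>Passing from \<alpha> to its composite with conjugation by \<open>s\<close>
    changes \<open>F\<close> only by translations, because \<open>s\<close> lies in the twisted
    class of the identity. So \<open>F'\<close> stays injective.\<close>
  have F'_eq: "F' g = F (g \<otimes>\<^bsub>SG\<^esub> h) \<otimes>\<^bsub>SG\<^esub> inv\<^bsub>SG\<^esub> s" if g: "g \<in> carrier SG" for g
    using g s h(1) \<alpha>c[OF g] \<alpha>c[OF h(1)]
    by (simp add: F'_def F_def \<beta>_def SG.inv_mult_group SG.m_assoc \<alpha>.hom_mult h(2) SG.inv_mult_cancel
        del: SG_simps)
  have F'inj: "inj_on F' (carrier SG)"
  proof (rule inj_onI)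
    fix x y assume xy: "x \<in> carrier SG" "y \<in> carrier SG" "F' x = F' y"
    have c: "x \<otimes>\<^bsub>SG\<^esub> h \<in> carrier SG" "y \<otimes>\<^bsub>SG\<^esub> h \<in> carrier SG"
      using xy(1,2) h(1) by (blast intro: SG.m_closed)+
    then have "F (x \<otimes>\<^bsub>SG\<^esub> h) \<in> carrier SG" "F (y \<otimes>\<^bsub>SG\<^esub> h) \<in> carrier SG" using Fc by blast+
    moreover have "F (x \<otimes>\<^bsub>SG\<^esub> h) \<otimes>\<^bsub>SG\<^esub> inv\<^bsub>SG\<^esub> s = F (y \<otimes>\<^bsub>SG\<^esub> h) \<otimes>\<^bsub>SG\<^esub> inv\<^bsub>SG\<^esub> s"
      using F'_eq[OF xy(1)] F'_eq[OF xy(2)] xy(3) by (simp only:)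
    ultimately have "F (x \<otimes>\<^bsub>SG\<^esub> h) = F (y \<otimes>\<^bsub>SG\<^esub> h)"
      using SG.right_cancel[OF SG.inv_closed[OF s]] by blast
    then have "x \<otimes>\<^bsub>SG\<^esub> h = y \<otimes>\<^bsub>SG\<^esub> h" using Finj c by (blast dest: inj_onD)
    then show "x = y" using SG.right_cancel[OF h(1) xy(1,2)] by blast
  qed
  have \<beta>_pow: "(\<beta> rot) [^]\<^bsub>SG\<^esub> m = rot"
    unfolding \<beta>_def using SG.int_pow_conj[OF s \<alpha>c[OF rotc], of m] rot_eq by simp
  have "\<beta> rot \<otimes>\<^bsub>SG\<^esub> (\<beta> rot) [^]\<^bsub>SG\<^esub> m = (\<beta> rot) [^]\<^bsub>SG\<^esub> m \<otimes>\<^bsub>SG\<^esub> \<beta> rot"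
    using SG.int_pow_mult[of "\<beta> rot" 1 m] SG.int_pow_mult[of "\<beta> rot" m 1] \<beta>.hom_closed[OF rotc]
    by (simp add: add.commute del: SG_simps)
  then have "\<beta> rot \<circ> rot = rot \<circ> \<beta> rot" by (simp add: \<beta>_pow)
  then obtain k :: int where k: "\<beta> rot = rot [^]\<^bsub>SG\<^esub> k"
    using commutes_rot_iff[of "\<beta> rot"] \<beta>.hom_closed[OF rotc] by auto
  define T where "T = range (\<lambda>j::int. rot [^]\<^bsub>SG\<^esub> j)"
  have TS: "T \<subseteq> carrier SG" using rotc by (auto simp: T_def simp del: SG_simps)
  have T_iff: "f \<in> T \<longleftrightarrow> f \<circ> rot = rot \<circ> f" if "f \<in> S" for f
    using commutes_rot_iff[OF that] by (auto simp: T_def)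
  have "F' ` T \<subseteq> T"
  proof clarify
    fix x assume "x \<in> T"
    then obtain j :: int where x: "x = rot [^]\<^bsub>SG\<^esub> j" by (auto simp: T_def)
    have "F' x = rot [^]\<^bsub>SG\<^esub> (j - k * j)"
      using rotc by (simp add: F'_def x \<beta>.hom_int_pow k SG.int_pow_pow SG.int_pow_diff del: SG_simps)
    then show "F' x \<in> T" by (simp add: T_def)
  qed
  \<comment> \<open>An injective self-map of a finite set is onto. The contradiction will be that
    \<open>F' n\<close> falls into \<open>T\<close> although \<open>n\<close> does not belong to
    \<open>T\<close>.\<close>
  then have F'T: "F' ` T = T"
    using finite_subset[OF TS fin] inj_on_subset[OF F'inj TS] by (intro endo_inj_surj)
  obtain n and a :: int where n: "n \<in> carrier SG" "n \<notin> T"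
    and na: "n \<otimes>\<^bsub>SG\<^esub> rot \<otimes>\<^bsub>SG\<^esub> inv\<^bsub>SG\<^esub> n = rot [^]\<^bsub>SG\<^esub> a"
    using exists_proper_normalizer T_iff by (metis SG_simps(1))
  have \<beta>n: "\<beta> n \<in> carrier SG" "\<beta> rot \<in> carrier SG" using n rotc \<beta>.hom_closed by auto
  have "\<beta> n \<otimes>\<^bsub>SG\<^esub> \<beta> rot \<otimes>\<^bsub>SG\<^esub> inv\<^bsub>SG\<^esub> (\<beta> n) = (\<beta> rot) [^]\<^bsub>SG\<^esub> a"
    using arg_cong[OF na, of \<beta>] n rotc
    by (simp add: \<beta>.hom_mult \<beta>.hom_int_pow del: SG_simps)
  then have "\<beta> n \<otimes>\<^bsub>SG\<^esub> (\<beta> rot) [^]\<^bsub>SG\<^esub> m \<otimes>\<^bsub>SG\<^esub> inv\<^bsub>SG\<^esub> (\<beta> n) = ((\<beta> rot) [^]\<^bsub>SG\<^esub> a) [^]\<^bsub>SG\<^esub> m"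
    using SG.int_pow_conj[OF \<beta>n, of m] by simp
  also have "\<dots> = ((\<beta> rot) [^]\<^bsub>SG\<^esub> m) [^]\<^bsub>SG\<^esub> a"
    using \<beta>n by (simp add: SG.int_pow_pow mult.commute del: SG_simps)
  finally have \<beta>na: "\<beta> n \<otimes>\<^bsub>SG\<^esub> rot \<otimes>\<^bsub>SG\<^esub> inv\<^bsub>SG\<^esub> (\<beta> n) = rot [^]\<^bsub>SG\<^esub> a" by (simp only: \<beta>_pow)
  \<comment> \<open>\<open>n\<close> and \<open>\<beta> n\<close> induce the same map on the group
    generated by \<open>rot\<close>, so \<open>t\<close> centralises \<open>rot\<close>.\<close>
  define t where "t = inv\<^bsub>SG\<^esub> n \<otimes>\<^bsub>SG\<^esub> \<beta> n"
  have tc: "t \<in> carrier SG" using n \<beta>n by (simp add: t_def del: SG_simps)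
  have "t \<otimes>\<^bsub>SG\<^esub> rot = inv\<^bsub>SG\<^esub> n \<otimes>\<^bsub>SG\<^esub> (\<beta> n \<otimes>\<^bsub>SG\<^esub> rot \<otimes>\<^bsub>SG\<^esub> inv\<^bsub>SG\<^esub> (\<beta> n)) \<otimes>\<^bsub>SG\<^esub> \<beta> n"
    using n \<beta>n rotc by (simp add: t_def SG.m_assoc del: SG_simps)
  also have "\<dots> = rot \<otimes>\<^bsub>SG\<^esub> t"
    unfolding \<beta>na na[symmetric] using n \<beta>n rotc
    by (simp add: t_def SG.m_assoc SG.inv_mult_cancel del: SG_simps)
  finally have "t \<in> T" using T_iff[of t] tc by simp
  then obtain j :: int where j: "t = rot [^]\<^bsub>SG\<^esub> j" by (auto simp: T_def)
  have "F' n = n \<otimes>\<^bsub>SG\<^esub> rot [^]\<^bsub>SG\<^esub> (- j) \<otimes>\<^bsub>SG\<^esub> inv\<^bsub>SG\<^esub> n"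
  proof -
    have "\<beta> n = n \<otimes>\<^bsub>SG\<^esub> t" using n \<beta>n by (simp add: t_def SG.inv_mult_cancel del: SG_simps)
    then show ?thesis
      using n rotc by (simp add: F'_def j SG.inv_mult_group SG.int_pow_neg SG.m_assoc del: SG_simps)
  qed
  also have "\<dots> = (rot [^]\<^bsub>SG\<^esub> a) [^]\<^bsub>SG\<^esub> (- j)"
    using SG.int_pow_conj[OF n(1) rotc, of "- j"] na by simp
  also have "\<dots> = rot [^]\<^bsub>SG\<^esub> (a * - j)" using rotc by (simp add: SG.int_pow_pow del: SG_simps)
  finally have "F' n \<in> F' ` T" unfolding F'T by (simp add: T_def)
  then show False using F'inj n TS by (metis image_iff inj_onD subsetD)
qed

lemma card_S_ge: "p \<le> card S"
proof -
  have "id \<in> U" using SG.one_closed by (simp add: U_def)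
  then have "card U > 0" using finite_S by (auto simp: card_gt_0_iff U_def)
  then show ?thesis by (simp add: card_S)
qed

end

section \<open>Twisted classes and simple quotients\<close>

lemma normal_image_surj:
  assumes "group_hom K S \<psi>" "\<psi> ` carrier K = carrier S" "M \<lhd> K"
  shows "\<psi> ` M \<lhd> S"
proof -
  interpret group_hom K S \<psi> by fact
  interpret M: normal M K by fact
  show ?thesis
  proof (rule H.normal_invI)
    show "subgroup (\<psi> ` M) S" by (rule subgroup_img_is_subgroup[OF M.subgroup_axioms])
    fix x h assume "x \<in> carrier S" "h \<in> \<psi> ` M"
    then obtain y m where "y \<in> carrier K" "x = \<psi> y" "m \<in> M" "h = \<psi> m" using assms(2) by blast
    then have "x \<otimes>\<^bsub>S\<^esub> h \<otimes>\<^bsub>S\<^esub> inv\<^bsub>S\<^esub> x = \<psi> (y \<otimes>\<^bsub>K\<^esub> m \<otimes>\<^bsub>K\<^esub> inv\<^bsub>K\<^esub> y)" "y \<otimes>\<^bsub>K\<^esub> m \<otimes>\<^bsub>K\<^esub> inv\<^bsub>K\<^esub> y \<in> M"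
      using M.subset by (auto intro: M.inv_op_closed2)
    then show "x \<otimes>\<^bsub>S\<^esub> h \<otimes>\<^bsub>S\<^esub> inv\<^bsub>S\<^esub> x \<in> \<psi> ` M" by blast
  qed
qed

definition simple_nonabelian :: "('a, 'b) monoid_scheme \<Rightarrow> bool"
  where "simple_nonabelian S \<longleftrightarrow> group S \<and> (\<forall>N. N \<lhd> S \<longrightarrow> N = {\<one>\<^bsub>S\<^esub>} \<or> N = carrier S) \<and>
    (\<exists>x\<in>carrier S. \<exists>y\<in>carrier S. x \<otimes>\<^bsub>S\<^esub> y \<noteq> y \<otimes>\<^bsub>S\<^esub> x)"

text \<open>
  The commutator of two normal subgroups that cover the quotient \<open>S\<close> covers its commutator
  subgroup, and lies in their intersection.
\<close>

lemma image_Int_normal: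
  assumes "group_hom K S \<psi>" "\<psi> ` carrier K = carrier S" "simple_nonabelian S"
    and M: "M \<lhd> K" "\<psi> ` M = carrier S" and L: "L \<lhd> K" "\<psi> ` L = carrier S"
  shows "\<psi> ` (M \<inter> L) = carrier S"
proof -
  interpret group_hom K S \<psi> by fact
  interpret M: normal M K by fact
  interpret L: normal L K by fact
  have "M \<inter> L \<lhd> K" using M.normal_axioms L.normal_axioms by (rule G.normal_subgroup_intersect)
  then have N: "\<psi> ` (M \<inter> L) \<lhd> S" using normal_image_surj assms(1,2) by blast
  obtain x y where xy: "x \<in> carrier S" "y \<in> carrier S" "x \<otimes>\<^bsub>S\<^esub> y \<noteq> y \<otimes>\<^bsub>S\<^esub> x"
    using assms(3) by (auto simp: simple_nonabelian_def)
  obtain m where m: "m \<in> M" "x = \<psi> m" using xy M by blast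
  obtain l where l: "l \<in> L" "y = \<psi> l" using xy L by blast
  have c: "m \<in> carrier K" "l \<in> carrier K" using m l M.subset L.subset by auto
  let ?c = "m \<otimes>\<^bsub>K\<^esub> l \<otimes>\<^bsub>K\<^esub> inv\<^bsub>K\<^esub> m \<otimes>\<^bsub>K\<^esub> inv\<^bsub>K\<^esub> l"
  have "?c \<in> L" using L.inv_op_closed2[OF c(1) l(1)] l by (simp add: L.m_closed L.m_inv_closed)
  moreover have "?c = m \<otimes>\<^bsub>K\<^esub> (l \<otimes>\<^bsub>K\<^esub> inv\<^bsub>K\<^esub> m \<otimes>\<^bsub>K\<^esub> inv\<^bsub>K\<^esub> l)" using c by (simp add: G.m_assoc)
  then have "?c \<in> M"
    using M.inv_op_closed2[OF c(2) M.m_inv_closed[OF m(1)]] m by (simp add: M.m_closed)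
  ultimately have "\<psi> ?c \<in> \<psi> ` (M \<inter> L)" by blast
  moreover have "\<psi> ?c = x \<otimes>\<^bsub>S\<^esub> y \<otimes>\<^bsub>S\<^esub> inv\<^bsub>S\<^esub> x \<otimes>\<^bsub>S\<^esub> inv\<^bsub>S\<^esub> y" using c m l by simp
  moreover have "x \<otimes>\<^bsub>S\<^esub> y \<otimes>\<^bsub>S\<^esub> inv\<^bsub>S\<^esub> x \<otimes>\<^bsub>S\<^esub> inv\<^bsub>S\<^esub> y \<noteq> \<one>\<^bsub>S\<^esub>"
  proof
    assume *: "x \<otimes>\<^bsub>S\<^esub> y \<otimes>\<^bsub>S\<^esub> inv\<^bsub>S\<^esub> x \<otimes>\<^bsub>S\<^esub> inv\<^bsub>S\<^esub> y = \<one>\<^bsub>S\<^esub>"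
    have "x \<otimes>\<^bsub>S\<^esub> y = (x \<otimes>\<^bsub>S\<^esub> y \<otimes>\<^bsub>S\<^esub> inv\<^bsub>S\<^esub> x \<otimes>\<^bsub>S\<^esub> inv\<^bsub>S\<^esub> y) \<otimes>\<^bsub>S\<^esub> (y \<otimes>\<^bsub>S\<^esub> x)"
      using xy by (simp add: H.m_assoc H.inv_mult_cancel)
    then show False using * xy by simp
  qed
  ultimately have "\<psi> ` (M \<inter> L) \<noteq> {\<one>\<^bsub>S\<^esub>}" by auto
  then show ?thesis using N assms(3) by (auto simp: simple_nonabelian_def)
qed

text \<open>Each member has a nontrivial normal image and so maps onto \<open>S\<close>; the
  commutator argument combines the members one at a time. The leading \<open>carrier K\<close> gives
  the empty intersection its right value.\<close>

lemma image_Inter_normal: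
  assumes "group_hom K S \<psi>" "\<psi> ` carrier K = carrier S" "simple_nonabelian S" "finite \<M>"
    and "\<And>M. M \<in> \<M> \<Longrightarrow> M \<lhd> K \<and> \<not> M \<subseteq> kernel K S \<psi>"
  shows "carrier K \<inter> \<Inter>\<M> \<lhd> K \<and> \<psi> ` (carrier K \<inter> \<Inter>\<M>) = carrier S"
  using assms(4,5)
proof (induction \<M>)
  case empty
  interpret group_hom K S \<psi> by fact
  show ?case using assms(2) G.normal_self by simp
next
  case (insert M \<M>)
  interpret group_hom K S \<psi> by fact
  have M: "M \<lhd> K" "\<not> M \<subseteq> kernel K S \<psi>" using insert.prems by auto
  interpret M: normal M K by fact
  have "\<psi> ` M \<noteq> {\<one>\<^bsub>S\<^esub>}" using M(2) M.subset by (auto simp: kernel_def)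
  then have "\<psi> ` M = carrier S"
    using normal_image_surj[OF assms(1,2) M(1)] assms(3) by (auto simp: simple_nonabelian_def)
  moreover have "carrier K \<inter> \<Inter>(insert M \<M>) = M \<inter> (carrier K \<inter> \<Inter>\<M>)" by blast
  ultimately show ?case
    using insert image_Int_normal[OF assms(1-3) M(1)] G.normal_subgroup_intersect[OF M(1)]
    by simp
qed

text \<open>The second map factors through the first, which gives a surjection from \<open>S\<close>
  to \<open>S'\<close>. It is injective if the two groups have equally many elements.\<close>

lemma kernel_subset_card:
  assumes "group_hom K S \<psi>" "\<psi> ` carrier K = carrier S" "finite (carrier S)"
    and "group_hom K S' \<psi>'" "\<psi>' ` carrier K = carrier S'"
    and sub: "kernel K S \<psi> \<subseteq> kernel K S' \<psi>'"
  shows "card (carrier S') \<le> card (carrier S)"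
    and "card (carrier S') = card (carrier S) \<Longrightarrow> kernel K S \<psi> = kernel K S' \<psi>'"
proof -
  interpret h: group_hom K S \<psi> by fact
  interpret h': group_hom K S' \<psi>' by fact
  have eq: "\<psi>' x = \<psi>' y" if "x \<in> carrier K" "y \<in> carrier K" "\<psi> x = \<psi> y" for x y
  proof -
    have "x \<otimes>\<^bsub>K\<^esub> inv\<^bsub>K\<^esub> y \<in> kernel K S \<psi>" using that by (simp add: kernel_def)
    from subsetD[OF sub this] have "\<psi>' x \<otimes>\<^bsub>S'\<^esub> inv\<^bsub>S'\<^esub> (\<psi>' y) = \<one>\<^bsub>S'\<^esub>"
      using that by (simp add: kernel_def)
    then show ?thesis using that
      by (metis h'.H.inv_equality h'.H.inv_inv h'.H.inv_closed h'.hom_closed)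
  qed
  define f where "f s = \<psi>' (inv_into (carrier K) \<psi> s)" for s
  have f: "f (\<psi> x) = \<psi>' x" if "x \<in> carrier K" for x
    unfolding f_def using that by (intro eq) (auto intro: inv_into_into f_inv_into_f)
  have im: "f ` carrier S = carrier S'"
    unfolding assms(2)[symmetric] assms(5)[symmetric] image_image using f by auto
  then show "card (carrier S') \<le> card (carrier S)" using assms(3) card_image_le by metis
  assume "card (carrier S') = card (carrier S)"
  then have inj: "inj_on f (carrier S)" using im assms(3) by (intro eq_card_imp_inj_on) auto
  have "x \<in> kernel K S \<psi>" if "x \<in> kernel K S' \<psi>'" for x
  proof -
    have x: "x \<in> carrier K" "\<psi>' x = \<one>\<^bsub>S'\<^esub>" using that by (auto simp: kernel_def)
    then have "f (\<psi> x) = f (\<psi> \<one>\<^bsub>K\<^esub>)" by (simp only: f h.G.one_closed h'.hom_one)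
    then have "\<psi> x = \<psi> \<one>\<^bsub>K\<^esub>" using inj x by (auto dest: inj_onD)
    then show ?thesis using x by (simp add: kernel_def)
  qed
  then show "kernel K S \<psi> = kernel K S' \<psi>'" using sub by blast
qed

lemma iso_funpow: "\<phi> \<in> iso K K \<Longrightarrow> \<phi> ^^ i \<in> iso K K"
proof (induction i)
  case 0
  then show ?case using iso_set_refl by (metis funpow_0 id_apply eq_id_iff)
next
  case (Suc i)
  then show ?case using iso_set_trans[of "\<phi> ^^ i" K K \<phi> K] by (simp only: funpow.simps)
qed

text \<open>
  If the kernel of \<open>\<psi>\<close> has exactly \<open>j\<close> images under \<open>\<phi>\<close>, an element \<open>y\<close> in all of them but
  one lies in the twisted class of the identity modulo their intersection only if its image
  in \<open>S\<close> lies in the twisted class of the identity for the automorphism of \<open>S\<close> induced by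
  the \<open>j\<close>-th power of \<open>\<phi>\<close>.
\<close>

lemma element_off_trivial_twisted_class:
  fixes K :: "('a, 'b) monoid_scheme" and S :: "('c, 'd) monoid_scheme"
  assumes \<phi>: "\<phi> \<in> iso K K" and \<psi>: "group_hom K S \<psi>" "\<psi> ` carrier K = carrier S"
    and S: "simple_nonabelian S" "finite (carrier S)"
    and tw: "\<And>\<alpha>. \<alpha> \<in> iso S S \<Longrightarrow> \<exists>s\<in>carrier S. \<forall>g\<in>carrier S. s \<noteq> g \<otimes>\<^bsub>S\<^esub> inv\<^bsub>S\<^esub> (\<alpha> g)"
    and per: "j0 > 0" "\<And>x. x \<in> carrier K \<Longrightarrow> \<psi> ((\<phi> ^^ j0) x) = \<psi> x"
    and \<M>: "finite \<M>" "\<And>M. M \<in> \<M> \<Longrightarrow> M \<lhd> K \<and> \<not> M \<subseteq> kernel K S \<psi>"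
  shows "\<exists>y\<in>carrier K \<inter> \<Inter>\<M>. \<forall>g\<in>carrier K.
    \<exists>i. \<psi> ((\<phi> ^^ i) y) \<noteq> \<psi> ((\<phi> ^^ i) (g \<otimes>\<^bsub>K\<^esub> inv\<^bsub>K\<^esub> (\<phi> g)))"
proof -
  interpret h: group_hom K S \<psi> by fact
  have iso: "\<phi> ^^ i \<in> iso K K" for i by (rule iso_funpow[OF \<phi>])
  have pc: "(\<phi> ^^ i) x \<in> carrier K" if "x \<in> carrier K" for i x
    using iso[of i] that by (auto simp: iso_def hom_def)
  have psur: "(\<phi> ^^ i) ` carrier K = carrier K" for i
    using iso[of i] by (auto simp: iso_def bij_betw_def)
  define \<psi>i where "\<psi>i i = \<psi> \<circ> \<phi> ^^ i" for i
  have \<psi>i: "group_hom K S (\<psi>i i)" "\<psi>i i ` carrier K = carrier S" for i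
  proof -
    have "\<psi>i i \<in> hom K S" unfolding \<psi>i_def
      using iso[of i] h.homh by (intro hom_compose[of _ K K]) (auto simp: iso_def)
    then show "group_hom K S (\<psi>i i)" by unfold_locales
    show "\<psi>i i ` carrier K = carrier S" 
      using psur \<psi>(2) unfolding \<psi>i_def by (metis image_comp)
  qed
  define j where "j = (LEAST j. j > 0 \<and> kernel K S (\<psi>i j) = kernel K S \<psi>)"
  have "kernel K S (\<psi>i j0) = kernel K S \<psi>" using per(2) by (auto simp: kernel_def \<psi>i_def)
  then have j: "j > 0" "kernel K S (\<psi>i j) = kernel K S \<psi>"
    using LeastI[of "\<lambda>j. j > 0 \<and> kernel K S (\<psi>i j) = kernel K S \<psi>" j0] per(1) by (auto simp: j_def)
  have min: "kernel K S (\<psi>i i) \<noteq> kernel K S \<psi>" if "0 < i" "i < j" for i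
    using not_less_Least[of i "\<lambda>j. j > 0 \<and> kernel K S (\<psi>i j) = kernel K S \<psi>"] that by (auto simp: j_def)
  define \<alpha> where "\<alpha> s = \<psi>i j (inv_into (carrier K) \<psi> s)" for s
  interpret hj: group_hom K S "\<psi>i j" by (rule \<psi>i)
  have ker_eq: "\<psi>i j x = \<psi>i j y \<longleftrightarrow> \<psi> x = \<psi> y" if "x \<in> carrier K" "y \<in> carrier K" for x y
  proof -
    have eq: "a = b \<longleftrightarrow> a \<otimes>\<^bsub>S\<^esub> inv\<^bsub>S\<^esub> b = \<one>\<^bsub>S\<^esub>" if "a \<in> carrier S" "b \<in> carrier S" for a b
      using that by (metis h.H.inv_equality h.H.inv_inv h.H.inv_closed h.H.r_inv)
    have "x \<otimes>\<^bsub>K\<^esub> inv\<^bsub>K\<^esub> y \<in> kernel K S (\<psi>i j) \<longleftrightarrow> x \<otimes>\<^bsub>K\<^esub> inv\<^bsub>K\<^esub> y \<in> kernel K S \<psi>" using j by simp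
    then show ?thesis using that eq[of "\<psi>i j x" "\<psi>i j y"] eq[of "\<psi> x" "\<psi> y"] by (simp add: kernel_def)
  qed
  have \<alpha>: "\<alpha> (\<psi> x) = \<psi>i j x" if "x \<in> carrier K" for x
    unfolding \<alpha>_def using that
    by (subst ker_eq) (auto intro: inv_into_into f_inv_into_f)
  have "\<alpha> \<in> iso S S"
  proof (rule isoI)
    show "\<alpha> \<in> hom S S"
    proof (rule homI)
      fix s assume "s \<in> carrier S"
      then obtain x where "x \<in> carrier K" "s = \<psi> x" using \<psi>(2) by blast
      then show "\<alpha> s \<in> carrier S" by (simp add: \<alpha>)
      fix t assume "t \<in> carrier S"
      then obtain y where "y \<in> carrier K" "t = \<psi> y" using \<psi>(2) by blast
      then show "\<alpha> (s \<otimes>\<^bsub>S\<^esub> t) = \<alpha> s \<otimes>\<^bsub>S\<^esub> \<alpha> t"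
        using \<open>x \<in> _\<close> \<open>s = _\<close> by (simp add: \<alpha> flip: h.hom_mult)
    qed
    have "inj_on \<alpha> (\<psi> ` carrier K)" by (rule inj_onI) (auto simp: \<alpha> ker_eq)
    moreover have "\<alpha> ` \<psi> ` carrier K = carrier S" using \<psi>i(2)[of j] \<alpha> by (simp add: image_image)
    ultimately show "bij_betw \<alpha> (carrier S) (carrier S)" using \<psi>(2) by (simp add: bij_betw_def)
  qed
  then obtain s where s: "s \<in> carrier S" "\<And>g. g \<in> carrier S \<Longrightarrow> s \<noteq> g \<otimes>\<^bsub>S\<^esub> inv\<^bsub>S\<^esub> (\<alpha> g)"
    using tw by blast
  define \<M>' where "\<M>' = \<M> \<union> (\<lambda>i. kernel K S (\<psi>i i)) ` {0<..<j}"
  have "M \<lhd> K \<and> \<not> M \<subseteq> kernel K S \<psi>" if M: "M \<in> \<M>'" for M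
  proof (cases "M \<in> \<M>")
    case False
    then obtain i where i: "0 < i" "i < j" "M = kernel K S (\<psi>i i)" using M by (auto simp: \<M>'_def)
    \<comment> \<open>Kernels of two epimorphisms onto the same finite group are equal as soon as
      one contains the other.\<close>
    have "\<not> M \<subseteq> kernel K S \<psi>"
      using kernel_subset_card(2)[OF \<psi>i(1,2) S(2) \<psi>, of i] min[OF i(1,2)] i by auto
    then show ?thesis using i group_hom.normal_kernel[OF \<psi>i(1)] by simp
  qed (use \<M> in blast)
  then have "\<psi> ` (carrier K \<inter> \<Inter>\<M>') = carrier S"
    using image_Inter_normal[OF \<psi> S(1), of \<M>'] \<M> by (simp add: \<M>'_def)
  then have "s \<in> \<psi> ` (carrier K \<inter> \<Inter>\<M>')" using s(1) by (simp only:)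
  then obtain y where y: "y \<in> carrier K" "y \<in> \<Inter>\<M>'" "\<psi> y = s" by blast
  have "\<exists>i. \<psi> ((\<phi> ^^ i) y) \<noteq> \<psi> ((\<phi> ^^ i) (g \<otimes>\<^bsub>K\<^esub> inv\<^bsub>K\<^esub> (\<phi> g)))" if g: "g \<in> carrier K" for g
  proof (rule ccontr)
    assume "\<not> ?thesis"
    then have *: "\<psi>i i y = \<psi>i i (g \<otimes>\<^bsub>K\<^esub> inv\<^bsub>K\<^esub> (\<phi> g))" for i by (simp add: \<psi>i_def)
    have \<phi>g: "\<phi> g \<in> carrier K" using pc[OF g, of 1] by simp
    have eq: "\<psi>i i y = \<psi>i i g \<otimes>\<^bsub>S\<^esub> inv\<^bsub>S\<^esub> (\<psi>i (Suc i) g)" for i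
    proof -
      interpret hi: group_hom K S "\<psi>i i" by (rule \<psi>i)
      have "\<psi>i (Suc i) g = \<psi>i i (\<phi> g)" by (simp add: \<psi>i_def funpow_swap1)
      then show ?thesis using *[of i] g \<phi>g by simp
    qed
    \<comment> \<open>Since \<open>y\<close> lies in these kernels, the value of
      \<open>\<psi>i i\<close> at \<open>g\<close> is the same for all \<open>i\<close> from 1 to
      \<open>j\<close>; what remains of \<open>eq\<close> is its case 0.\<close>
    have step: "\<psi>i i g = \<psi>i (Suc i) g" if "0 < i" "i < j" for i
    proof -
      interpret hi: group_hom K S "\<psi>i i" by (rule \<psi>i)
      interpret hi': group_hom K S "\<psi>i (Suc i)" by (rule \<psi>i)
      have "y \<in> kernel K S (\<psi>i i)" using y that by (auto simp: \<M>'_def)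
      then have "\<psi>i i g \<otimes>\<^bsub>S\<^esub> inv\<^bsub>S\<^esub> (\<psi>i (Suc i) g) = \<one>\<^bsub>S\<^esub>" using eq[of i] by (simp add: kernel_def)
      then show ?thesis
        using g by (metis h.H.inv_equality h.H.inv_inv h.H.inv_closed hi.hom_closed hi'.hom_closed)
    qed
    have const: "\<psi>i (Suc i) g = \<psi>i 1 g" if "i < j" for i
      using that
    proof (induction i)
      case (Suc i)
      then show ?case using step[of "Suc i"] by simp
    qed simp
    have "\<psi>i j g = \<psi>i 1 g" using const[of "j - 1"] j(1) by simp
    then have "s = \<psi> g \<otimes>\<^bsub>S\<^esub> inv\<^bsub>S\<^esub> (\<alpha> (\<psi> g))" using eq[of 0] y(3) \<alpha>[OF g] by (simp add: \<psi>i_def)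
    then show False using s(2)[of "\<psi> g"] g by simp
  qed
  moreover have "y \<in> carrier K \<inter> \<Inter>\<M>" using y by (auto simp: \<M>'_def)
  ultimately show ?thesis by blast
qed

text \<open>The element \<open>y n\<close> is chosen to die in all earlier quotients, also after
  powers of \<phi>, but to avoid the twisted class of the identity as seen in the
  \<open>n\<close>-th. If \<open>y n\<close> and \<open>y m\<close> with \<open>m < n\<close> were
  twisted conjugate, \<open>y m\<close> would fall into the twisted class of the identity as seen in
  the \<open>m\<close>-th quotient.\<close>

theorem infinite_set_of_distinct_twisted_classes:
  fixes K :: "('a, 'b) monoid_scheme" and S :: "nat \<Rightarrow> ('c, 'd) monoid_scheme"
  assumes \<phi>: "\<phi> \<in> iso K K"
    and \<psi>: "\<And>n. group_hom K (S n) (\<psi> n)" "\<And>n. \<psi> n ` carrier K = carrier (S n)"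
    and S: "\<And>n. simple_nonabelian (S n)" "\<And>n. finite (carrier (S n))"
    and tw: "\<And>n \<alpha>. \<alpha> \<in> iso (S n) (S n) \<Longrightarrow>
      \<exists>s\<in>carrier (S n). \<forall>g\<in>carrier (S n). s \<noteq> g \<otimes>\<^bsub>S n\<^esub> inv\<^bsub>S n\<^esub> (\<alpha> g)"
    and per: "\<And>n. \<exists>j>0. \<forall>x\<in>carrier K. \<psi> n ((\<phi> ^^ j) x) = \<psi> n x"
    and mono: "\<And>m n. m < n \<Longrightarrow> card (carrier (S m)) < card (carrier (S n))"
  shows "\<exists>Y\<subseteq>carrier K. infinite Y \<and>
    (\<forall>y\<in>Y. \<forall>y'\<in>Y. y \<noteq> y' \<longrightarrow> \<not> (\<exists>g\<in>carrier K. y' = g \<otimes>\<^bsub>K\<^esub> y \<otimes>\<^bsub>K\<^esub> inv\<^bsub>K\<^esub> (\<phi> g)))"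
proof -
  interpret h0: group_hom K "S 0" "\<psi> 0" by (rule \<psi>)
  have iso: "\<phi> ^^ i \<in> iso K K" for i by (rule iso_funpow[OF \<phi>])
  have pc: "(\<phi> ^^ i) x \<in> carrier K" if "x \<in> carrier K" for i x
    using iso[of i] that by (auto simp: iso_def hom_def)
  have psur: "(\<phi> ^^ i) ` carrier K = carrier K" for i
    using iso[of i] by (auto simp: iso_def bij_betw_def)
  define \<psi>i where "\<psi>i n i = \<psi> n \<circ> \<phi> ^^ i" for n i
  have \<psi>i: "group_hom K (S n) (\<psi>i n i)" "\<psi>i n i ` carrier K = carrier (S n)" for n i
  proof -
    interpret hn: group_hom K "S n" "\<psi> n" by (rule \<psi>)
    have "\<psi>i n i \<in> hom K (S n)" unfolding \<psi>i_def
      using iso[of i] hn.homh by (intro hom_compose[of _ K K]) (auto simp: iso_def)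
    then show "group_hom K (S n) (\<psi>i n i)" by unfold_locales
    show "\<psi>i n i ` carrier K = carrier (S n)" using psur \<psi>(2) unfolding \<psi>i_def by (metis image_comp)
  qed
  have finite_kernels: "finite (range (\<lambda>i. kernel K (S n) (\<psi>i n i)))" for n
  proof -
    obtain j where j: "j > 0" "\<And>x. x \<in> carrier K \<Longrightarrow> \<psi> n ((\<phi> ^^ j) x) = \<psi> n x" using per by blast
    have mult: "\<psi> n ((\<phi> ^^ (j * q)) x) = \<psi> n x" if "x \<in> carrier K" for q x
    proof (induction q)
      case (Suc q)
      have "\<psi> n ((\<phi> ^^ (j * Suc q)) x) = \<psi> n ((\<phi> ^^ j) ((\<phi> ^^ (j * q)) x))" by (simp add: funpow_add)
      then show ?case using Suc j(2) pc[OF that] by simp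
    qed simp
    have red: "\<psi>i n i x = \<psi>i n (i mod j) x" if "x \<in> carrier K" for i x
    proof -
      have "(\<phi> ^^ i) x = (\<phi> ^^ (j * (i div j))) ((\<phi> ^^ (i mod j)) x)"
        by (metis comp_apply funpow_add mult_div_mod_eq)
      then show ?thesis using mult[OF pc[OF that]] by (simp add: \<psi>i_def)
    qed
    have ker: "kernel K (S n) (\<psi>i n i) = kernel K (S n) (\<psi>i n (i mod j))" for i
      unfolding kernel_def using red[of _ i] by auto
    have "range (\<lambda>i. kernel K (S n) (\<psi>i n i)) \<subseteq> (\<lambda>i. kernel K (S n) (\<psi>i n i)) ` {..<j}"
    proof clarify
      fix i
      show "kernel K (S n) (\<psi>i n i) \<in> (\<lambda>i. kernel K (S n) (\<psi>i n i)) ` {..<j}"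
        using j(1) by (subst ker) (simp add: imageI)
    qed
    then show ?thesis by (rule finite_subset) simp
  qed
  have ex: "\<exists>y\<in>carrier K. (\<forall>m<n. \<forall>i. \<psi>i m i y = \<one>\<^bsub>S m\<^esub>) \<and>
      (\<forall>g\<in>carrier K. \<exists>i. \<psi>i n i y \<noteq> \<psi>i n i (g \<otimes>\<^bsub>K\<^esub> inv\<^bsub>K\<^esub> (\<phi> g)))" for n
  proof -
    define \<M> where "\<M> = (\<Union>m<n. range (\<lambda>i. kernel K (S m) (\<psi>i m i)))"
    obtain j where j: "j > 0" "\<And>x. x \<in> carrier K \<Longrightarrow> \<psi> n ((\<phi> ^^ j) x) = \<psi> n x" using per by blast
    have "finite \<M>" using finite_kernels by (simp add: \<M>_def)
    moreover have "M \<lhd> K \<and> \<not> M \<subseteq> kernel K (S n) (\<psi> n)" if M: "M \<in> \<M>" for M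
    proof -
      obtain m i where mi: "m < n" "M = kernel K (S m) (\<psi>i m i)" using M by (auto simp: \<M>_def)
      \<comment> \<open>Otherwise the \<open>n\<close>-th group would be a quotient of the smaller
        \<open>m\<close>-th one.\<close>
      have "\<not> M \<subseteq> kernel K (S n) (\<psi> n)"
      proof
        assume "M \<subseteq> kernel K (S n) (\<psi> n)"
        then have "card (carrier (S n)) \<le> card (carrier (S m))"
          using kernel_subset_card(1)[OF \<psi>i S(2) \<psi>, of m i n] mi by simp
        then show False using mono[OF mi(1)] by simp
      qed
      then show ?thesis using mi group_hom.normal_kernel[OF \<psi>i(1)] by simp
    qed
    ultimately obtain y where y: "y \<in> carrier K" "y \<in> \<Inter>\<M>"
      "\<And>g. g \<in> carrier K \<Longrightarrow> \<exists>i. \<psi> n ((\<phi> ^^ i) y) \<noteq> \<psi> n ((\<phi> ^^ i) (g \<otimes>\<^bsub>K\<^esub> inv\<^bsub>K\<^esub> (\<phi> g)))"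
      using element_off_trivial_twisted_class[OF \<phi> \<psi> S tw j, of \<M>] by blast
    moreover have "\<psi>i m i y = \<one>\<^bsub>S m\<^esub>" if "m < n" for m i
    proof -
      have "y \<in> kernel K (S m) (\<psi>i m i)" using y(2) that unfolding \<M>_def by blast
      then show ?thesis by (simp add: kernel_def)
    qed
    ultimately show ?thesis unfolding \<psi>i_def comp_def by blast
  qed
  define y where "y n = (SOME y. y \<in> carrier K \<and> (\<forall>m<n. \<forall>i. \<psi>i m i y = \<one>\<^bsub>S m\<^esub>) \<and>
      (\<forall>g\<in>carrier K. \<exists>i. \<psi>i n i y \<noteq> \<psi>i n i (g \<otimes>\<^bsub>K\<^esub> inv\<^bsub>K\<^esub> (\<phi> g))))" for n
  have y: "y n \<in> carrier K" "\<And>m i. m < n \<Longrightarrow> \<psi>i m i (y n) = \<one>\<^bsub>S m\<^esub>"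
    "\<And>g. g \<in> carrier K \<Longrightarrow> \<exists>i. \<psi>i n i (y n) \<noteq> \<psi>i n i (g \<otimes>\<^bsub>K\<^esub> inv\<^bsub>K\<^esub> (\<phi> g))" for n
    using someI_ex[OF ex[of n, unfolded Bex_def]] unfolding y_def[symmetric] by blast+
  have lt: "y n \<noteq> g \<otimes>\<^bsub>K\<^esub> y m \<otimes>\<^bsub>K\<^esub> inv\<^bsub>K\<^esub> (\<phi> g)" if mn: "m < n" and g: "g \<in> carrier K" for m n g
  proof
    assume eq: "y n = g \<otimes>\<^bsub>K\<^esub> y m \<otimes>\<^bsub>K\<^esub> inv\<^bsub>K\<^esub> (\<phi> g)"
    have \<phi>g: "\<phi> g \<in> carrier K" using pc[OF g, of 1] by simp
    have inv_g: "\<phi> (inv\<^bsub>K\<^esub> g) = inv\<^bsub>K\<^esub> (\<phi> g)"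
    proof -
      interpret p: group_hom K K \<phi> using \<phi> by unfold_locales (simp add: iso_def)
      show ?thesis using g by simp
    qed
    have ym: "y m = inv\<^bsub>K\<^esub> g \<otimes>\<^bsub>K\<^esub> y n \<otimes>\<^bsub>K\<^esub> \<phi> g"
      unfolding eq using g \<phi>g y(1)[of m] by (simp add: h0.G.m_assoc h0.G.inv_mult_cancel)
    obtain i where i: "\<psi>i m i (y m) \<noteq> \<psi>i m i (inv\<^bsub>K\<^esub> g \<otimes>\<^bsub>K\<^esub> inv\<^bsub>K\<^esub> (\<phi> (inv\<^bsub>K\<^esub> g)))"
      using y(3)[of "inv\<^bsub>K\<^esub> g" m] g by blast
    interpret hi: group_hom K "S m" "\<psi>i m i" by (rule \<psi>i)
    have "\<psi>i m i (y m) = \<psi>i m i (inv\<^bsub>K\<^esub> g \<otimes>\<^bsub>K\<^esub> \<phi> g)"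
      unfolding ym using y(1)[of n] y(2)[OF mn, of i] g \<phi>g by simp
    then show False using i g \<phi>g by (simp add: inv_g)
  qed
  have diff: "y n \<noteq> g \<otimes>\<^bsub>K\<^esub> y m \<otimes>\<^bsub>K\<^esub> inv\<^bsub>K\<^esub> (\<phi> g)" if mn: "m \<noteq> n" and g: "g \<in> carrier K" for m n g
  proof (cases "m < n")
    case False
    then have "n < m" using mn by simp
    show ?thesis
    proof
      assume eq: "y n = g \<otimes>\<^bsub>K\<^esub> y m \<otimes>\<^bsub>K\<^esub> inv\<^bsub>K\<^esub> (\<phi> g)"
      interpret p: group_hom K K \<phi> using \<phi> by unfold_locales (simp add: iso_def)
      have "y m = inv\<^bsub>K\<^esub> g \<otimes>\<^bsub>K\<^esub> y n \<otimes>\<^bsub>K\<^esub> inv\<^bsub>K\<^esub> (\<phi> (inv\<^bsub>K\<^esub> g))"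
        unfolding eq using g y(1)[of m] by (simp add: h0.G.m_assoc h0.G.inv_mult_cancel)
      then show False using lt[OF \<open>n < m\<close>, of "inv\<^bsub>K\<^esub> g"] g by simp
    qed
  qed (use lt g in blast)
  have "inj y"
  proof (rule injI, rule ccontr)
    fix m n assume "y m = y n" "m \<noteq> n"
    interpret p: group_hom K K \<phi> using \<phi> by unfold_locales (simp add: iso_def)
    show False using diff[OF \<open>m \<noteq> n\<close> h0.G.one_closed] \<open>y m = y n\<close> y(1) by simp
  qed
  then have "infinite (range y)" by (simp add: finite_image_iff)
  moreover have "\<not> (\<exists>g\<in>carrier K. u' = g \<otimes>\<^bsub>K\<^esub> u \<otimes>\<^bsub>K\<^esub> inv\<^bsub>K\<^esub> (\<phi> g))"
    if u: "u \<in> range y" "u' \<in> range y" "u \<noteq> u'" for u u'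
  proof -
    obtain m n where mn: "u = y m" "u' = y n" using u by blast
    then have "m \<noteq> n" using u by blast
    from diff[OF this] show ?thesis unfolding mn by blast
  qed
  moreover have "range y \<subseteq> carrier K" using y(1) by blast
  ultimately show ?thesis by blast
qed

section \<open>Words in free products\<close>

lemma reduced_words_append:
  "u @ v \<in> reduced_words I G \<longleftrightarrow> u \<in> reduced_words I G \<and> v \<in> reduced_words I G \<and>
    (u = [] \<or> v = [] \<or> fst (last u) \<noteq> fst (hd v))"
  by (auto simp: reduced_words_def distinct_adj_append_iff last_map hd_map)

lemma foldr_letter_mult_append:
  "u @ v \<in> reduced_words I G \<Longrightarrow> foldr (letter_mult G) u v = u @ v"
proof (induction u)
  case (Cons p u)
  obtain i x where p: "p = (i, x)" by fastforce
  show ?case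
    using Cons reduced_words_Cons[of i x "u @ v" I G] by (simp add: p)
qed simp

lemma length_letter_mult: "length (letter_mult G l w) \<le> Suc (length w)"
  by (cases "(G, l, w)" rule: letter_mult.cases) auto

lemma length_foldr_letter_mult: "length (foldr (letter_mult G) u v) \<le> length u + length v"
proof (induction u)
  case (Cons l u)
  then show ?case using length_letter_mult[of G l "foldr (letter_mult G) u v"] by simp
qed simp

definition starts_in :: "'i \<Rightarrow> ('i \<times> 'a) list \<Rightarrow> bool"
  where "starts_in i w \<longleftrightarrow> w \<noteq> [] \<and> fst (hd w) = i"

definition ends_in :: "'i \<Rightarrow> ('i \<times> 'a) list \<Rightarrow> bool"
  where "ends_in i w \<longleftrightarrow> w \<noteq> [] \<and> fst (last w) = i"

lemma starts_in_Nil [simp]: "\<not> starts_in i []" and ends_in_Nil [simp]: "\<not> ends_in i []"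
  by (simp_all add: starts_in_def ends_in_def)

lemma starts_in_append: "u \<noteq> [] \<Longrightarrow> starts_in i (u @ v) = starts_in i u"
  by (simp add: starts_in_def)

lemma ends_in_append: "v \<noteq> [] \<Longrightarrow> ends_in i (u @ v) = ends_in i v"
  by (simp add: ends_in_def)

section \<open>Cancellation in products of reduced words\<close>

locale free_product_of_groups =
  fixes I :: "'i set" and G :: "'i \<Rightarrow> 'a monoid"
  assumes groups: "\<And>i. i \<in> I \<Longrightarrow> group (G i)"
begin

definition F :: "('i \<times> 'a) list monoid" where "F = free_product I G"

sublocale F: group F
  unfolding F_def using groups by (rule group_free_product)

lemma carrier_F: "carrier F = reduced_words I G" and one_F: "\<one>\<^bsub>F\<^esub> = []"
  and mult_F: "u \<otimes>\<^bsub>F\<^esub> v = foldr (letter_mult G) u v"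
  by (simp_all add: F_def free_product_simps)

abbreviation mult_in_F (infixl "\<cdot>" 70) where "u \<cdot> v \<equiv> u \<otimes>\<^bsub>F\<^esub> v"

lemma Nil_in_F [simp]: "[] \<in> carrier F" using F.one_closed by (simp add: one_F)

lemma mult_Nil [simp]: "u \<in> carrier F \<Longrightarrow> u \<cdot> [] = u" "u \<in> carrier F \<Longrightarrow> [] \<cdot> u = u"
  and inv_Nil [simp]: "inv\<^bsub>F\<^esub> [] = []"
  using F.r_one F.l_one F.inv_one by (simp_all add: one_F)

lemma append_in_F:
  "u @ v \<in> carrier F \<longleftrightarrow> u \<in> carrier F \<and> v \<in> carrier F \<and>
    (u = [] \<or> v = [] \<or> fst (last u) \<noteq> fst (hd v))"
  by (simp add: carrier_F reduced_words_append)

lemma mult_append: "u @ v \<in> carrier F \<Longrightarrow> u \<cdot> v = u @ v"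
  by (simp add: carrier_F mult_F foldr_letter_mult_append)

lemma Cons_in_F:
  assumes "(i, x) # w \<in> carrier F"
  shows "i \<in> I" "x \<in> carrier (G i)" "x \<noteq> \<one>\<^bsub>G i\<^esub>" "w \<in> carrier F" "\<not> starts_in i w"
    "[(i, x)] \<in> carrier F"
  using assms by (auto simp: carrier_F reduced_words_def distinct_adj_Cons starts_in_def hd_map)

lemma letter_in_F: "[(i, x)] \<in> carrier F \<longleftrightarrow> i \<in> I \<and> x \<in> carrier (G i) \<and> x \<noteq> \<one>\<^bsub>G i\<^esub>"
  by (auto simp: carrier_F reduced_words_def)

definition incl :: "'i \<Rightarrow> 'a \<Rightarrow> ('i \<times> 'a) list" where "incl = free_product_incl G"

lemma incl_eq: "incl i x = (if x = \<one>\<^bsub>G i\<^esub> then [] else [(i, x)])"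
  by (simp add: incl_def free_product_incl_def)

lemma incl_hom: "i \<in> I \<Longrightarrow> group_hom (G i) F (incl i)"
  using free_product_incl_hom(1)[of I G i, OF groups] groups F.is_group
  by (simp add: group_hom_def group_hom_axioms_def F_def incl_def)

lemma incl_inj: "i \<in> I \<Longrightarrow> inj_on (incl i) (carrier (G i))"
  using free_product_incl_hom(2)[of I G i, OF groups] by (simp add: incl_def)

lemma incl_in_F: "i \<in> I \<Longrightarrow> x \<in> carrier (G i) \<Longrightarrow> incl i x \<in> carrier F"
  using incl_hom by (meson group_hom.hom_closed)

lemma Cons_eq_incl_mult:
  assumes "(i, x) # w \<in> carrier F"
  shows "(i, x) # w = incl i x \<cdot> w"
  using mult_append[of "[(i, x)]" w] assms Cons_in_F[OF assms] by (simp add: incl_eq)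

definition word_inv :: "('i \<times> 'a) list \<Rightarrow> ('i \<times> 'a) list"
  where "word_inv w = rev (map (\<lambda>(i, x). (i, inv\<^bsub>G i\<^esub> x)) w)"

lemma word_inv_closed: "w \<in> carrier F \<Longrightarrow> word_inv w \<in> carrier F"
proof -
  assume w: "w \<in> carrier F"
  have "map fst (word_inv w) = rev (map fst w)" by (simp add: word_inv_def rev_map case_prod_unfold)
  moreover have "inv\<^bsub>G i\<^esub> x \<in> carrier (G i) \<and> inv\<^bsub>G i\<^esub> x \<noteq> \<one>\<^bsub>G i\<^esub>" if "(i, x) \<in> set w" for i x
  proof -
    have x: "i \<in> I" "x \<in> carrier (G i)" "x \<noteq> \<one>\<^bsub>G i\<^esub>"
      using w that by (auto simp: carrier_F reduced_words_def)
    interpret group "G i" using x groups by blast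
    show ?thesis using x by (simp add: inv_eq_1_iff)
  qed
  ultimately show ?thesis
    using w by (fastforce simp: carrier_F reduced_words_def word_inv_def)
qed

lemma inv_F: "w \<in> carrier F \<Longrightarrow> inv\<^bsub>F\<^esub> w = word_inv w"
proof -
  have "word_inv w \<cdot> w = []" if "w \<in> carrier F" for w
    using that
  proof (induction w)
    case (Cons p w)
    obtain i x where p: "p = (i, x)" by fastforce
    note w = Cons_in_F[OF Cons.prems[unfolded p]]
    interpret group "G i" using w groups by blast
    have "letter_mult G (i, inv\<^bsub>G i\<^esub> x) ((i, x) # w) = w" using w by (auto simp: inv_eq_1_iff)
    then show ?case using Cons.IH w by (simp add: mult_F word_inv_def p)
  qed (simp add: mult_F word_inv_def)
  then show "w \<in> carrier F \<Longrightarrow> inv\<^bsub>F\<^esub> w = word_inv w"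
    by (intro F.inv_equality) (auto simp: one_F word_inv_closed)
qed

lemma starts_in_inv: "w \<in> carrier F \<Longrightarrow> starts_in i (inv\<^bsub>F\<^esub> w) = ends_in i w"
  by (cases w rule: rev_cases) (auto simp: inv_F word_inv_def starts_in_def ends_in_def)

lemma ends_in_inv: "w \<in> carrier F \<Longrightarrow> ends_in i (inv\<^bsub>F\<^esub> w) = starts_in i w"
  using starts_in_inv[of "inv\<^bsub>F\<^esub> w"] by simp

text \<open>Where two letters meet, exactly one of them has index \<open>i\<close>, so they belong
  to different factors and nothing cancels.\<close>

lemma mult_alternating:
  assumes "u \<in> carrier F" "v \<in> carrier F" "u \<noteq> []" "ends_in i u \<noteq> starts_in i v"
  shows "u \<cdot> v = u @ v" "starts_in i (u \<cdot> v) = starts_in i u"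
proof -
  have "u @ v \<in> carrier F" using assms by (auto simp: append_in_F starts_in_def ends_in_def)
  then show "u \<cdot> v = u @ v" by (rule mult_append)
  then show "starts_in i (u \<cdot> v) = starts_in i u" using assms by (simp add: starts_in_append)
qed

text \<open>
  In the tree of cosets of the factors, this says that the edge between the element \<open>p\<close> and
  its coset of the \<open>i\<close>-th factor separates \<open>1\<close> from \<open>h\<close> only if \<open>p\<close> is a prefix of \<open>h\<close>.
\<close>

lemma separating_prefix:
  assumes h: "h \<in> carrier F" and p: "p \<in> carrier F"
    and sep: "starts_in i (inv\<^bsub>F\<^esub> p \<cdot> h) \<noteq> starts_in i (inv\<^bsub>F\<^esub> p)"
  shows "\<exists>h'. h = p @ h'"
proof -
  \<comment> \<open>The common prefix cancels. It remains to see that, if a nonempty rest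
    \<open>p'\<close> of \<open>p\<close> is left, the product starts in the same factor as the
    inverse of \<open>p\<close>.\<close>
  obtain q p' h' where q: "p = q @ p'" "h = q @ h'" "p' = [] \<or> h' = [] \<or> hd p' \<noteq> hd h'"
    using longest_common_prefix[of p h] by blast
  have c: "q \<in> carrier F" "p' \<in> carrier F" "h' \<in> carrier F" using h p q by (auto simp: append_in_F)
  have "inv\<^bsub>F\<^esub> p \<cdot> h = inv\<^bsub>F\<^esub> (q \<cdot> p') \<cdot> (q \<cdot> h')"
    using mult_append h p q by simp
  also have "\<dots> = inv\<^bsub>F\<^esub> p' \<cdot> h'"
    using c by (simp add: F.inv_mult_group F.m_assoc F.inv_mult_cancel)
  finally have ph: "inv\<^bsub>F\<^esub> p \<cdot> h = inv\<^bsub>F\<^esub> p' \<cdot> h'" .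
  have "p' = []"
  proof (rule ccontr)
    assume p': "p' \<noteq> []"
    then have st_p: "starts_in i (inv\<^bsub>F\<^esub> p) = starts_in i (inv\<^bsub>F\<^esub> p')"
      using c p q by (simp add: starts_in_inv ends_in_append)
    obtain j x p'' where pc: "p' = (j, x) # p''" using p' by (cases p') auto
    show False
    proof (cases h')
      case Nil
      then show False using sep ph c st_p by simp
    next
      case (Cons b h'')
      obtain l y where b: "b = (l, y)" by fastforce
      note pp = Cons_in_F[OF c(2)[unfolded pc]] and hh = Cons_in_F[OF c(3)[unfolded Cons b]]
      show False
      proof (cases "j = l")
        case False
        have "inv\<^bsub>F\<^esub> p' @ h' \<in> carrier F"
          using c False Cons b pc by (auto simp: append_in_F inv_F word_inv_closed) (simp add: word_inv_def)
        then have "inv\<^bsub>F\<^esub> p' \<cdot> h' = inv\<^bsub>F\<^esub> p' @ h'" by (rule mult_append)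
        moreover have "inv\<^bsub>F\<^esub> p' \<noteq> []" using c pc by (simp add: inv_F word_inv_def)
        ultimately show False using sep ph st_p by (simp add: starts_in_append)
      next
        case True
        interpret Gj: group "G j" using groups pp by blast
        \<comment> \<open>The two different first letters merge into a nontrivial letter of the same
          factor. It survives, so the first factor of the product is still that of the inverse of
          \<open>p'\<close>.\<close>
        define z where "z = inv\<^bsub>G j\<^esub> x \<otimes>\<^bsub>G j\<^esub> y"
        have y: "y \<in> carrier (G j)" "x \<noteq> y" using hh q(3) Cons b pc True by auto
        have z: "z \<in> carrier (G j)" "z \<noteq> \<one>\<^bsub>G j\<^esub>"
          using y pp by (auto simp: z_def) (metis Gj.inv_closed Gj.inv_equality Gj.inv_inv)
        have zh: "(j, z) # h'' \<in> carrier F"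
          using hh z True append_in_F[of "[(j, z)]" h''] by (auto simp: letter_in_F starts_in_def)
        have iz: "inv\<^bsub>F\<^esub> (incl j x) \<cdot> incl j y = incl j z"
        proof -
          interpret e: group_hom "G j" F "incl j" using incl_hom pp by blast
          show ?thesis using y pp by (simp add: z_def flip: e.hom_inv)
        qed
        have inc: "incl j x \<in> carrier F" "incl j y \<in> carrier F" using incl_in_F pp y by auto
        have "inv\<^bsub>F\<^esub> p' \<cdot> h' = inv\<^bsub>F\<^esub> (incl j x \<cdot> p'') \<cdot> (incl j y \<cdot> h'')"
          using Cons_eq_incl_mult c(2,3) pc Cons b True by metis
        also have "\<dots> = inv\<^bsub>F\<^esub> p'' \<cdot> ((inv\<^bsub>F\<^esub> (incl j x) \<cdot> incl j y) \<cdot> h'')"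
          using inc pp hh by (simp add: F.inv_mult_group F.m_assoc)
        also have "\<dots> = inv\<^bsub>F\<^esub> p'' \<cdot> ((j, z) # h'')"
          unfolding iz using Cons_eq_incl_mult[OF zh] by simp
        finally have eq: "inv\<^bsub>F\<^esub> p' \<cdot> h' = inv\<^bsub>F\<^esub> p'' \<cdot> ((j, z) # h'')" .
        show False
        proof (cases "p'' = []")
          case True
          then have "starts_in i (inv\<^bsub>F\<^esub> p' \<cdot> h') = starts_in i (inv\<^bsub>F\<^esub> p')"
            unfolding eq using zh c(2) True
            by (simp add: starts_in_inv pc) (simp add: starts_in_def ends_in_def)
          then show False using sep ph st_p by simp
        next
          case False
          have ne: "inv\<^bsub>F\<^esub> p'' \<noteq> []" using False pp by (simp add: inv_F word_inv_def)
          have "ends_in j (inv\<^bsub>F\<^esub> p'') \<noteq> starts_in j ((j, z) # h'')"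
            using pp by (simp add: ends_in_inv) (simp add: starts_in_def)
          from mult_alternating(1)[OF _ zh ne this]
          have "starts_in i (inv\<^bsub>F\<^esub> p' \<cdot> h') = starts_in i (inv\<^bsub>F\<^esub> p'')"
            unfolding eq using pp ne by (simp add: starts_in_append)
          also have "\<dots> = starts_in i (inv\<^bsub>F\<^esub> p')"
            using pp c(2) False by (simp add: starts_in_inv pc ends_in_def)
          finally show False using sep ph st_p by simp
        qed
      qed
    qed
  qed
  then show ?thesis using q by auto
qed

end

section \<open>Indecomposable subgroups of free products\<close>

text \<open>This is a form of the ping-pong lemma. By induction from the right, the value of a
  nonempty reduced word satisfies \<open>X\<close> or \<open>Y\<close> according to its first
  letter, so it is never the identity.\<close>

lemma free_product_criterion:
  fixes L :: "'a monoid"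
  assumes "group L" and A: "subgroup A L" and B: "subgroup B L"
    and gen: "generate L (A \<union> B) = carrier L"
    and X: "\<And>a v. \<lbrakk>a \<in> A; a \<noteq> \<one>\<^bsub>L\<^esub>; v \<in> carrier L; v = \<one>\<^bsub>L\<^esub> \<or> Y v\<rbrakk> \<Longrightarrow> X (a \<otimes>\<^bsub>L\<^esub> v)"
    and Y: "\<And>b v. \<lbrakk>b \<in> B; b \<noteq> \<one>\<^bsub>L\<^esub>; v \<in> carrier L; v = \<one>\<^bsub>L\<^esub> \<or> X v\<rbrakk> \<Longrightarrow> Y (b \<otimes>\<^bsub>L\<^esub> v)"
    and one: "\<not> X \<one>\<^bsub>L\<^esub>" "\<not> Y \<one>\<^bsub>L\<^esub>"
  shows "L \<cong> binary_free_product (L\<lparr>carrier := A\<rparr>) (L\<lparr>carrier := B\<rparr>)"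
proof -
  interpret L: group L by fact
  let ?G = "\<lambda>i::nat. if i = 1 then L\<lparr>carrier := A\<rparr> else L\<lparr>carrier := B\<rparr>"
  let ?F = "free_product {1, 2} ?G"
  have grp: "group (?G i)" if "i \<in> {1, 2}" for i
    using L.subgroup_imp_group[OF A] L.subgroup_imp_group[OF B] by simp
  have sub: "carrier (?G i) \<subseteq> carrier L" for i
    using subgroup.subset[OF A] subgroup.subset[OF B] by simp
  interpret F: group ?F by (rule group_free_product[OF grp])
  have "(\<lambda>x. x) \<in> hom (?G i) L" for i using sub[of i] by (auto simp: hom_def)
  then obtain h where h: "h \<in> hom ?F L"
    and h_incl: "\<And>i x. i \<in> {1, 2} \<Longrightarrow> x \<in> carrier (?G i) \<Longrightarrow> h (free_product_incl ?G i x) = x"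
    using free_product_universal(1)[of "{1, 2}" ?G L "\<lambda>_ x. x", OF grp \<open>group L\<close>] by blast
  interpret h: group_hom ?F L h using h by unfold_locales
  have incl: "free_product_incl ?G i x \<in> carrier ?F" if "i \<in> {1, 2}" "x \<in> carrier (?G i)" for i x
    using free_product_incl_hom(1)[of "{1, 2}" ?G i, OF grp that(1)] that(2) by (auto simp: hom_def)
  have XY: "if fst (hd w) = 1 then X (h w) else Y (h w)"
    if "w \<in> reduced_words {1, 2} ?G" "w \<noteq> []" for w
    using that
  proof (induction w)
    case (Cons p w)
    obtain i x where p: "p = (i, x)" by fastforce
    note r = reduced_words_Cons[OF Cons.prems(1)[unfolded p]]
    have x: "x \<noteq> \<one>\<^bsub>L\<^esub>" "w \<noteq> [] \<longrightarrow> fst (hd w) \<noteq> i"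
      using Cons.prems by (auto simp: p reduced_words_def distinct_adj_Cons hd_map split: if_splits)
    have pw: "p # w = free_product_incl ?G i x \<otimes>\<^bsub>?F\<^esub> w"
      using r x by (simp add: p free_product_simps free_product_incl_def split: if_splits)
    have wc: "w \<in> carrier ?F" using r by (simp add: free_product_simps)
    have hpw: "h (p # w) = x \<otimes>\<^bsub>L\<^esub> h w"
      unfolding pw hom_mult[OF h incl[OF r(1,2)] wc] h_incl[OF r(1,2)] ..
    have hw: "h w \<in> carrier L" using wc by simp
    have nil: "h [] = \<one>\<^bsub>L\<^esub>" using h.hom_one by (simp add: free_product_simps)
    show ?case
    proof (cases "i = 1")
      case True
      have "w = [] \<or> Y (h w)" using Cons.IH[OF r(3)] x(2) True by (cases "w = []") auto
      then have "h w = \<one>\<^bsub>L\<^esub> \<or> Y (h w)" using nil by auto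
      then have "X (x \<otimes>\<^bsub>L\<^esub> h w)" using X[of x "h w"] r x hw True by simp
      then show ?thesis using True hpw by (simp add: p)
    next
      case False
      then have i2: "i = 2" using r by simp
      have "fst (hd w) = 1" if "w \<noteq> []"
      proof -
        have "fst (hd w) \<in> {1, 2}" using r(3) that by (cases w) (auto simp: reduced_words_def)
        then show ?thesis using x(2) that i2 by auto
      qed
      then have "w = [] \<or> X (h w)" using Cons.IH[OF r(3)] by (cases "w = []") auto
      then have "h w = \<one>\<^bsub>L\<^esub> \<or> X (h w)" using nil by auto
      then have "Y (x \<otimes>\<^bsub>L\<^esub> h w)" using Y[of x "h w"] r x hw i2 by simp
      then show ?thesis using i2 hpw by (simp add: p)
    qed
  qed simp
  have "w = \<one>\<^bsub>?F\<^esub>" if "w \<in> carrier ?F" "h w = \<one>\<^bsub>L\<^esub>" for w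
    using XY[of w] one that by (cases "w = []") (auto simp: free_product_simps split: if_splits)
  then have inj: "inj_on h (carrier ?F)" by (intro h.inj_on_one_iff[THEN iffD2]) blast
  have "subgroup (h ` carrier ?F) L" by (rule h.img_is_subgroup)
  moreover have "A \<union> B \<subseteq> h ` carrier ?F"
  proof
    fix x assume "x \<in> A \<union> B"
    then have "x \<in> carrier (?G 1) \<or> x \<in> carrier (?G 2)" by simp
    then obtain i where i: "i \<in> {1, 2}" "x \<in> carrier (?G i)" by blast
    show "x \<in> h ` carrier ?F" using imageI[OF incl[OF i], of h] unfolding h_incl[OF i] .
  qed
  ultimately have "carrier L \<subseteq> h ` carrier ?F" unfolding gen[symmetric] by (intro L.generate_subgroup_incl)
  then have "h ` carrier ?F = carrier L" using h.hom_closed by blast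
  then have "h \<in> iso ?F L" using h inj by (simp add: iso_def bij_betw_def)
  then show ?thesis using F.iso_sym is_isoI by blast
qed

definition infinite_cyclic :: "('a, 'b) monoid_scheme \<Rightarrow> bool"
  where "infinite_cyclic L \<longleftrightarrow> cyclic_group L \<and> infinite (carrier L)"

section \<open>Splittings of a subgroup along an orbit of edges\<close>

context free_product_of_groups
begin

text \<open>
  The subgroups \<open>A\<close> and \<open>B\<close> below stabilise the two ends of an edge of the Bass--Serre tree
  after all edges outside the \<open>H\<close>-orbit of this edge have been collapsed, and an element \<open>t\<close>
  carries one end to the other. Hence \<open>H\<close> is the free product of \<open>A\<close> and \<open>B\<close> or, if there
  is such a \<open>t\<close>, of \<open>A\<close> and the infinite cyclic group generated by \<open>t\<close>.
\<close>

lemma indecomposable_subgroup_one_sided: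
  assumes H: "subgroup H F" and ind: "freely_indecomposable (F\<lparr>carrier := H\<rparr>)"
    and ncyc: "\<not> infinite_cyclic (F\<lparr>carrier := H\<rparr>)"
  shows "(\<forall>h\<in>H. \<not> starts_in i h) \<or> (\<forall>h\<in>H. h \<noteq> [] \<longrightarrow> starts_in i h)"
proof -
  define L where "L = F\<lparr>carrier := H\<rparr>"
  interpret H: subgroup H F by (rule H)
  interpret L: group L unfolding L_def by (rule F.subgroup_imp_group[OF H])
  have L_simps: "carrier L = H" "u \<otimes>\<^bsub>L\<^esub> v = u \<cdot> v" "\<one>\<^bsub>L\<^esub> = []" for u v
    by (simp_all add: L_def one_F)
  have L_inv: "inv\<^bsub>L\<^esub> u = inv\<^bsub>F\<^esub> u" if "u \<in> H" for u
    unfolding L_def using F.m_inv_consistent[OF H that] .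
  have HF: "h \<in> carrier F" if "h \<in> H" for h using that H.subset by blast
  have one_H: "[] \<in> H" using H.one_closed by (simp add: one_F)
  define st :: "('i \<times> 'a) list \<Rightarrow> bool" where "st h = starts_in i h" for h
  define en :: "('i \<times> 'a) list \<Rightarrow> bool" where "en h = ends_in i h" for h
  define st' where "st' h \<longleftrightarrow> st h \<or> h = []" for h
  \<comment> \<open>\<open>st (h \<cdot> a)\<close> tells on which side of a translate of the edge
    the vertex \<open>a\<close> lies, and \<open>st'\<close> does the same for the far end of the
    edge. So for \<open>a\<close> in \<open>A\<close> no translate separates \<open>[]\<close> from
    \<open>a\<close>, for \<open>b\<close> in \<open>B\<close> none separates the far ends belonging
    to \<open>[]\<close> and \<open>b\<close>, and for \<open>t\<close> in \<open>T\<close> none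
    separates the vertex \<open>t\<close> from the far end belonging to \<open>[]\<close>.\<close>
  define A where "A = {a \<in> H. \<forall>h\<in>H. st (h \<cdot> a) = st h}"
  define B where "B = {b \<in> H. \<forall>h\<in>H. st' (h \<cdot> b) = st' h}"
  define T where "T = {t \<in> H. \<forall>h\<in>H. st (h \<cdot> t) = st' h}"
  have st_inv: "st (inv\<^bsub>F\<^esub> u) = en u" if "u \<in> H" for u
    using starts_in_inv HF[OF that] by (simp add: st_def en_def)
  have en_inv: "en (inv\<^bsub>F\<^esub> u) = st u" if "u \<in> H" for u
    using ends_in_inv HF[OF that] by (simp add: st_def en_def)
  have st_Nil [simp]: "\<not> st []" "st' []" "\<not> en []" by (simp_all add: st_def st'_def en_def)
  have ne_inv: "inv\<^bsub>F\<^esub> u \<noteq> []" if "u \<in> H" "u \<noteq> []" for u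
    using that HF by (metis F.inv_inv inv_Nil)
  have concat: "u \<cdot> v \<noteq> []" "st (u \<cdot> v) = st u"
    if "u \<in> H" "v \<in> H" "u \<noteq> []" "en u \<noteq> st v" for u v
    using mult_alternating[of u v i] that HF by (auto simp: st_def en_def)
  have A_sub: "subgroup A F"
  proof (rule F.subgroupI)
    show "A \<subseteq> carrier F" using H.subset by (auto simp: A_def)
    have "[] \<in> A" using HF by (auto simp: A_def one_H)
    then show "A \<noteq> {}" by blast
    show "inv\<^bsub>F\<^esub> a \<in> A" if "a \<in> A" for a
    proof -
      have a: "a \<in> H" "\<And>h. h \<in> H \<Longrightarrow> st (h \<cdot> a) = st h" using that by (auto simp: A_def)
      have "st (h \<cdot> inv\<^bsub>F\<^esub> a) = st h" if "h \<in> H" for h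
        using a(2)[of "h \<cdot> inv\<^bsub>F\<^esub> a"] a(1) that HF by (simp add: F.m_assoc)
      then show ?thesis using a(1) by (simp add: A_def)
    qed
    show "a \<cdot> b \<in> A" if "a \<in> A" "b \<in> A" for a b
      using that HF by (auto simp: A_def simp flip: F.m_assoc)
  qed
  have B_sub: "subgroup B F"
  proof (rule F.subgroupI)
    show "B \<subseteq> carrier F" using H.subset by (auto simp: B_def)
    have "[] \<in> B" using HF by (auto simp: B_def one_H)
    then show "B \<noteq> {}" by blast
    show "inv\<^bsub>F\<^esub> a \<in> B" if "a \<in> B" for a
    proof -
      have a: "a \<in> H" "\<And>h. h \<in> H \<Longrightarrow> st' (h \<cdot> a) = st' h" using that by (auto simp: B_def)
      have "st' (h \<cdot> inv\<^bsub>F\<^esub> a) = st' h" if "h \<in> H" for h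
        using a(2)[of "h \<cdot> inv\<^bsub>F\<^esub> a"] a(1) that HF by (simp add: F.m_assoc)
      then show ?thesis using a(1) by (simp add: B_def)
    qed
    show "a \<cdot> b \<in> B" if "a \<in> B" "b \<in> B" for a b
      using that HF by (auto simp: B_def simp flip: F.m_assoc)
  qed
  have AH: "A \<subseteq> H" and BH: "B \<subseteq> H" and TH: "T \<subseteq> H" by (auto simp: A_def B_def T_def)
  have A_L: "subgroup A L" and B_L: "subgroup B L"
    using F.subgroup_incl[OF A_sub H AH] F.subgroup_incl[OF B_sub H BH] by (simp_all add: L_def)
  have typeA: "\<not> st a" "\<not> en a" if "a \<in> A" for a
  proof -
    have st: "\<not> st a" if "a \<in> A" for a
    proof -
      have "st ([] \<cdot> a) = st []" using that one_H unfolding A_def by blast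
      then show ?thesis using that HF AH by auto
    qed
    from st[OF that] st[OF subgroup.m_inv_closed[OF A_sub that]] show "\<not> st a" "\<not> en a"
      using st_inv that AH by auto
  qed
  have typeB: "st b" "en b" if "b \<in> B" "b \<noteq> []" for b
  proof -
    have st: "st b" if "b \<in> B" "b \<noteq> []" for b
    proof -
      have "st' ([] \<cdot> b) = st' []" using that one_H unfolding B_def by blast
      then show ?thesis using that HF BH by (auto simp: st'_def)
    qed
    from st[OF that] st[OF subgroup.m_inv_closed[OF B_sub that(1)]] show "st b" "en b"
      using st_inv ne_inv that BH by auto
  qed
  have typeT: "st t" "\<not> en t" "t \<noteq> []" if "t \<in> T" for t
  proof -
    have t: "t \<in> H" "\<And>h. h \<in> H \<Longrightarrow> st (h \<cdot> t) = st' h" using that by (auto simp: T_def)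
    show st: "st t" using t(2)[OF one_H] t(1) HF by simp
    then show ne: "t \<noteq> []" by auto
    have "st (inv\<^bsub>F\<^esub> t \<cdot> t) = st' (inv\<^bsub>F\<^esub> t)" using t by blast
    then have "\<not> st (inv\<^bsub>F\<^esub> t)" using t(1) HF by (auto simp: st'_def one_F)
    then show "\<not> en t" using st_inv t(1) by simp
  qed
  have generated: "h \<in> generate L (A \<union> B \<union> T)" if "h \<in> H" for h
    using that
  proof (induction "length h" arbitrary: h rule: less_induct)
    case less
    let ?gen = "generate L (A \<union> B \<union> T)"
    have gen_sub: "subgroup ?gen L" using AH BH TH by (intro L.generate_is_subgroup) (auto simp: L_simps)
    note h = less.prems
    \<comment> \<open>An intermediate cut splits \<open>h\<close> into two shorter elements of
      \<open>H\<close>, because \<open>k\<close> is then a prefix of \<open>h\<close>.\<close>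
    define cut where "cut k \<longleftrightarrow> k \<in> H \<and> st (inv\<^bsub>F\<^esub> k \<cdot> h) \<noteq> st (inv\<^bsub>F\<^esub> k)" for k
    show ?case
    proof (cases "\<exists>k. cut k \<and> k \<noteq> [] \<and> k \<noteq> h")
      case True
      then obtain k where k: "k \<in> H" "k \<noteq> []" "k \<noteq> h" "st (inv\<^bsub>F\<^esub> k \<cdot> h) \<noteq> st (inv\<^bsub>F\<^esub> k)"
        by (auto simp: cut_def)
      then obtain h' where h': "h = k @ h'" 
        using separating_prefix[OF HF[OF h] HF[OF k(1)] k(4)[unfolded st_def]] by blast
      then have c: "k \<in> carrier F" "h' \<in> carrier F" using HF[OF h] by (auto simp: append_in_F)
      have hk: "h = k \<cdot> h'" using mult_append h' HF[OF h] by simp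
      then have "h' = inv\<^bsub>F\<^esub> k \<cdot> h" using c by (simp add: F.inv_mult_cancel)
      then have "h' \<in> H" using h k(1) by simp
      moreover have "length h' < length h" "length k < length h" using h' k by auto
      ultimately have "k \<in> ?gen" "h' \<in> ?gen" using less.hyps k(1) by auto
      then have "k \<otimes>\<^bsub>L\<^esub> h' \<in> ?gen" using subgroup.m_closed[OF gen_sub] by blast
      then show ?thesis by (simp add: L_simps hk)
    next
      case False
      then have no: "st (k \<cdot> h) = st k" if "k \<in> H" "k \<noteq> []" "inv\<^bsub>F\<^esub> k \<noteq> h" for k
        using that ne_inv[of k] HF[OF that(1)] by (auto simp: cut_def dest: spec[of _ "inv\<^bsub>F\<^esub> k"])
      have no': "st (k \<cdot> h) = st k" if "k \<in> H" "k \<noteq> []" "k \<noteq> inv\<^bsub>F\<^esub> h" for k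
        using no[OF that(1,2)] that h HF by (metis F.inv_inv)
      have inv_h: "inv\<^bsub>F\<^esub> h \<in> H" using h by simp
      show ?thesis
      proof (cases "h = []")
        case True
        then show ?thesis using subgroup.one_closed[OF gen_sub] by (simp add: L_simps)
      next
        case ne: False
        have hinv: "inv\<^bsub>F\<^esub> h \<cdot> h = []" using HF[OF h] by (simp add: one_F)
        \<comment> \<open>Only the edges at \<open>[]\<close> and at \<open>h\<close> can separate
          the two now, so the first and last letters of \<open>h\<close> decide which of the three
          sets contains \<open>h\<close> or, in the third case, its inverse.\<close>
        consider "st h" "en h" | "st h" "\<not> en h" | "\<not> st h" "en h" | "\<not> st h" "\<not> en h" by blast
        then have "h \<in> A \<union> B \<union> T \<or> inv\<^bsub>F\<^esub> h \<in> T"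
        proof cases
          case 1
          have "st' (k \<cdot> h) = st' k" if k: "k \<in> H" for k
          proof -
            consider "k = []" | "k = inv\<^bsub>F\<^esub> h" | "k \<noteq> []" "k \<noteq> inv\<^bsub>F\<^esub> h" by blast
            then show ?thesis
            proof cases
              case 3
              have "k \<cdot> h \<noteq> []"
                using 3 k h HF by (metis F.inv_equality F.inv_inv one_F)
              then show ?thesis using no'[OF k 3] 3 by (simp add: st'_def)
            qed (use 1 h HF hinv st_inv in \<open>auto simp: st'_def\<close>)
          qed
          then show ?thesis using h by (simp add: B_def)
        next
          case 2
          have "st (k \<cdot> h) = st' k" if k: "k \<in> H" for k
          proof -
            consider "k = []" | "k = inv\<^bsub>F\<^esub> h" | "k \<noteq> []" "k \<noteq> inv\<^bsub>F\<^esub> h" by blast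
            then show ?thesis
            proof cases
              case 3
              then show ?thesis using no'[OF k 3] 3 by (simp add: st'_def)
            qed (use 2 h HF hinv st_inv ne ne_inv in \<open>auto simp: st'_def\<close>)
          qed
          then show ?thesis using h by (simp add: T_def)
        next
          case 3
          have "st (m \<cdot> inv\<^bsub>F\<^esub> h) = st' m" if m: "m \<in> H" for m
          proof -
            consider "m = []" | "m = h" | "m \<noteq> []" "m \<noteq> h" by blast
            then show ?thesis
            proof cases
              case 2
              have "m \<cdot> inv\<^bsub>F\<^esub> h = []" using HF[OF h] 2 by (simp add: one_F)
              then show ?thesis using 2 3 ne by (simp add: st'_def)
            next
              case c: 3
              define k where "k = m \<cdot> inv\<^bsub>F\<^esub> h"
              have k: "k \<in> H" "m = k \<cdot> h" using m h HF by (simp_all add: k_def F.m_assoc)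
              have "k \<noteq> []"
              proof
                assume "k = []"
                then have "m = h" using k(2) HF[OF h] by simp
                then show False using c by simp
              qed
              moreover have "k \<noteq> inv\<^bsub>F\<^esub> h"
              proof
                assume "k = inv\<^bsub>F\<^esub> h"
                then have "m = []" using k(2) hinv by simp
                then show False using c by simp
              qed
              ultimately have "st m = st k" using no'[OF k(1)] k(2) by simp
              then show ?thesis using c unfolding st'_def k_def[symmetric] by blast
            qed (use 3 h HF st_inv in simp)
          qed
          then show ?thesis using h by (simp add: T_def)
        next
          case 4
          have "st (k \<cdot> h) = st k" if k: "k \<in> H" for k
          proof -
            consider "k = []" | "k = inv\<^bsub>F\<^esub> h" | "k \<noteq> []" "k \<noteq> inv\<^bsub>F\<^esub> h" by blast
            then show ?thesis
              by cases (use 4 h HF hinv st_inv no'[OF k] in auto)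
          qed
          then show ?thesis using h by (simp add: A_def)
        qed
        then show ?thesis
        proof
          assume "inv\<^bsub>F\<^esub> h \<in> T"
          then have "inv\<^bsub>L\<^esub> (inv\<^bsub>F\<^esub> h) \<in> ?gen" by (intro generate.inv) simp
          then show ?thesis using h HF by (simp add: L_inv)
        qed (auto intro: generate.incl)
      qed
    qed
  qed
  have triv: "trivial_group (L\<lparr>carrier := C\<rparr>) \<longleftrightarrow> C = {[]}" if "subgroup C L" for C
    using L.subgroup_imp_group[OF that] by (auto simp: trivial_group_def L_simps)
  have split: "C = {[]} \<or> D = {[]}"
    if C: "subgroup C L" and D: "subgroup D L" and iso: "L \<cong> binary_free_product (L\<lparr>carrier := C\<rparr>) (L\<lparr>carrier := D\<rparr>)" for C D
    using freely_indecomposable_any_type[OF ind L.subgroup_imp_group[OF C] L.subgroup_imp_group[OF D]]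
      triv[OF C] triv[OF D] iso by (auto simp: L_def)
  show ?thesis
  proof (cases "T = {}")
    case True
    have gen: "generate L (A \<union> B) = carrier L"
      using generated True L.generate_incl[of "A \<union> B"] AH BH by (auto simp: L_simps)
    have "L \<cong> binary_free_product (L\<lparr>carrier := A\<rparr>) (L\<lparr>carrier := B\<rparr>)"
    proof (rule free_product_criterion[where X = "\<lambda>v. v \<noteq> [] \<and> \<not> st v" and Y = st])
      show "group L" by (rule L.is_group)
      show "a \<otimes>\<^bsub>L\<^esub> v \<noteq> [] \<and> \<not> st (a \<otimes>\<^bsub>L\<^esub> v)"
        if "a \<in> A" "a \<noteq> \<one>\<^bsub>L\<^esub>" "v \<in> carrier L" "v = \<one>\<^bsub>L\<^esub> \<or> st v" for a v
        using that typeA[of a] concat[of a v] AH HF by (auto simp: L_simps)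
      show "st (b \<otimes>\<^bsub>L\<^esub> v)"
        if "b \<in> B" "b \<noteq> \<one>\<^bsub>L\<^esub>" "v \<in> carrier L" "v = \<one>\<^bsub>L\<^esub> \<or> v \<noteq> [] \<and> \<not> st v" for b v
        using that typeB[of b] concat[of b v] BH HF by (auto simp: L_simps)
    qed (use A_L B_L gen in \<open>auto simp: L_simps\<close>)
    from split[OF A_L B_L this] show ?thesis
    proof
      assume "A = {[]}"
      then have "H = B" using gen L.generate_minimal L.generate_subgroup_incl[of "A \<union> B" B] B_L BH subgroup.one_closed[OF B_L]
        by (auto simp: L_simps)
      then show ?thesis using typeB by (auto simp: st_def)
    next
      assume "B = {[]}"
      then have "H = A" using gen L.generate_subgroup_incl[of "A \<union> B" A] A_L AH subgroup.one_closed[OF A_L]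
        by (auto simp: L_simps)
      then show ?thesis using typeA by (auto simp: st_def)
    qed
  next
    case False
    then obtain t where t: "t \<in> T" by blast
    have tH: "t \<in> H" and tF: "t \<in> carrier F" using t TH HF by auto
    note tt = typeT[OF t]
    have tA: "t \<cdot> a \<in> T" if "a \<in> A" for a
      using that t HF AH TH by (auto simp: A_def T_def simp flip: F.m_assoc)
    have T_tA: "inv\<^bsub>F\<^esub> t \<cdot> s \<in> A" if "s \<in> T" for s
    proof -
      have sH: "s \<in> H" using that TH by blast
      have "st (h \<cdot> (inv\<^bsub>F\<^esub> t \<cdot> s)) = st h" if h: "h \<in> H" for h
      proof -
        have "st (h \<cdot> (inv\<^bsub>F\<^esub> t \<cdot> s)) = st ((h \<cdot> inv\<^bsub>F\<^esub> t) \<cdot> s)"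
          using h tH sH HF by (simp add: F.m_assoc)
        also have "\<dots> = st' (h \<cdot> inv\<^bsub>F\<^esub> t)" using \<open>s \<in> T\<close> h tH by (simp add: T_def)
        also have "\<dots> = st ((h \<cdot> inv\<^bsub>F\<^esub> t) \<cdot> t)" using t h tH by (simp add: T_def)
        also have "\<dots> = st h" using h tH HF by (simp add: F.m_assoc)
        finally show ?thesis .
      qed
      then show ?thesis using sH tH by (simp add: A_def)
    qed
    have tBt: "inv\<^bsub>F\<^esub> t \<cdot> b \<cdot> t \<in> A" if "b \<in> B" for b
    proof -
      have bH: "b \<in> H" using that BH by blast
      have "st (h \<cdot> (inv\<^bsub>F\<^esub> t \<cdot> b \<cdot> t)) = st h" if h: "h \<in> H" for h
      proof -
        have "st (h \<cdot> (inv\<^bsub>F\<^esub> t \<cdot> b \<cdot> t)) = st (((h \<cdot> inv\<^bsub>F\<^esub> t) \<cdot> b) \<cdot> t)"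
          using h tH bH HF by (simp add: F.m_assoc)
        also have "\<dots> = st' ((h \<cdot> inv\<^bsub>F\<^esub> t) \<cdot> b)" using t h tH bH by (simp add: T_def)
        also have "\<dots> = st' (h \<cdot> inv\<^bsub>F\<^esub> t)" using \<open>b \<in> B\<close> h tH by (simp add: B_def)
        also have "\<dots> = st ((h \<cdot> inv\<^bsub>F\<^esub> t) \<cdot> t)" using t h tH by (simp add: T_def)
        also have "\<dots> = st h" using h tH HF by (simp add: F.m_assoc)
        finally show ?thesis .
      qed
      then show ?thesis using bH tH by (simp add: A_def)
    qed
    have tAt: "t \<cdot> a \<cdot> inv\<^bsub>F\<^esub> t \<in> B" if "a \<in> A" for a
    proof -
      have aH: "a \<in> H" using that AH by blast
      have "st' (h \<cdot> (t \<cdot> a \<cdot> inv\<^bsub>F\<^esub> t)) = st' h" if h: "h \<in> H" for h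
      proof -
        have "st' (h \<cdot> (t \<cdot> a \<cdot> inv\<^bsub>F\<^esub> t)) = st (h \<cdot> (t \<cdot> a \<cdot> inv\<^bsub>F\<^esub> t) \<cdot> t)"
          using t h aH tH by (simp add: T_def)
        also have "\<dots> = st ((h \<cdot> t) \<cdot> a)" using h tH aH HF by (simp add: F.m_assoc)
        also have "\<dots> = st (h \<cdot> t)" using \<open>a \<in> A\<close> h tH by (simp add: A_def)
        also have "\<dots> = st' h" using t h by (simp add: T_def)
        finally show ?thesis .
      qed
      then show ?thesis using aH tH by (simp add: B_def)
    qed
    define C where "C = range (\<lambda>n::int. t [^]\<^bsub>L\<^esub> n)"
    have tL: "t \<in> carrier L" using tH by (simp add: L_simps)
    have C_L: "subgroup C L" unfolding C_def by (rule L.subgroup_of_powers[OF tL])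
    have CH: "C \<subseteq> H" using subgroup.subset[OF C_L] by (simp add: L_simps)
    have tC: "t \<in> C" unfolding C_def using tL by (metis L.int_pow_1 rangeI)
    have tC': "inv\<^bsub>F\<^esub> t \<in> C" using subgroup.m_inv_closed[OF C_L tC] tH by (simp add: L_inv)
    have up: "st (t \<cdot> u)" if "u \<in> H" "st u" for u
      using concat(2)[of t u] that tt tH by simp
    have down: "\<not> st (inv\<^bsub>F\<^esub> t \<cdot> u)" if "u \<in> H" "\<not> st u" for u
      using concat(2)[of "inv\<^bsub>F\<^esub> t" u] that tt tH ne_inv en_inv st_inv by simp
    have pow_H: "u [^]\<^bsub>L\<^esub> n \<in> H" if "u \<in> H" for u and n :: nat
      using L.nat_pow_closed[of u n] that by (simp add: L_simps)
    have up_pow: "st (t [^]\<^bsub>L\<^esub> n \<cdot> u)" if "u \<in> H" "st u" for n :: nat and u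
      using that
    proof (induction n arbitrary: u)
      case (Suc n)
      have "t [^]\<^bsub>L\<^esub> Suc n \<cdot> u = t [^]\<^bsub>L\<^esub> n \<cdot> (t \<cdot> u)"
        using L.m_assoc[of "t [^]\<^bsub>L\<^esub> n" t u] Suc.prems pow_H[OF tH] tH by (simp add: L_simps)
      then show ?case using Suc.IH[of "t \<cdot> u"] up Suc.prems tH by simp
    qed (use HF L_simps(3) in simp)
    have down_pow: "\<not> st (inv\<^bsub>F\<^esub> t [^]\<^bsub>L\<^esub> n \<cdot> u)" if "u \<in> H" "\<not> st u" for n :: nat and u
      using that
    proof (induction n arbitrary: u)
      case (Suc n)
      have "inv\<^bsub>F\<^esub> t [^]\<^bsub>L\<^esub> Suc n \<cdot> u = inv\<^bsub>F\<^esub> t [^]\<^bsub>L\<^esub> n \<cdot> (inv\<^bsub>F\<^esub> t \<cdot> u)"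
        using L.m_assoc[of "inv\<^bsub>F\<^esub> t [^]\<^bsub>L\<^esub> n" "inv\<^bsub>F\<^esub> t" u] Suc.prems tH pow_H by (simp add: L_simps)
      then show ?case using Suc.IH[of "inv\<^bsub>F\<^esub> t \<cdot> u"] down Suc.prems tH by simp
    qed (use HF L_simps(3) in simp)
    \<comment> \<open>The edge at \<open>[]\<close> and its translate by the inverse of
      \<open>t\<close> both end at the collapsed vertex that \<open>A\<close> stabilises.
      \<open>Y\<close> collects what lies beyond one of these two edges, and \<open>X\<close> the
      remaining nontrivial elements.\<close>
    define X where "X v \<longleftrightarrow> v \<noteq> [] \<and> \<not> st v \<and> st (t \<cdot> v)" for v
    define Y where "Y v \<longleftrightarrow> st v \<or> \<not> st (t \<cdot> v)" for v
    have "Y (c \<cdot> v)" if c: "c \<in> C" "c \<noteq> []" and v: "v \<in> H" "v = [] \<or> X v" for c v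
    proof -
      have v': "\<not> st v" "st (t \<cdot> v)" using v tt tF by (auto simp: X_def)
      obtain n :: int where n: "c = t [^]\<^bsub>L\<^esub> n" using c by (auto simp: C_def)
      have tv: "t \<cdot> v \<in> H" using tH v by simp
      show ?thesis
      \<comment> \<open>One factor \<open>t\<close> or its inverse is split off, since the
        hypothesis speaks of \<open>t \<cdot> v\<close> and \<open>Y\<close> tests
        \<open>t \<cdot> (c \<cdot> v)\<close>.\<close>
      proof (cases "n > 0")
        case True
        then obtain m where m: "n = int (Suc m)" by (metis gr0_implies_Suc zero_less_imp_eq_int of_nat_0_less_iff)
        have "c \<cdot> v = t [^]\<^bsub>L\<^esub> m \<cdot> (t \<cdot> v)"
          using L.m_assoc[of "t [^]\<^bsub>L\<^esub> m" t v] v tH pow_H[OF tH] by (simp add: n m int_pow_int L_simps del: of_nat_Suc)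
        then show ?thesis using up_pow[OF tv v'(2)] by (simp add: Y_def)
      next
        case False
        moreover have "n \<noteq> 0" using n c L_simps(3) by auto
        ultimately obtain m where m: "n = - int (Suc m)"
          by (metis int_cases2 linorder_neqE_linordered_idom neg_equal_0_iff_equal not0_implies_Suc of_nat_0 of_nat_0_less_iff zero_less_Suc)
        have "c = inv\<^bsub>L\<^esub> t [^]\<^bsub>L\<^esub> Suc m" unfolding n m by (simp only: L.int_pow_neg_int[OF tL] L.nat_pow_inv[OF tL])
        also have "\<dots> = inv\<^bsub>L\<^esub> t \<otimes>\<^bsub>L\<^esub> inv\<^bsub>L\<^esub> t [^]\<^bsub>L\<^esub> m" using tL L.nat_pow_Suc2[of "inv\<^bsub>L\<^esub> t" m] by simp
        finally have c': "c = inv\<^bsub>F\<^esub> t \<cdot> inv\<^bsub>F\<^esub> t [^]\<^bsub>L\<^esub> m" using L_inv[OF tH] by (simp add: L_simps)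
        have pH: "inv\<^bsub>F\<^esub> t [^]\<^bsub>L\<^esub> m \<in> H" using L.nat_pow_closed[of "inv\<^bsub>F\<^esub> t" m] tH by (simp add: L_simps)
        have "t \<cdot> (c \<cdot> v) = inv\<^bsub>F\<^esub> t [^]\<^bsub>L\<^esub> m \<cdot> v"
          unfolding c' using HF tH pH v by (simp add: F.m_assoc F.inv_mult_cancel)
        then show ?thesis using down_pow[OF v(1) v'(1)] by (simp add: Y_def)
      qed
    qed
    note Y_step = this
    have X_step: "X (a \<cdot> v)" if a: "a \<in> A" "a \<noteq> []" and v: "v \<in> H" "v = [] \<or> Y v" for a v
    proof -
      have aH: "a \<in> H" using a AH by blast
      note ta = typeT[OF tA[OF a(1)]]
      have taH: "t \<cdot> a \<in> H" using tH aH by simp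
      have assoc: "t \<cdot> (a \<cdot> v) = (t \<cdot> a) \<cdot> v" using tH aH v HF by (simp add: F.m_assoc)
      consider "v = []" | "st v" | "\<not> st (t \<cdot> v)" using v by (auto simp: Y_def)
      then show ?thesis
      proof cases
        case 1
        then show ?thesis using a aH HF typeA[OF a(1)] ta by (auto simp: X_def)
      next
        case 2
        then show ?thesis
          using concat[OF aH v(1) a(2)] concat[OF taH v(1) ta(3)] typeA[OF a(1)] ta by (simp add: X_def assoc)
      next
        case 3
        \<comment> \<open>The products \<open>a \<cdot> v\<close> and
          \<open>t \<cdot> (a \<cdot> v)\<close> are rewritten as multiples of \<open>c\<close> by
          the inverse of an element \<open>s\<close> of \<open>T\<close> and by an element
          \<open>b\<close> of \<open>B\<close>. Both multipliers end in \<open>i\<close> while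
          \<open>c\<close> does not start there, so nothing cancels.\<close>
        define c where "c = t \<cdot> v"
        have c: "c \<in> H" "\<not> st c" using 3 tH v by (auto simp: c_def)
        define s where "s = t \<cdot> inv\<^bsub>F\<^esub> a"
        have s: "s \<in> T" unfolding s_def using tA subgroup.m_inv_closed[OF A_sub a(1)] by blast
        have sH: "s \<in> H" using s TH by blast
        define b where "b = t \<cdot> a \<cdot> inv\<^bsub>F\<^esub> t"
        have b: "b \<in> B" "b \<in> H" using tAt[OF a(1)] BH by (auto simp: b_def)
        have "a = inv\<^bsub>F\<^esub> t \<cdot> b \<cdot> t"
          using tH aH HF by (simp add: b_def F.m_assoc F.inv_mult_cancel)
        then have b1: "b \<noteq> []" using a tF by (auto simp: one_F[symmetric])
        have av: "a \<cdot> v = inv\<^bsub>F\<^esub> s \<cdot> c"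
          using tH aH HF v by (simp add: s_def c_def F.inv_mult_group F.m_assoc F.inv_mult_cancel)
        have tav: "t \<cdot> (a \<cdot> v) = b \<cdot> c"
          using tH aH HF v by (simp add: b_def c_def F.m_assoc F.inv_mult_cancel)
        have "a \<cdot> v \<noteq> []" "\<not> st (a \<cdot> v)"
          using concat[of "inv\<^bsub>F\<^esub> s" c] typeT[OF s] sH c ne_inv en_inv st_inv by (auto simp: av)
        moreover have "st (t \<cdot> (a \<cdot> v))"
          using concat[OF b(2) c(1) b1] typeB[OF b(1) b1] c by (simp add: tav)
        ultimately show ?thesis by (simp add: X_def)
      qed
    qed
    have "A \<union> B \<union> T \<subseteq> generate L (A \<union> C)"
    proof -
      have sub: "subgroup (generate L (A \<union> C)) L"
        using AH CH by (intro L.generate_is_subgroup) (auto simp: L_simps)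
      note mc = subgroup.m_closed[OF sub, unfolded L_simps]
      have inc: "x \<in> generate L (A \<union> C)" if "x \<in> A \<or> x \<in> C" for x using that by (auto intro: generate.incl)
      have "b \<in> generate L (A \<union> C)" if "b \<in> B" for b
      proof -
        have "b = t \<cdot> (inv\<^bsub>F\<^esub> t \<cdot> b \<cdot> t) \<cdot> inv\<^bsub>F\<^esub> t"
          using tF that BH HF by (simp add: F.m_assoc F.inv_mult_cancel subsetD)
        then show ?thesis using mc inc tC tC' tBt[OF that] by metis
      qed
      moreover have "s \<in> generate L (A \<union> C)" if "s \<in> T" for s
      proof -
        have "s = t \<cdot> (inv\<^bsub>F\<^esub> t \<cdot> s)" using tF that TH HF by (simp add: F.inv_mult_cancel subsetD)
        then show ?thesis using mc inc tC T_tA[OF that] by metis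
      qed
      ultimately show ?thesis using inc by blast
    qed
    then have "generate L (A \<union> B \<union> T) \<subseteq> generate L (A \<union> C)"
      using AH CH by (intro L.generate_subgroup_incl L.generate_is_subgroup) (auto simp: L_simps)
    then have gen: "generate L (A \<union> C) = carrier L"
      using generated L.generate_incl[of "A \<union> C"] AH CH by (auto simp: L_simps)
    have "L \<cong> binary_free_product (L\<lparr>carrier := A\<rparr>) (L\<lparr>carrier := C\<rparr>)"
      by (rule free_product_criterion[where X = X and Y = Y, OF L.is_group A_L C_L gen])
        (use X_step Y_step tt tF in \<open>auto simp: L_simps X_def[of "[]"] Y_def[of "[]"]\<close>)
    from split[OF A_L C_L this] have "A = {[]}" using tC tt(3) by auto
    then have "carrier L = C" using gen L.generate_subgroup_incl[of "A \<union> C" C] C_L CH subgroup.one_closed[OF C_L]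
      by (auto simp: L_simps)
    then have "cyclic_group L" using L.cyclic_group tL unfolding C_def by blast
    moreover have "infinite (carrier L)"
    proof
      assume fin: "finite (carrier L)"
      have "t [^]\<^bsub>L\<^esub> L.ord t = []" using L.pow_ord_eq_1[OF tL] by (simp add: L_simps)
      moreover obtain m where "L.ord t = Suc m" using L.ord_ge_1[OF fin tL] by (cases "L.ord t") auto
      ultimately have "t [^]\<^bsub>L\<^esub> m \<cdot> t = []" by (simp add: L_simps)
      then show False using up_pow[OF tH tt(1), of m] by simp
    qed
    ultimately show ?thesis using ncyc by (simp add: infinite_cyclic_def L_def)
  qed
qed

end

section \<open>Transport along isomorphisms and embeddings\<close>

lemma freely_indecomposable_iso:
  fixes G :: "'a monoid" and H :: "'b monoid"
  assumes "freely_indecomposable G" "G \<cong> H" "group H"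
  shows "freely_indecomposable H"
proof -
  have G: "group G" "\<not> trivial_group G" using assms(1) by (auto simp: freely_indecomposable_def)
  have "\<not> trivial_group H" using G assms(2,3) isomorphic_group_triviality by blast
  moreover have "\<not> H \<cong> binary_free_product A B"
    if "group A" "group B" "\<not> trivial_group A" "\<not> trivial_group B" for A B :: "'b monoid"
    using freely_indecomposable_any_type[OF assms(1) that] iso_trans[OF assms(2)] by blast
  ultimately show ?thesis using assms(3) by (auto simp: freely_indecomposable_def)
qed

lemma infinite_cyclic_iso:
  assumes "G \<cong> H" "group G" "group H"
  shows "infinite_cyclic G \<longleftrightarrow> infinite_cyclic H"
proof -
  obtain f where "bij_betw f (carrier G) (carrier H)" using assms(1) by (auto simp: is_iso_def iso_def)
  then show ?thesis
    using isomorphic_group_cyclicity[OF assms] by (simp add: infinite_cyclic_def bij_betw_finite)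
qed

text \<open>The least positive exponent that occurs in the image generates the image. This later
  excludes embeddings of the other factors into infinite cyclic ones.\<close>

lemma infinite_cyclic_embedding:
  assumes f: "f \<in> hom M L" and inj: "inj_on f (carrier M)" and M: "group M" "\<not> trivial_group M"
    and L: "group L" "infinite_cyclic L"
  shows "infinite_cyclic M"
proof -
  interpret M: group M by fact
  interpret L: group L by fact
  interpret f: group_hom M L f using f by unfold_locales
  obtain z where z: "z \<in> carrier L" and zr: "carrier L = range (\<lambda>n::int. z [^]\<^bsub>L\<^esub> n)"
    using L by (auto simp: infinite_cyclic_def L.cyclic_group)
  have "L.ord z = 0"
    using L.infinite_cyclic_subgroup_order[OF z] L.carrier_subgroup_generated_by_singleton[OF z] zr L(2)
    unfolding infinite_cyclic_def by metis
  then have z_inj: "z [^]\<^bsub>L\<^esub> m = z [^]\<^bsub>L\<^esub> n \<longleftrightarrow> m = n" for m n :: int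
    using L.int_pow_eq[OF z, of m n] by auto
  define P where "P d \<longleftrightarrow> d > 0 \<and> (\<exists>m\<in>carrier M. f m = z [^]\<^bsub>L\<^esub> int d)" for d
  have "\<exists>d. P d"
  proof -
    obtain m where m: "m \<in> carrier M" "m \<noteq> \<one>\<^bsub>M\<^esub>" using M by (auto simp: trivial_group_def)
    obtain n where n: "f m = z [^]\<^bsub>L\<^esub> (n::int)" using zr f.hom_closed[OF m(1)] by auto
    have "n \<noteq> 0" using n m inj f.hom_one by (metis M.one_closed inj_onD int_pow_0)
    have "f (inv\<^bsub>M\<^esub> m) = z [^]\<^bsub>L\<^esub> (- n)" using m n z by (simp add: L.int_pow_neg)
    have "P (nat n) \<or> P (nat (- n))"
    proof (cases "n > 0")
      case True
      then show ?thesis using m n by (auto simp: P_def)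
    next
      case False
      then show ?thesis
        unfolding P_def using M.inv_closed[OF m(1)] \<open>n \<noteq> 0\<close> \<open>f (inv\<^bsub>M\<^esub> m) = _\<close> by auto
    qed
    then show ?thesis by blast
  qed
  then obtain d where d: "P d" "\<And>e. P e \<Longrightarrow> d \<le> e" by (metis LeastI Least_le)
  obtain m0 where m0: "m0 \<in> carrier M" "f m0 = z [^]\<^bsub>L\<^esub> int d" and d0: "d > 0" using d by (auto simp: P_def)
  have fpow: "f (m0 [^]\<^bsub>M\<^esub> q) = z [^]\<^bsub>L\<^esub> (int d * q)" for q :: int
    using m0 z by (simp add: f.hom_int_pow L.int_pow_pow)
  have "m \<in> range (\<lambda>q::int. m0 [^]\<^bsub>M\<^esub> q)" if m: "m \<in> carrier M" for m
  proof -
    obtain n where n: "f m = z [^]\<^bsub>L\<^esub> (n::int)" using zr f.hom_closed[OF m] by auto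
    define q r where "q = n div int d" and "r = n mod int d"
    have r: "0 \<le> r" "r < int d" using d0 by (simp_all add: r_def)
    have "f (m \<otimes>\<^bsub>M\<^esub> m0 [^]\<^bsub>M\<^esub> (- q)) = z [^]\<^bsub>L\<^esub> (n + int d * - q)"
      using m m0 z n fpow by (simp flip: L.int_pow_mult)
    also have "n + int d * - q = r" by (simp add: q_def r_def minus_mult_div_eq_mod)
    finally have "f (m \<otimes>\<^bsub>M\<^esub> m0 [^]\<^bsub>M\<^esub> (- q)) = z [^]\<^bsub>L\<^esub> int (nat r)" using r by simp
    moreover have "m \<otimes>\<^bsub>M\<^esub> m0 [^]\<^bsub>M\<^esub> (- q) \<in> carrier M" using m m0 by simp
    ultimately have "P (nat r)" if "r \<noteq> 0" unfolding P_def using that r by auto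
    then have "r = 0" using d(2)[of "nat r"] r by linarith
    then have "n = int d * q" using mult_div_mod_eq[of "int d" n] by (simp add: q_def r_def)
    then have "f m = f (m0 [^]\<^bsub>M\<^esub> q)" using n fpow by simp
    then have "m = m0 [^]\<^bsub>M\<^esub> q" using inj m m0 by (auto dest: inj_onD)
    then show ?thesis by blast
  qed
  then have eq: "carrier M = range (\<lambda>q::int. m0 [^]\<^bsub>M\<^esub> q)" using m0 by auto
  then have "cyclic_group M" using M.cyclic_group m0 by blast
  moreover have "inj (\<lambda>q::int. m0 [^]\<^bsub>M\<^esub> q)"
  proof (rule injI)
    fix q r :: int assume "m0 [^]\<^bsub>M\<^esub> q = m0 [^]\<^bsub>M\<^esub> r"
    then have "int d * q = int d * r" using fpow z_inj by metis
    then show "q = r" using d0 by simp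
  qed
  then have "infinite (carrier M)" unfolding eq using finite_imageD infinite_UNIV_int by blast
  ultimately show ?thesis by (simp add: infinite_cyclic_def)
qed

section \<open>Conjugating subgroups into factors\<close>

context free_product_of_groups
begin

definition conj_by :: "('i \<times> 'a) list \<Rightarrow> ('i \<times> 'a) list \<Rightarrow> ('i \<times> 'a) list"
  where "conj_by g h = inv\<^bsub>F\<^esub> g \<cdot> h \<cdot> g"

lemma conj_by_hom: "g \<in> carrier F \<Longrightarrow> group_hom F F (conj_by g)"
proof -
  assume g: "g \<in> carrier F"
  have "conj_by g \<in> hom F F"
    using F.conj_hom[of "inv\<^bsub>F\<^esub> g"] g by (simp add: conj_by_def[abs_def])
  then show ?thesis by unfold_locales
qed

lemma conj_by_inj: "g \<in> carrier F \<Longrightarrow> inj_on (conj_by g) (carrier F)"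
  by (rule inj_onI) (simp add: conj_by_def)

lemma conj_by_mult:
  "g \<in> carrier F \<Longrightarrow> k \<in> carrier F \<Longrightarrow> h \<in> carrier F \<Longrightarrow>
    conj_by (g \<cdot> k) h = conj_by k (conj_by g h)"
  by (simp add: conj_by_def F.inv_mult_group F.m_assoc)

text \<open>One-sidedness is applied to the conjugate of \<open>H\<close> by \<open>g\<close>;
  closure under inverses turns the information on first letters into one on last letters.\<close>

lemma indecomposable_conjugate_one_sided:
  assumes H: "subgroup H F" and ind: "freely_indecomposable (F\<lparr>carrier := H\<rparr>)"
    and ncyc: "\<not> infinite_cyclic (F\<lparr>carrier := H\<rparr>)"
    and g: "g \<in> carrier F" and h: "h \<in> H" "starts_in i (conj_by g h)" and k: "k \<in> H" "conj_by g k \<noteq> []"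
  shows "starts_in i (conj_by g k)" "ends_in i (conj_by g k)"
proof -
  interpret c: group_hom F F "conj_by g" by (rule conj_by_hom[OF g])
  let ?H = "conj_by g ` H"
  have H': "subgroup ?H F" by (rule c.subgroup_img_is_subgroup[OF H])
  have "conj_by g \<in> iso (F\<lparr>carrier := H\<rparr>) (F\<lparr>carrier := ?H\<rparr>)"
    using conj_by_inj[OF g] subgroup.subset[OF H] c.homh
    by (auto simp: iso_def hom_def bij_betw_def subset_iff intro: inj_on_subset)
  then have iso: "F\<lparr>carrier := H\<rparr> \<cong> F\<lparr>carrier := ?H\<rparr>" by (rule is_isoI)
  have grp: "group (F\<lparr>carrier := H\<rparr>)" "group (F\<lparr>carrier := ?H\<rparr>)"
    using F.subgroup_imp_group H H' by auto
  have "(\<forall>h\<in>?H. \<not> starts_in i h) \<or> (\<forall>h\<in>?H. h \<noteq> [] \<longrightarrow> starts_in i h)"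
    using indecomposable_subgroup_one_sided[OF H' freely_indecomposable_iso[OF ind iso grp(2)]]
      infinite_cyclic_iso[OF iso grp] ncyc by blast
  then have all: "\<forall>h\<in>?H. h \<noteq> [] \<longrightarrow> starts_in i h" using h by blast
  then show "starts_in i (conj_by g k)" using k by blast
  have kF: "conj_by g k \<in> carrier F" using subgroup.subset[OF H'] k by blast
  have "inv\<^bsub>F\<^esub> (conj_by g k) \<in> ?H" using subgroup.m_inv_closed[OF H'] k by blast
  moreover have "inv\<^bsub>F\<^esub> (conj_by g k) \<noteq> []" using k kF by (metis F.inv_inv inv_Nil)
  ultimately show "ends_in i (conj_by g k)" using all starts_in_inv[OF kF] by blast
qed

text \<open>Conjugation by the first letter moves it to the end, where it merges with the last
  letter, so the word becomes shorter.\<close>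

lemma conj_by_letter:
  assumes "(i, a) # m @ [(i, b)] \<in> carrier F"
  shows "conj_by [(i, a)] ((i, a) # m @ [(i, b)]) = m \<cdot> incl i (b \<otimes>\<^bsub>G i\<^esub> a)"
proof -
  note w = Cons_in_F[OF assms]
  have m: "m \<in> carrier F" "[(i, b)] \<in> carrier F" using w(4) by (auto simp: append_in_F)
  interpret e: group_hom "G i" F "incl i" by (rule incl_hom[OF w(1)])
  have b: "b \<in> carrier (G i)" "b \<noteq> \<one>\<^bsub>G i\<^esub>" using m letter_in_F by auto
  have a: "[(i, a)] = incl i a" "[(i, b)] = incl i b" using w b by (auto simp: incl_eq)
  have "(i, a) # m @ [(i, b)] = incl i a \<cdot> (m \<cdot> incl i b)"
    using Cons_eq_incl_mult[OF assms] mult_append[OF w(4)] a by simp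
  then show ?thesis
    unfolding a(1) conj_by_def using w b m by (simp add: F.m_assoc F.inv_mult_cancel e.hom_mult)
qed

text \<open>Among all conjugates of nontrivial elements of \<open>H\<close>, one of least length is
  a single letter: by one-sidedness it starts and ends in the same factor, so a longer one could be
  shortened by conjugating with its first letter. The rest of \<open>H\<close> then has to follow
  into that factor.\<close>

theorem indecomposable_subgroup_in_conjugate:
  assumes H: "subgroup H F" and ind: "freely_indecomposable (F\<lparr>carrier := H\<rparr>)"
    and ncyc: "\<not> infinite_cyclic (F\<lparr>carrier := H\<rparr>)"
  shows "\<exists>w\<in>carrier F. \<exists>i\<in>I. \<forall>h\<in>H. \<exists>x\<in>carrier (G i). h = w \<cdot> incl i x \<cdot> inv\<^bsub>F\<^esub> w"
proof -
  have HF: "h \<in> carrier F" if "h \<in> H" for h using that subgroup.subset[OF H] by blast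
  note one_sided = indecomposable_conjugate_one_sided[OF H ind ncyc]
  have conj_ne: "conj_by g h \<noteq> []" if "g \<in> carrier F" "h \<in> H" "h \<noteq> []" for g h
  proof -
    have "conj_by g h \<noteq> conj_by g []"
      using conj_by_inj[OF that(1)] HF[OF that(2)] that(3) by (auto dest: inj_onD)
    then show ?thesis using that(1) by (simp add: conj_by_def one_F)
  qed
  have conj_F: "conj_by g h \<in> carrier F" if "g \<in> carrier F" "h \<in> H" for g h
    using that HF by (simp add: conj_by_def)
  have "H \<noteq> {[]}" using ind by (auto simp: freely_indecomposable_def trivial_group_def one_F)
  then obtain h0 where h0: "h0 \<in> H" "h0 \<noteq> []"
    using subgroup.one_closed[OF H] by (auto simp: one_F)
  define S where "S = {(g, h). g \<in> carrier F \<and> h \<in> H \<and> h \<noteq> []}"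
  have "([], h0) \<in> S" using h0 by (simp add: S_def)
  then obtain s where s: "s \<in> S" "\<And>s'. s' \<in> S \<Longrightarrow> length (conj_by (fst s) (snd s)) \<le> length (conj_by (fst s') (snd s'))"
    using ex_has_least_nat[of "\<lambda>s. s \<in> S" "([], h0)" "\<lambda>s. length (conj_by (fst s) (snd s))"] by blast
  define g h where "g = fst s" and "h = snd s"
  have g: "g \<in> carrier F" and h: "h \<in> H" "h \<noteq> []" using s(1) by (auto simp: S_def g_def h_def)
  have least: "length (conj_by g h) \<le> length (conj_by g' h')" if "g' \<in> carrier F" "h' \<in> H" "h' \<noteq> []" for g' h'
    using s(2)[of "(g', h')"] that by (simp add: S_def g_def h_def)
  obtain i x u where cons: "conj_by g h = (i, x) # u"
    using conj_ne[OF g h] by (metis list.exhaust prod.exhaust)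
  then have st: "starts_in i (conj_by g h)" by (simp add: starts_in_def)
  have cF: "(i, x) # u \<in> carrier F" using conj_F[OF g h(1)] cons by simp
  note ci = Cons_in_F[OF cF]
  have split_last: "\<exists>m b. v = m @ [(i, b)] \<and> m \<noteq> []"
    if v': "ends_in i ((i, a) # v)" "(i, a) # v \<in> carrier F" "v \<noteq> []" for a v
  proof -
    obtain m b where v: "v = m @ [b]" using v'(3) by (metis rev_exhaust)
    then have "fst b = i" using v'(1) by (simp add: ends_in_def)
    moreover have "m \<noteq> []" using Cons_in_F(5)[OF v'(2)] v \<open>fst b = i\<close> by (auto simp: starts_in_def)
    ultimately show ?thesis using v by (metis prod.collapse)
  qed
  have "u = []"
  proof (rule ccontr)
    assume "u \<noteq> []"
    then obtain m b where m: "u = m @ [(i, b)]"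
      using split_last[of x u] one_sided(2)[OF g h(1) st h(1)] conj_ne[OF g h] cons cF by auto
    have "length (conj_by g h) \<le> length (conj_by (g \<cdot> [(i, x)]) h)"
      using least h g ci by simp
    also have "conj_by (g \<cdot> [(i, x)]) h = m \<cdot> incl i (b \<otimes>\<^bsub>G i\<^esub> x)"
      using conj_by_mult[OF g ci(6) HF[OF h(1)]] conj_by_letter[of i x m b] cons cF m by simp
    also have "length \<dots> \<le> length m + length (incl i (b \<otimes>\<^bsub>G i\<^esub> x))"
      unfolding mult_F by (rule length_foldr_letter_mult)
    also have "\<dots> \<le> length m + 1" by (simp add: incl_eq)
    finally show False using cons m by simp
  qed
  have in_factor: "\<exists>y\<in>carrier (G i). conj_by g k = incl i y" if k: "k \<in> H" for k
  proof (cases "k = []")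
    case True
    then have "conj_by g k = []" using g by (simp add: conj_by_def one_F)
    then show ?thesis
      using group_hom.hom_one[OF incl_hom[OF ci(1)]] groups[OF ci(1)] group.is_monoid
      by (metis monoid.one_closed one_F)
  next
    case ne: False
    have kF: "conj_by g k \<in> carrier F" by (rule conj_F[OF g k])
    have k': "starts_in i (conj_by g k)" "ends_in i (conj_by g k)"
      using one_sided[OF g h(1) st k] conj_ne[OF g k ne] by auto
    then obtain a v where av: "conj_by g k = (i, a) # v"
      by (cases "conj_by g k") (auto simp: starts_in_def)
    note ca = Cons_in_F[OF kF[unfolded av]]
    have "v = []"
    proof (rule ccontr)
      assume "v \<noteq> []"
      then obtain m b where m: "v = m @ [(i, b)]" "m \<noteq> []" using split_last[of a v] k' kF av by auto
      \<comment> \<open>Conjugating further by the letter \<open>a\<close> keeps the image of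
        \<open>h\<close> in the factor \<open>i\<close>, so the image of \<open>k\<close> must still
        start there; but it now starts with \<open>m\<close>, which follows a letter of index
        \<open>i\<close>.\<close>
      let ?g = "g \<cdot> [(i, a)]"
      have g': "?g \<in> carrier F" using g ca by simp
      interpret Gi: group "G i" by (rule groups[OF ci(1)])
      interpret e: group_hom "G i" F "incl i" by (rule incl_hom[OF ci(1)])
      have "conj_by ?g h = conj_by (incl i a) (incl i x)"
        using conj_by_mult[OF g ca(6) HF[OF h(1)]] cons \<open>u = []\<close> ca ci by (simp add: incl_eq)
      also have "\<dots> = incl i (inv\<^bsub>G i\<^esub> a \<otimes>\<^bsub>G i\<^esub> x \<otimes>\<^bsub>G i\<^esub> a)"
        using ca ci by (simp add: conj_by_def)
      finally have eq: "conj_by ?g h = incl i (inv\<^bsub>G i\<^esub> a \<otimes>\<^bsub>G i\<^esub> x \<otimes>\<^bsub>G i\<^esub> a)" .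
      then have "starts_in i (conj_by ?g h)"
        using conj_ne[OF g' h] by (auto simp: incl_eq starts_in_def split: if_splits)
      then have st2: "starts_in i (conj_by ?g k)" using one_sided(1)[OF g' h(1) _ k] conj_ne[OF g' k ne] by blast
      have mF: "m \<in> carrier F" "fst (last m) \<noteq> i"
        using ca(4) m by (auto simp: append_in_F)
      have bc: "b \<otimes>\<^bsub>G i\<^esub> a \<in> carrier (G i)" using ca(2,4) m by (auto simp: append_in_F letter_in_F)
      have "m @ incl i (b \<otimes>\<^bsub>G i\<^esub> a) \<in> carrier F"
        using mF incl_in_F[OF ci(1) bc] by (auto simp: append_in_F incl_eq)
      then have "conj_by ?g k = m @ incl i (b \<otimes>\<^bsub>G i\<^esub> a)"
        using conj_by_mult[OF g ca(6) HF[OF k]] conj_by_letter[of i a m b] av kF m mult_append by simp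
      then have "starts_in i m" using st2 m(2) by (simp add: starts_in_append)
      then show False using ca(5) m by (simp add: starts_in_append)
    qed
    then show ?thesis using av ca by (intro bexI[of _ a]) (simp_all add: incl_eq)
  qed
  have "k = g \<cdot> conj_by g k \<cdot> inv\<^bsub>F\<^esub> g" if "k \<in> H" for k
    using g HF[OF that] by (simp add: conj_by_def F.m_assoc F.inv_mult_cancel)
  then show ?thesis using in_factor g ci(1) by metis
qed

text \<open>Factors are malnormal, and conjugates of different factors meet trivially. Once a last
  letter of index \<open>l\<close> is stripped from \<open>u\<close>, the conjugate is a reduced
  word as it stands, and it is a single letter only if the rest of \<open>u\<close> is
  empty.\<close>

lemma factor_meets_conjugate:
  assumes x: "i \<in> I" "x \<in> carrier (G i)" "x \<noteq> \<one>\<^bsub>G i\<^esub>" and y: "l \<in> I" "y \<in> carrier (G l)"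
    and u: "u \<in> carrier F" and eq: "incl i x = u \<cdot> incl l y \<cdot> inv\<^bsub>F\<^esub> u"
  shows "l = i \<and> (\<exists>c\<in>carrier (G i). u = incl i c)"
proof -
  interpret Gl: group "G l" by (rule groups[OF y(1)])
  interpret e: group_hom "G l" F "incl l" by (rule incl_hom[OF y(1)])
  have "\<exists>u0 c. u0 \<in> carrier F \<and> \<not> ends_in l u0 \<and> c \<in> carrier (G l) \<and> u = u0 \<cdot> incl l c"
  proof (cases "ends_in l u")
    case True
    then obtain u0 c where u0: "u = u0 @ [(l, c)]"
      by (cases u rule: rev_cases) (auto simp: ends_in_def)
    then have "u0 \<in> carrier F" "\<not> ends_in l u0" "[(l, c)] \<in> carrier F"
      using u by (auto simp: append_in_F ends_in_def)
    then show ?thesis using u0 mult_append[of u0 "[(l, c)]"] u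
      by (intro exI[of _ u0] exI[of _ c]) (simp add: letter_in_F incl_eq)
  next
    case False
    then show ?thesis using u by (intro exI[of _ u] exI[of _ "\<one>\<^bsub>G l\<^esub>"]) (simp add: one_F[symmetric])
  qed
  then obtain u0 c where u0: "u0 \<in> carrier F" "\<not> ends_in l u0" "c \<in> carrier (G l)" "u = u0 \<cdot> incl l c"
    by blast
  define z where "z = c \<otimes>\<^bsub>G l\<^esub> y \<otimes>\<^bsub>G l\<^esub> inv\<^bsub>G l\<^esub> c"
  have z: "z \<in> carrier (G l)" using u0 y by (simp add: z_def)
  have eq': "incl i x = u0 \<cdot> incl l z \<cdot> inv\<^bsub>F\<^esub> u0"
    unfolding eq u0(4) z_def using u0 y by (simp add: F.inv_mult_group F.m_assoc)
  have "z \<noteq> \<one>\<^bsub>G l\<^esub>"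
  proof
    assume "z = \<one>\<^bsub>G l\<^esub>"
    then have "incl i x = []" using eq' u0 by (simp add: one_F)
    then show False using x by (simp add: incl_eq)
  qed
  then have iz: "incl l z = [(l, z)]" by (simp add: incl_eq)
  have zF: "[(l, z)] \<in> carrier F" using z y \<open>z \<noteq> _\<close> by (simp add: letter_in_F)
  have u0z: "u0 @ [(l, z)] \<in> carrier F"
    using u0 zF by (auto simp: append_in_F ends_in_def)
  have "ends_in l (u0 @ [(l, z)])" by (simp add: ends_in_def)
  moreover have "\<not> starts_in l (inv\<^bsub>F\<^esub> u0)" using u0 by (simp add: starts_in_inv)
  ultimately have "incl i x = (u0 @ [(l, z)]) @ inv\<^bsub>F\<^esub> u0"
    using mult_alternating(1)[OF u0z F.inv_closed[OF u0(1)], of l] eq' mult_append[OF u0z] iz by simp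
  then have "u0 = []" using x by (cases u0) (auto simp: incl_eq)
  moreover from this have "incl i x = [(l, z)]"
    using \<open>incl i x = (u0 @ [(l, z)]) @ inv\<^bsub>F\<^esub> u0\<close> by simp
  ultimately show ?thesis using u0 x by (auto simp: incl_eq[of i x])
qed

text \<open>The image of the factor \<open>i\<close> lies in a conjugate of a factor
  \<open>j\<close>, and the inverse automorphism takes the factor \<open>j\<close> into a conjugate
  of a factor \<open>l\<close>. So the factor \<open>i\<close> meets a conjugate of the factor
  \<open>l\<close> nontrivially; malnormality gives \<open>l = i\<close> with a conjugator inside
  the factor, and \<theta> is onto.\<close>

theorem automorphism_permutes_factors:
  assumes ind: "\<And>j. j \<in> I \<Longrightarrow> freely_indecomposable (G j)"
    and \<phi>: "\<phi> \<in> iso F F" and i: "i \<in> I" "\<not> infinite_cyclic (G i)"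
  shows "\<exists>j\<in>I. \<not> infinite_cyclic (G j) \<and> (\<exists>w\<in>carrier F. \<exists>\<theta>\<in>iso (G i) (G j).
    \<forall>x\<in>carrier (G i). \<phi> (incl i x) = w \<cdot> incl j (\<theta> x) \<cdot> inv\<^bsub>F\<^esub> w)"
proof -
  have in_conj: "\<exists>j\<in>I. \<exists>w\<in>carrier F. \<forall>x\<in>carrier (G i). \<exists>y\<in>carrier (G j).
      \<phi> (incl i x) = w \<cdot> incl j y \<cdot> inv\<^bsub>F\<^esub> w"
    if \<phi>: "\<phi> \<in> iso F F" and i: "i \<in> I" "\<not> infinite_cyclic (G i)" for \<phi> i
  proof -
    interpret e: group_hom "G i" F "incl i" by (rule incl_hom[OF i(1)])
    interpret p: group_hom F F \<phi> using \<phi> by unfold_locales (simp add: iso_def)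
    let ?H = "(\<phi> \<circ> incl i) ` carrier (G i)"
    have "\<phi> \<circ> incl i \<in> hom (G i) F" by (rule hom_compose[OF e.homh p.homh])
    then interpret q: group_hom "G i" F "\<phi> \<circ> incl i" by unfold_locales
    have H: "subgroup ?H F" by (rule q.img_is_subgroup)
    have "inj_on (\<phi> \<circ> incl i) (carrier (G i))"
      using incl_inj[OF i(1)] \<phi> incl_in_F[OF i(1)]
      by (intro comp_inj_on) (auto simp: iso_def bij_betw_def intro: inj_on_subset)
    then have "\<phi> \<circ> incl i \<in> iso (G i) (F\<lparr>carrier := ?H\<rparr>)"
      using q.homh by (auto simp: iso_def hom_def bij_betw_def)
    then have iso: "G i \<cong> F\<lparr>carrier := ?H\<rparr>" by (rule is_isoI)
    have grp: "group (F\<lparr>carrier := ?H\<rparr>)" by (rule F.subgroup_imp_group[OF H])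
    obtain w j where "w \<in> carrier F" "j \<in> I"
      "\<forall>h\<in>?H. \<exists>y\<in>carrier (G j). h = w \<cdot> incl j y \<cdot> inv\<^bsub>F\<^esub> w"
      using indecomposable_subgroup_in_conjugate[OF H freely_indecomposable_iso[OF ind[OF i(1)] iso grp]]
        infinite_cyclic_iso[OF iso _ grp] groups i by blast
    then show ?thesis by (auto intro!: bexI[of _ j] bexI[of _ w])
  qed
  obtain j w where j: "j \<in> I" and w: "w \<in> carrier F"
    and cw: "\<And>x. x \<in> carrier (G i) \<Longrightarrow> \<exists>y\<in>carrier (G j). \<phi> (incl i x) = w \<cdot> incl j y \<cdot> inv\<^bsub>F\<^esub> w"
    using in_conj[OF \<phi> i] by blast
  interpret Gi: group "G i" by (rule groups[OF i(1)])
  interpret Gj: group "G j" by (rule groups[OF j])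
  interpret e: group_hom "G i" F "incl i" by (rule incl_hom[OF i(1)])
  interpret e': group_hom "G j" F "incl j" by (rule incl_hom[OF j])
  interpret p: group_hom F F \<phi> using \<phi> by unfold_locales (simp add: iso_def)
  define \<theta> where "\<theta> x = (SOME y. y \<in> carrier (G j) \<and> \<phi> (incl i x) = w \<cdot> incl j y \<cdot> inv\<^bsub>F\<^esub> w)" for x
  have \<theta>: "\<theta> x \<in> carrier (G j)" "\<phi> (incl i x) = w \<cdot> incl j (\<theta> x) \<cdot> inv\<^bsub>F\<^esub> w"
    if "x \<in> carrier (G i)" for x
    using someI_ex[of "\<lambda>y. y \<in> carrier (G j) \<and> \<phi> (incl i x) = w \<cdot> incl j y \<cdot> inv\<^bsub>F\<^esub> w"] cw[OF that]
    by (auto simp: \<theta>_def)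
  have cancel: "y = y'" if "y \<in> carrier (G j)" "y' \<in> carrier (G j)"
    "w \<cdot> incl j y \<cdot> inv\<^bsub>F\<^esub> w = w \<cdot> incl j y' \<cdot> inv\<^bsub>F\<^esub> w" for y y'
  proof -
    have "incl j y = incl j y'" using that w by simp
    then show ?thesis using incl_inj[OF j] that by (auto dest: inj_onD)
  qed
  have \<theta>_hom: "\<theta> \<in> hom (G i) (G j)"
  proof (rule homI)
    fix x y assume xy: "x \<in> carrier (G i)" "y \<in> carrier (G i)"
    show "\<theta> (x \<otimes>\<^bsub>G i\<^esub> y) = \<theta> x \<otimes>\<^bsub>G j\<^esub> \<theta> y"
    proof (rule cancel)
      have "w \<cdot> incl j (\<theta> (x \<otimes>\<^bsub>G i\<^esub> y)) \<cdot> inv\<^bsub>F\<^esub> w = \<phi> (incl i x) \<cdot> \<phi> (incl i y)"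
        using \<theta>(2)[of "x \<otimes>\<^bsub>G i\<^esub> y"] xy by simp
      also have "\<dots> = w \<cdot> incl j (\<theta> x \<otimes>\<^bsub>G j\<^esub> \<theta> y) \<cdot> inv\<^bsub>F\<^esub> w"
        using xy \<theta>(1) w by (simp add: \<theta>(2) F.m_assoc F.inv_mult_cancel)
      finally show "w \<cdot> incl j (\<theta> (x \<otimes>\<^bsub>G i\<^esub> y)) \<cdot> inv\<^bsub>F\<^esub> w
        = w \<cdot> incl j (\<theta> x \<otimes>\<^bsub>G j\<^esub> \<theta> y) \<cdot> inv\<^bsub>F\<^esub> w" .
    qed (use xy \<theta>(1) in auto)
  qed (use \<theta> in auto)
  have \<phi>_inj: "inj_on \<phi> (carrier F)" and \<phi>_sur: "\<phi> ` carrier F = carrier F"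
    using \<phi> by (auto simp: iso_def bij_betw_def)
  have \<theta>_inj: "inj_on \<theta> (carrier (G i))"
  proof (rule inj_onI)
    fix x y assume xy: "x \<in> carrier (G i)" "y \<in> carrier (G i)" "\<theta> x = \<theta> y"
    then have "\<phi> (incl i x) = \<phi> (incl i y)" by (simp add: \<theta>(2))
    then have "incl i x = incl i y" using \<phi>_inj xy by (auto dest: inj_onD)
    then show "x = y" using incl_inj[OF i(1)] xy by (auto dest: inj_onD)
  qed
  have nontriv: "\<not> trivial_group (G i)" using ind[OF i(1)] by (simp add: freely_indecomposable_def)
  \<comment> \<open>This allows \<open>in_conj\<close> to be applied to the inverse automorphism and
    the factor \<open>j\<close>.\<close>
  have ncyc: "\<not> infinite_cyclic (G j)"
    using infinite_cyclic_embedding[OF \<theta>_hom \<theta>_inj Gi.is_group nontriv Gj.is_group] i(2) by blast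
  define \<psi> where "\<psi> = inv_into (carrier F) \<phi>"
  have \<psi>: "\<psi> \<in> iso F F" unfolding \<psi>_def by (rule F.iso_set_sym[OF \<phi>])
  interpret s: group_hom F F \<psi> using \<psi> by unfold_locales (simp add: iso_def)
  have \<psi>\<phi>: "\<psi> (\<phi> g) = g" if "g \<in> carrier F" for g
    unfolding \<psi>_def using \<phi>_inj that by (rule inv_into_f_f)
  have \<phi>\<psi>: "\<phi> (\<psi> g) = g" if "g \<in> carrier F" for g
    unfolding \<psi>_def using \<phi>_sur that by (simp add: f_inv_into_f)
  obtain l v where l: "l \<in> I" and v: "v \<in> carrier F"
    and cv: "\<And>y. y \<in> carrier (G j) \<Longrightarrow> \<exists>z\<in>carrier (G l). \<psi> (incl j y) = v \<cdot> incl l z \<cdot> inv\<^bsub>F\<^esub> v"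
    using in_conj[OF \<psi> j ncyc] by blast
  define u where "u = \<psi> w \<cdot> v"
  have u: "u \<in> carrier F" using w v by (simp add: u_def)
  have cu: "\<exists>z\<in>carrier (G l). \<psi> (w \<cdot> incl j y \<cdot> inv\<^bsub>F\<^esub> w) = u \<cdot> incl l z \<cdot> inv\<^bsub>F\<^esub> u"
    if y: "y \<in> carrier (G j)" for y
  proof -
    obtain z where z: "z \<in> carrier (G l)" "\<psi> (incl j y) = v \<cdot> incl l z \<cdot> inv\<^bsub>F\<^esub> v" using cv[OF y] by blast
    have "\<psi> (w \<cdot> incl j y \<cdot> inv\<^bsub>F\<^esub> w) = \<psi> w \<cdot> (v \<cdot> incl l z \<cdot> inv\<^bsub>F\<^esub> v) \<cdot> inv\<^bsub>F\<^esub> (\<psi> w)"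
      using w y by (simp flip: z(2))
    also have "\<dots> = u \<cdot> incl l z \<cdot> inv\<^bsub>F\<^esub> u"
      using w v incl_in_F[OF l z(1)] by (simp add: u_def F.inv_mult_group F.m_assoc)
    finally show ?thesis using z(1) by blast
  qed
  obtain x0 where x0: "x0 \<in> carrier (G i)" "x0 \<noteq> \<one>\<^bsub>G i\<^esub>"
    using nontriv Gi.is_group by (auto simp: trivial_group_def)
  have "\<exists>z\<in>carrier (G l). incl i x0 = u \<cdot> incl l z \<cdot> inv\<^bsub>F\<^esub> u"
    using cu[OF \<theta>(1)[OF x0(1)]] \<psi>\<phi>[of "incl i x0"] x0 by (simp flip: \<theta>(2))
  then obtain c where li: "l = i" and c: "c \<in> carrier (G i)" "u = incl i c"
    using factor_meets_conjugate[OF i(1) x0 l _ u] by blast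
  have "y \<in> \<theta> ` carrier (G i)" if y: "y \<in> carrier (G j)" for y
  proof -
    obtain z where z: "z \<in> carrier (G i)"
      "\<psi> (w \<cdot> incl j y \<cdot> inv\<^bsub>F\<^esub> w) = u \<cdot> incl i z \<cdot> inv\<^bsub>F\<^esub> u"
      using cu[OF y] li by blast
    define x where "x = c \<otimes>\<^bsub>G i\<^esub> z \<otimes>\<^bsub>G i\<^esub> inv\<^bsub>G i\<^esub> c"
    have x: "x \<in> carrier (G i)" using c z by (simp add: x_def)
    have "\<psi> (w \<cdot> incl j y \<cdot> inv\<^bsub>F\<^esub> w) = incl i x" using z c by (simp add: x_def)
    then have "\<phi> (incl i x) = w \<cdot> incl j y \<cdot> inv\<^bsub>F\<^esub> w"
      using \<phi>\<psi>[of "w \<cdot> incl j y \<cdot> inv\<^bsub>F\<^esub> w"] w y by simp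
    then have "y = \<theta> x" unfolding \<theta>(2)[OF x] by (intro cancel[OF y \<theta>(1)[OF x]]) (rule sym)
    then show ?thesis using x by blast
  qed
  then have "\<theta> \<in> iso (G i) (G j)"
    using \<theta>_hom \<theta>_inj \<theta>(1) by (auto simp: iso_def bij_betw_def)
  then show ?thesis using j ncyc w \<theta>(2) by blast
qed

end

section \<open>Homomorphisms to finite groups\<close>

text \<open>\<Phi> assigns finitely many labels, with equal labels only inside one right coset of
  \<open>K\<close>. If infinitely many \<open>y\<close> shared a class, each would be reached from
  \<open>y0\<close> by some \<open>c y\<close>; two of these have the same label, and their quotient
  is a twisted conjugator in \<open>K\<close>.\<close>

lemma reidemeister_number_infinite:
  fixes G :: "('a, 'b) monoid_scheme" (structure)
  assumes "group G" and \<phi>: "\<phi> \<in> iso G G"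
    and fin: "finite (\<Phi> ` carrier G)"
    and \<Phi>: "\<And>g g'. \<lbrakk>g \<in> carrier G; g' \<in> carrier G; \<Phi> g = \<Phi> g'\<rbrakk> \<Longrightarrow> g' \<otimes>\<^bsub>G\<^esub> inv\<^bsub>G\<^esub> g \<in> K"
    and Y: "Y \<subseteq> carrier G" "infinite Y"
    and sep: "\<And>y y'. \<lbrakk>y \<in> Y; y' \<in> Y; y \<noteq> y'\<rbrakk> \<Longrightarrow> \<not> (\<exists>k\<in>K. y' = k \<otimes>\<^bsub>G\<^esub> y \<otimes>\<^bsub>G\<^esub> inv\<^bsub>G\<^esub> (\<phi> k))"
  shows "reidemeister_number G \<phi> = \<infinity>"
proof -
  interpret group G by fact
  interpret p: group_hom G G \<phi> using \<phi> by unfold_locales (simp add: iso_def)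
  let ?act = "\<lambda>g x. g \<otimes> x \<otimes> \<phi> (inv g)"
  have "infinite (twisted_conjugacy_classes G \<phi>)"
  proof
    assume fin_cl: "finite (twisted_conjugacy_classes G \<phi>)"
    have "orbit G ?act ` Y \<subseteq> twisted_conjugacy_classes G \<phi>"
      using Y by (auto simp: twisted_conjugacy_classes_def orbits_def)
    then have "finite (orbit G ?act ` Y)" using fin_cl finite_subset by blast
    then obtain y0 where y0: "y0 \<in> Y" "infinite {y \<in> Y. orbit G ?act y = orbit G ?act y0}"
      using pigeonhole_infinite[OF Y(2)] by blast
    define Z where "Z = {y \<in> Y. orbit G ?act y = orbit G ?act y0}"
    have y0G: "y0 \<in> carrier G" using y0 Y by blast
    have "\<exists>g\<in>carrier G. y = ?act g y0" if "y \<in> Z" for y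
    proof -
      have yG: "y \<in> carrier G" using that Y by (auto simp: Z_def)
      have "y = ?act \<one> y" using yG by simp
      then have "y \<in> orbit G ?act y" using yG unfolding orbit_def by blast
      then have "y \<in> orbit G ?act y0" using that by (simp add: Z_def)
      then show ?thesis unfolding orbit_def by blast
    qed
    then obtain c where c: "\<And>y. y \<in> Z \<Longrightarrow> c y \<in> carrier G \<and> y = ?act (c y) y0" by metis
    have "\<not> inj_on (\<lambda>y. \<Phi> (c y)) Z"
    proof
      assume "inj_on (\<lambda>y. \<Phi> (c y)) Z"
      moreover have "(\<lambda>y. \<Phi> (c y)) ` Z \<subseteq> \<Phi> ` carrier G" using c by blast
      ultimately have "finite Z" using fin by (meson finite_imageD finite_subset)
      then show False using y0 by (simp add: Z_def)
    qed
    then obtain y y' where y: "y \<in> Z" "y' \<in> Z" "y \<noteq> y'" "\<Phi> (c y) = \<Phi> (c y')"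
      by (auto simp: inj_on_def)
    define k where "k = c y' \<otimes> inv (c y)"
    have k: "k \<in> K" unfolding k_def using \<Phi>[OF _ _ y(4)] c y by blast
    have cc: "c y \<in> carrier G" "c y' \<in> carrier G" "\<phi> (c y) \<in> carrier G" "\<phi> (c y') \<in> carrier G"
      using c y by auto
    have "k \<otimes> (c y \<otimes> y0 \<otimes> inv (\<phi> (c y))) \<otimes> inv (\<phi> k) = c y' \<otimes> y0 \<otimes> inv (\<phi> (c y'))"
      using cc y0G by (simp add: k_def inv_mult_group m_assoc inv_mult_cancel)
    moreover have "y = c y \<otimes> y0 \<otimes> inv (\<phi> (c y))" "y' = c y' \<otimes> y0 \<otimes> inv (\<phi> (c y'))"
      using c[OF y(1)] c[OF y(2)] by auto
    ultimately have "y' = k \<otimes> y \<otimes> inv (\<phi> k)" by simp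
    then show False using sep y k by (auto simp: Z_def)
  qed
  then show ?thesis by (simp add: reidemeister_number_def)
qed

text \<open>\<open>L_iso\<close> with \<open>i = j\<close> makes \<open>L j\<close> characteristic;
  with different indices it makes the choices agree on isomorphic factors, which an automorphism may
  permute.\<close>

locale factor_kernels = free_product_of_groups I G for I :: "'i set" and G :: "'i \<Rightarrow> 'a monoid" +
  fixes L :: "'i \<Rightarrow> 'a set"
  assumes fin_I: "finite I"
    and ind: "\<And>j. j \<in> I \<Longrightarrow> freely_indecomposable (G j)"
    and L_normal: "\<And>j. j \<in> I \<Longrightarrow> L j \<lhd> G j"
    and L_index: "\<And>j. \<lbrakk>j \<in> I; \<not> infinite_cyclic (G j)\<rbrakk> \<Longrightarrow> finite (rcosets\<^bsub>G j\<^esub> L j)"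
    and L_iso: "\<And>i j \<theta>. \<lbrakk>i \<in> I; j \<in> I; \<theta> \<in> iso (G i) (G j)\<rbrakk> \<Longrightarrow> \<theta> ` L i = L j"
begin

text \<open>Infinite cyclic factors are spared because only the other ones are known to be permuted
  up to conjugacy. This is what makes the set stable under automorphisms.\<close>

definition admissible :: "('b, 'c) monoid_scheme \<Rightarrow> (('i \<times> 'a) list \<Rightarrow> 'b) set"
  where "admissible W = {f \<in> hom F W. \<forall>j\<in>I. \<not> infinite_cyclic (G j) \<longrightarrow> (\<forall>x\<in>L j. f (incl j x) = \<one>\<^bsub>W\<^esub>)}"

lemma L_subset: "j \<in> I \<Longrightarrow> L j \<subseteq> carrier (G j)"
  using normal_imp_subgroup[OF L_normal] by (rule subgroup.subset)

lemma admissible_hom: "group W \<Longrightarrow> f \<in> admissible W \<Longrightarrow> group_hom F W f"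
  using F.is_group by (simp add: group_hom_def group_hom_axioms_def admissible_def)

text \<open>An automorphism takes \<open>L i\<close> to a conjugate of some \<open>L j\<close>, and
  vanishing on a set is inherited by its conjugates.\<close>

lemma admissible_comp:
  assumes W: "group W" and f: "f \<in> admissible W" and \<phi>: "\<phi> \<in> iso F F"
  shows "f \<circ> \<phi> \<in> admissible W"
proof -
  interpret f: group_hom F W f by (rule admissible_hom[OF W f])
  have "f \<circ> \<phi> \<in> hom F W" using \<phi> f.homh by (intro hom_compose[of \<phi> F F]) (auto simp: iso_def)
  moreover have "(f \<circ> \<phi>) (incl i x) = \<one>\<^bsub>W\<^esub>" if i: "i \<in> I" "\<not> infinite_cyclic (G i)" and x: "x \<in> L i" for i x
  proof -
    have xG: "x \<in> carrier (G i)" using L_subset i x by blast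
    obtain j w \<theta> where j: "j \<in> I" "\<not> infinite_cyclic (G j)" and w: "w \<in> carrier F" and \<theta>: "\<theta> \<in> iso (G i) (G j)"
      and eq: "\<phi> (incl i x) = w \<cdot> incl j (\<theta> x) \<cdot> inv\<^bsub>F\<^esub> w"
      using automorphism_permutes_factors[OF ind \<phi> i] xG by blast
    have "\<theta> x \<in> L j" using L_iso[OF i(1) j(1) \<theta>] x by blast
    then have "f (incl j (\<theta> x)) = \<one>\<^bsub>W\<^esub>" "\<theta> x \<in> carrier (G j)"
      using f j L_subset by (auto simp: admissible_def)
    then show ?thesis using w j incl_in_F by (simp add: eq)
  qed
  ultimately show ?thesis by (simp add: admissible_def)
qed

lemma F_induct [consumes 1, case_names one mult]:
  assumes "w \<in> carrier F" and "P []"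
    and "\<And>i x w. \<lbrakk>i \<in> I; x \<in> carrier (G i); w \<in> carrier F; P w\<rbrakk> \<Longrightarrow> P (incl i x \<cdot> w)"
  shows "P w"
  using assms(1)
proof (induction w)
  case (Cons p w)
  obtain i x where p: "p = (i, x)" by fastforce
  note c = Cons_in_F[OF Cons.prems[unfolded p]]
  show ?case using assms(3)[OF c(1,2,4) Cons.IH[OF c(4)]] Cons_eq_incl_mult[OF Cons.prems[unfolded p]]
    by (simp add: p)
qed (rule assms(2))

text \<open>A generator of each infinite cyclic factor and coset representatives of
  \<open>L j\<close> in each other factor form such a set. This takes the place of finite
  generation.\<close>

lemma finite_test_set:
  fixes W :: "('b, 'c) monoid_scheme"
  assumes W: "group W"
  shows "\<exists>Y. finite Y \<and> Y \<subseteq> carrier F \<and>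
    (\<forall>f f'. f \<in> admissible W \<longrightarrow> f' \<in> admissible W \<longrightarrow>
      (\<forall>y\<in>Y. f y = f' y) \<longrightarrow> (\<forall>x\<in>carrier F. f x = f' x))"
proof -
  define P where "P j R \<longleftrightarrow> finite R \<and> R \<subseteq> carrier (G j) \<and>
    (\<forall>f f'. f \<in> admissible W \<longrightarrow> f' \<in> admissible W \<longrightarrow>
      (\<forall>y\<in>R. f (incl j y) = f' (incl j y)) \<longrightarrow> (\<forall>x\<in>carrier (G j). f (incl j x) = f' (incl j x)))" for j R
  have ex: "\<exists>R. P j R" if j: "j \<in> I" for j
  proof -
    interpret Gj: group "G j" by (rule groups[OF j])
    interpret e: group_hom "G j" F "incl j" by (rule incl_hom[OF j])
    have hom: "group_hom (G j) W (f \<circ> incl j)" if "f \<in> admissible W" for f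
      using W that hom_compose[OF e.homh, of f W] Gj.is_group
      by (auto simp: group_hom_def group_hom_axioms_def admissible_def)
    show ?thesis
    proof (cases "infinite_cyclic (G j)")
      case True
      then obtain z where z: "z \<in> carrier (G j)" "carrier (G j) = range (\<lambda>n::int. z [^]\<^bsub>G j\<^esub> n)"
        by (auto simp: infinite_cyclic_def Gj.cyclic_group)
      have "f (incl j x) = f' (incl j x)"
        if f: "f \<in> admissible W" "f' \<in> admissible W" "f (incl j z) = f' (incl j z)" "x \<in> carrier (G j)"
        for f f' x
      proof -
        obtain n :: int where n: "x = z [^]\<^bsub>G j\<^esub> n" using f(4) z by blast
        show ?thesis
          using group_hom.hom_int_pow[OF hom[OF f(1)] z(1), of n] group_hom.hom_int_pow[OF hom[OF f(2)] z(1), of n] f(3)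
          by (simp add: n)
      qed
      then show ?thesis using z(1) unfolding P_def by (intro exI[of _ "{z}"]) simp
    next
      case False
      define R where "R = (\<lambda>C. SOME r. r \<in> C) ` (rcosets\<^bsub>G j\<^esub> L j)"
      have sub: "subgroup (L j) (G j)" by (rule normal_imp_subgroup[OF L_normal[OF j]])
      have some: "(SOME r. r \<in> C) \<in> C" if "C \<in> rcosets\<^bsub>G j\<^esub> L j" for C
        using subgroup.rcosets_non_empty[OF sub that] by (simp add: some_in_eq)
      have fin: "finite R" using L_index[OF j False] by (simp add: R_def)
      have RG: "R \<subseteq> carrier (G j)"
        unfolding R_def using some Gj.rcosets_part_G[OF sub] by blast
      have rep: "\<exists>r\<in>R. \<exists>l\<in>L j. x = l \<otimes>\<^bsub>G j\<^esub> r" if x: "x \<in> carrier (G j)" for x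
      proof -
        have C: "L j #>\<^bsub>G j\<^esub> x \<in> rcosets\<^bsub>G j\<^esub> L j" using x by (auto simp: RCOSETS_def)
        define r where "r = (SOME r. r \<in> L j #>\<^bsub>G j\<^esub> x)"
        have r: "r \<in> L j #>\<^bsub>G j\<^esub> x" using some[OF C] by (simp add: r_def)
        then obtain l where l: "l \<in> L j" "r = l \<otimes>\<^bsub>G j\<^esub> x" by (auto simp: r_coset_def)
        have "x = inv\<^bsub>G j\<^esub> l \<otimes>\<^bsub>G j\<^esub> r" using l x L_subset[OF j] by (simp add: Gj.inv_mult_cancel subsetD)
        moreover have "inv\<^bsub>G j\<^esub> l \<in> L j" using subgroup.m_inv_closed[OF sub l(1)] .
        moreover have "r \<in> R" unfolding R_def r_def using C by blast
        ultimately show ?thesis by blast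
      qed
      have "f (incl j x) = f' (incl j x)"
        if f: "f \<in> admissible W" "f' \<in> admissible W" "\<forall>y\<in>R. f (incl j y) = f' (incl j y)" "x \<in> carrier (G j)"
        for f f' x
      proof -
        obtain r l where rl: "r \<in> R" "l \<in> L j" "x = l \<otimes>\<^bsub>G j\<^esub> r" using rep[OF f(4)] by blast
        have c: "l \<in> carrier (G j)" "r \<in> carrier (G j)" using rl RG L_subset[OF j] by auto
        interpret f: group_hom "G j" W "f \<circ> incl j" by (rule hom[OF f(1)])
        interpret f': group_hom "G j" W "f' \<circ> incl j" by (rule hom[OF f(2)])
        have "f (incl j l) = \<one>\<^bsub>W\<^esub>" "f' (incl j l) = \<one>\<^bsub>W\<^esub>"
          using f(1,2) j False rl(2) by (auto simp: admissible_def)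
        then show ?thesis
          using f.hom_mult[OF c] f'.hom_mult[OF c] f(3) rl f.hom_closed[OF c(2)] f'.hom_closed[OF c(2)] by simp
      qed
      then show ?thesis using fin RG unfolding P_def by (intro exI[of _ R]) blast
    qed
  qed
  define R where "R j = (SOME R. P j R)" for j
  have "P j (R j)" if "j \<in> I" for j unfolding R_def using ex[OF that] by (rule someI_ex)
  then have R: "finite (R j)" "R j \<subseteq> carrier (G j)"
    "\<And>f f' x. \<lbrakk>f \<in> admissible W; f' \<in> admissible W;
      \<forall>y\<in>R j. f (incl j y) = f' (incl j y); x \<in> carrier (G j)\<rbrakk> \<Longrightarrow> f (incl j x) = f' (incl j x)"
    if "j \<in> I" for j
    using that unfolding P_def by blast+
  define Y where "Y = (\<Union>j\<in>I. incl j ` R j)"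
  have "f x = f' x" if f: "f \<in> admissible W" "f' \<in> admissible W" "\<forall>y\<in>Y. f y = f' y" "x \<in> carrier F"
    for f f' x
  proof -
    interpret f: group_hom F W f by (rule admissible_hom[OF W f(1)])
    interpret f': group_hom F W f' by (rule admissible_hom[OF W f(2)])
    show ?thesis using f(4)
    proof (induction x rule: F_induct)
      case one
      show ?case using f.hom_one f'.hom_one by (simp add: one_F)
    next
      case (mult i x w)
      have "f (incl i x) = f' (incl i x)" using R(3)[OF mult(1) f(1,2) _ mult(2)] f(3) mult(1) unfolding Y_def by blast
      then show ?case using mult incl_in_F by simp
    qed
  qed
  moreover have "finite Y" using R(1) fin_I by (simp add: Y_def)
  moreover have "Y \<subseteq> carrier F" using R(2) incl_in_F by (auto simp: Y_def)
  ultimately show ?thesis by (intro exI[of _ Y]) blast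
qed

text \<open>Values on the finite test set determine a restricted homomorphism. The restriction
  matters because elements of \<open>hom\<close> are arbitrary outside the carrier.\<close>

lemma finite_admissible:
  assumes "group W" "finite (carrier W)"
  shows "finite ((\<lambda>f. restrict f (carrier F)) ` admissible W)"
proof -
  obtain Y where Y: "finite Y" "Y \<subseteq> carrier F"
    and test: "\<forall>f f'. f \<in> admissible W \<longrightarrow> f' \<in> admissible W \<longrightarrow>
      (\<forall>y\<in>Y. f y = f' y) \<longrightarrow> (\<forall>x\<in>carrier F. f x = f' x)"
    using finite_test_set[OF assms(1)] by (elim exE conjE)
  have "finite ((\<lambda>f. restrict f Y) ` ((\<lambda>f. restrict f (carrier F)) ` admissible W))"
  proof (rule finite_subset)
    show "(\<lambda>f. restrict f Y) ` ((\<lambda>f. restrict f (carrier F)) ` admissible W) \<subseteq> Y \<rightarrow>\<^sub>E carrier W"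
      using Y(2) by (auto simp: admissible_def hom_def)
    show "finite (Y \<rightarrow>\<^sub>E carrier W)" using Y(1) assms(2) by (rule finite_PiE)
  qed
  moreover have "inj_on (\<lambda>f. restrict f Y) ((\<lambda>f. restrict f (carrier F)) ` admissible W)"
  proof (rule inj_onI, elim imageE)
    fix g g' f f'
    assume eq: "restrict g Y = restrict g' Y" and g: "g = restrict f (carrier F)" "f \<in> admissible W"
      "g' = restrict f' (carrier F)" "f' \<in> admissible W"
    have "f y = f' y" if "y \<in> Y" for y
      using fun_cong[OF eq, of y] that Y(2) g by (auto simp: subset_iff)
    then have "\<forall>x\<in>carrier F. f x = f' x" using test g by blast
    then show "g = g'" using g by auto
  qed
  ultimately show ?thesis by (rule finite_imageD)
qed

section \<open>The invariant subgroup of finite index\<close>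

definition common_kernel :: "('b, 'c) monoid_scheme \<Rightarrow> ('i \<times> 'a) list set"
  where "common_kernel W = {x \<in> carrier F. \<forall>f\<in>admissible W. f x = \<one>\<^bsub>W\<^esub>}"

lemma common_kernel_normal:
  assumes "group W"
  shows "common_kernel W \<lhd> F"
proof (rule F.normal_invI)
  interpret W: group W by fact
  note h = admissible_hom[OF assms]
  show "subgroup (common_kernel W) F"
  proof (rule F.subgroupI)
    show "common_kernel W \<subseteq> carrier F" by (auto simp: common_kernel_def)
    have "\<one>\<^bsub>F\<^esub> \<in> common_kernel W" by (simp add: common_kernel_def group_hom.hom_one[OF h])
    then show "common_kernel W \<noteq> {}" by blast
    show "inv\<^bsub>F\<^esub> a \<in> common_kernel W" if "a \<in> common_kernel W" for a
    proof -
      have a: "a \<in> carrier F" "\<And>f. f \<in> admissible W \<Longrightarrow> f a = \<one>\<^bsub>W\<^esub>" using that by (auto simp: common_kernel_def)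
      have "f (inv\<^bsub>F\<^esub> a) = \<one>\<^bsub>W\<^esub>" if "f \<in> admissible W" for f
        using group_hom.hom_inv[OF h[OF that] a(1)] a(2)[OF that] by simp
      then show ?thesis using a(1) by (simp add: common_kernel_def)
    qed
    show "a \<cdot> b \<in> common_kernel W" if "a \<in> common_kernel W" "b \<in> common_kernel W" for a b
    proof -
      have ab: "a \<in> carrier F" "b \<in> carrier F" using that by (auto simp: common_kernel_def)
      have "f (a \<cdot> b) = \<one>\<^bsub>W\<^esub>" if f: "f \<in> admissible W" for f
      proof -
        have "f a = \<one>\<^bsub>W\<^esub>" "f b = \<one>\<^bsub>W\<^esub>"
          using \<open>a \<in> common_kernel W\<close> \<open>b \<in> common_kernel W\<close> f unfolding common_kernel_def by blast+
        then show ?thesis using group_hom.hom_mult[OF h[OF f] ab] by simp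
      qed
      then show ?thesis using ab by (simp add: common_kernel_def)
    qed
  qed
  fix x k assume x: "x \<in> carrier F" and k: "k \<in> common_kernel W"
  then have kF: "k \<in> carrier F" by (simp add: common_kernel_def)
  have "f (x \<cdot> k \<cdot> inv\<^bsub>F\<^esub> x) = \<one>\<^bsub>W\<^esub>" if f: "f \<in> admissible W" for f
  proof -
    interpret f: group_hom F W f by (rule h[OF f])
    have "f k = \<one>\<^bsub>W\<^esub>" using k f unfolding common_kernel_def by blast
    then show ?thesis using x kF by simp
  qed
  then show "x \<cdot> k \<cdot> inv\<^bsub>F\<^esub> x \<in> common_kernel W" using x kF by (simp add: common_kernel_def)
qed

lemma common_kernel_invariant:
  assumes "group W" and \<phi>: "\<phi> \<in> iso F F"
  shows "\<phi> ` common_kernel W = common_kernel W"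
proof -
  have sub: "\<phi> ` common_kernel W \<subseteq> common_kernel W" if \<phi>: "\<phi> \<in> iso F F" for \<phi>
  proof clarify
    fix x assume x: "x \<in> common_kernel W"
    then have "\<phi> x \<in> carrier F" using \<phi> by (auto simp: common_kernel_def iso_def hom_def)
    moreover have "f (\<phi> x) = \<one>\<^bsub>W\<^esub>" if "f \<in> admissible W" for f
      using admissible_comp[OF assms(1) that \<phi>] x by (auto simp: common_kernel_def)
    ultimately show "\<phi> x \<in> common_kernel W" by (simp add: common_kernel_def)
  qed
  have "common_kernel W \<subseteq> \<phi> ` common_kernel W"
  proof
    fix x assume x: "x \<in> common_kernel W"
    have "inv_into (carrier F) \<phi> x \<in> common_kernel W"
      using sub[OF F.iso_set_sym[OF \<phi>]] x by blast
    moreover have "\<phi> (inv_into (carrier F) \<phi> x) = x"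
      using \<phi> x by (intro f_inv_into_f) (auto simp: common_kernel_def iso_def bij_betw_def)
    ultimately show "x \<in> \<phi> ` common_kernel W" by (metis imageI)
  qed
  then show ?thesis using sub[OF \<phi>] by blast
qed

text \<open>These families label the cosets of the common kernel. The index set consists of
  restricted homomorphisms so that it is finite when \<open>W\<close> is.\<close>

definition joint_values :: "('b, 'c) monoid_scheme \<Rightarrow> ('i \<times> 'a) list \<Rightarrow> (('i \<times> 'a) list \<Rightarrow> 'b) \<Rightarrow> 'b"
  where "joint_values W x = (\<lambda>f\<in>(\<lambda>f. restrict f (carrier F)) ` admissible W. f x)"

lemma finite_joint_values:
  assumes "group W" "finite (carrier W)"
  shows "finite (joint_values W ` carrier F)"
proof (rule finite_subset)
  show "joint_values W ` carrier F \<subseteq> (\<lambda>f. restrict f (carrier F)) ` admissible W \<rightarrow>\<^sub>E carrier W"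
    by (auto simp: joint_values_def admissible_def hom_def)
  show "finite ((\<lambda>f. restrict f (carrier F)) ` admissible W \<rightarrow>\<^sub>E carrier W)"
    by (intro finite_PiE finite_admissible[OF assms] assms(2))
qed

lemma joint_values_eq:
  assumes W: "group W" and x: "x \<in> carrier F" "y \<in> carrier F" "joint_values W x = joint_values W y"
  shows "y \<cdot> inv\<^bsub>F\<^esub> x \<in> common_kernel W"
proof -
  have "f (y \<cdot> inv\<^bsub>F\<^esub> x) = \<one>\<^bsub>W\<^esub>" if f: "f \<in> admissible W" for f
  proof -
    interpret f: group_hom F W f by (rule admissible_hom[OF W f])
    have "f x = f y"
      using fun_cong[OF x(3), of "restrict f (carrier F)"] f x by (simp add: joint_values_def)
    then show ?thesis using x by simp
  qed
  then show ?thesis using x by (simp add: common_kernel_def)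
qed

text \<open>Two of the maps \<open>f \<circ> \<phi> ^^ i\<close> agree on the carrier because there
  are only finitely many; the smaller power of \<phi> is then cancelled by its surjectivity.\<close>

lemma admissible_periodic:
  assumes W: "group W" "finite (carrier W)" and f: "f \<in> admissible W" and \<phi>: "\<phi> \<in> iso F F"
  shows "\<exists>j>0. \<forall>x\<in>carrier F. f ((\<phi> ^^ j) x) = f x"
proof -
  have iso: "\<phi> ^^ i \<in> iso F F" for i by (rule iso_funpow[OF \<phi>])
  let ?g = "\<lambda>i. restrict (f \<circ> \<phi> ^^ i) (carrier F)"
  have "range ?g \<subseteq> (\<lambda>f. restrict f (carrier F)) ` admissible W"
    using admissible_comp[OF W(1) f iso] by blast
  then have "finite (range ?g)" using finite_admissible[OF W] finite_subset by blast
  then have "\<not> inj ?g" using finite_imageD infinite_UNIV_nat by blast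
  then obtain a b where ab: "a \<noteq> b" "?g a = ?g b" unfolding inj_on_def by blast
  define i i' where "i = min a b" and "i' = max a b"
  have "i < i'" using ab(1) by (simp add: i_def i'_def min_def max_def)
  have "?g i = ?g i'" using ab(2) by (cases "a \<le> b") (simp_all only: i_def i'_def min_def max_def if_True if_False)
  have "f ((\<phi> ^^ (i' - i)) x) = f x" if x: "x \<in> carrier F" for x
  proof -
    obtain y where y: "y \<in> carrier F" "x = (\<phi> ^^ i) y"
      using iso[of i] x by (auto simp: iso_def bij_betw_def)
    have "(\<phi> ^^ (i' - i)) x = (\<phi> ^^ i') y"
      using \<open>i < i'\<close> y by (metis comp_apply funpow_add le_add_diff_inverse2 less_imp_le)
    then show ?thesis using fun_cong[OF \<open>?g i = ?g i'\<close>, of y] y by simp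
  qed
  then show ?thesis using \<open>i < i'\<close> by (intro exI[of _ "i' - i"]) simp
qed

end

section \<open>From actions with blocks to infinitely many twisted classes\<close>

context prime_degree
begin

lemma simple_nonabelian_SG: "simple_nonabelian SG"
  unfolding simple_nonabelian_def
proof (intro conjI allI impI)
  show "group SG" by (rule SG.is_group)
  show "N = {\<one>\<^bsub>SG\<^esub>} \<or> N = carrier SG" if "N \<lhd> SG" for N
    using S_simple[OF that] by auto
  show "\<exists>x\<in>carrier SG. \<exists>y\<in>carrier SG. x \<otimes>\<^bsub>SG\<^esub> y \<noteq> y \<otimes>\<^bsub>SG\<^esub> x"
    using rot_S tri_S rot_tri_noncommute by auto
qed

end

context factor_kernels
begin

text \<open>The stabiliser \<open>K0\<close> of \<gamma> acts on the block over \<gamma> through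
  \<open>S\<close>, and \<open>u\<close> and \<open>v\<close> make this action surjective. The
  common kernel is normal in \<open>K0\<close>, so its image in the simple group is trivial or
  everything, and \<open>large\<close> excludes the former.\<close>

lemma block_homomorphism:
  fixes \<Gamma> :: "'g set"
  assumes \<phi>: "\<phi> \<in> iso F F" and \<Gamma>: "finite \<Gamma>" "\<gamma> \<in> \<Gamma>" and f: "f \<in> admissible (perm_group \<Gamma>)"
    and p: "prime p" "p \<ge> 5" and large: "card (joint_values (perm_group \<Gamma>) ` carrier F) < p"
    and g: "g \<in> admissible (perm_group (\<Gamma> \<times> {..<p}))"
    and cocycle: "\<And>x. x \<in> carrier F \<Longrightarrow> \<exists>c\<in>prime_degree.S p. \<forall>y<p. g x (\<gamma>, y) = (f x \<gamma>, c y)"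
    and u: "u \<in> carrier F" "\<And>y. y < p \<Longrightarrow> g u (\<gamma>, y) = (\<gamma>, prime_degree.rot p y)"
    and v: "v \<in> carrier F" "\<And>y. y < p \<Longrightarrow> g v (\<gamma>, y) = (\<gamma>, prime_degree.tri y)"
  shows "\<exists>\<psi>. group_hom (F\<lparr>carrier := common_kernel (perm_group \<Gamma>)\<rparr>) (prime_degree.SG p) \<psi> \<and>
    \<psi> ` common_kernel (perm_group \<Gamma>) = prime_degree.S p \<and>
    (\<exists>j>0. \<forall>x\<in>common_kernel (perm_group \<Gamma>). \<psi> ((\<phi> ^^ j) x) = \<psi> x)"
proof -
  interpret P: prime_degree p using p by unfold_locales
  define K where "K = common_kernel (perm_group \<Gamma>)"
  define K0 where "K0 = {x \<in> carrier F. f x \<gamma> = \<gamma>}"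
  \<comment> \<open>Off the block the value is \<open>y\<close> itself, as for every element of
    \<open>S\<close>.\<close>
  define \<psi> where "\<psi> x y = (if y < p then snd (g x (\<gamma>, y)) else y)" for x y
  interpret f: group_hom F "perm_group \<Gamma>" f by (rule admissible_hom[OF group_perm_group f])
  interpret g: group_hom F "perm_group (\<Gamma> \<times> {..<p})" g by (rule admissible_hom[OF group_perm_group g])
  have p0: "0 < p" using p by simp
  have g_eq: "\<psi> x \<in> P.S \<and> (\<forall>y<p. g x (\<gamma>, y) = (f x \<gamma>, \<psi> x y))" if x: "x \<in> carrier F" for x
  proof -
    obtain c where c: "c \<in> P.S" "\<forall>y<p. g x (\<gamma>, y) = (f x \<gamma>, c y)" using cocycle[OF x] by blast
    have "\<psi> x y = c y" for y
      using c permutes_not_in[OF P.S_permutes[OF c(1)], of y] by (auto simp: \<psi>_def)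
    then have "\<psi> x = c" by blast
    then show ?thesis using c by simp
  qed
  have K0_sub: "subgroup K0 F"
  proof (rule F.subgroupI)
    show "K0 \<subseteq> carrier F" by (auto simp: K0_def)
    have "\<one>\<^bsub>F\<^esub> \<in> K0" using f.hom_one by (simp add: K0_def)
    then show "K0 \<noteq> {}" by blast
    show "inv\<^bsub>F\<^esub> a \<in> K0" if a: "a \<in> K0" for a
    proof -
      have aF: "a \<in> carrier F" using a by (simp add: K0_def)
      have "f (inv\<^bsub>F\<^esub> a) \<circ> f a = id" using f.hom_mult[of "inv\<^bsub>F\<^esub> a" a] f.hom_one aF by simp
      then have "f (inv\<^bsub>F\<^esub> a) (f a \<gamma>) = \<gamma>" by (metis comp_apply id_apply)
      then show ?thesis using a by (simp add: K0_def)
    qed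
    show "a \<cdot> b \<in> K0" if "a \<in> K0" "b \<in> K0" for a b
      using that by (simp add: K0_def f.hom_mult)
  qed
  interpret K0: group "F\<lparr>carrier := K0\<rparr>" by (rule F.subgroup_imp_group[OF K0_sub])
  have \<psi>_mult: "\<psi> (a \<cdot> b) = \<psi> a \<circ> \<psi> b" if ab: "a \<in> K0" "b \<in> K0" for a b
  proof
    fix y
    have abF: "a \<in> carrier F" "b \<in> carrier F" using ab by (auto simp: K0_def)
    show "\<psi> (a \<cdot> b) y = (\<psi> a \<circ> \<psi> b) y"
    proof (cases "y < p")
      case True
      have lt: "\<psi> b y < p" using P.S_lt g_eq[OF abF(2)] True by blast
      have "g (a \<cdot> b) (\<gamma>, y) = g a (g b (\<gamma>, y))" using g.hom_mult[OF abF] by simp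
      also have "g b (\<gamma>, y) = (\<gamma>, \<psi> b y)" using g_eq[OF abF(2)] True ab(2) unfolding K0_def by auto
      also have "g a \<dots> = (\<gamma>, \<psi> a (\<psi> b y))" using g_eq[OF abF(1)] lt ab(1) unfolding K0_def by auto
      finally show ?thesis using True unfolding \<psi>_def[of "a \<cdot> b"] by simp
    next
      case False
      then show ?thesis by (simp add: \<psi>_def)
    qed
  qed
  have \<psi>S: "\<psi> x \<in> P.S" if "x \<in> K0" for x using g_eq that by (simp add: K0_def)
  have "\<psi> \<in> hom (F\<lparr>carrier := K0\<rparr>) (perm_group {..<p})"
    using \<psi>_mult \<psi>S P.S_permutes by (auto simp: hom_def)
  then interpret \<psi>P: group_hom "F\<lparr>carrier := K0\<rparr>" "perm_group {..<p}" \<psi> by unfold_locales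
  have "\<psi> \<in> hom (F\<lparr>carrier := K0\<rparr>) P.SG" using \<psi>_mult \<psi>S by (auto simp: hom_def)
  then interpret \<psi>: group_hom "F\<lparr>carrier := K0\<rparr>" P.SG \<psi> by unfold_locales
  have gen: "x \<in> K0 \<and> \<psi> x = r" if x: "x \<in> carrier F" and r: "r \<in> P.S" "\<And>y. y < p \<Longrightarrow> g x (\<gamma>, y) = (\<gamma>, r y)" for x r
  proof
    show "x \<in> K0" using g_eq[OF x] r(2)[OF p0] p0 x by (auto simp: K0_def)
    show "\<psi> x = r" using r permutes_not_in[OF P.S_permutes[OF r(1)]] by (auto simp: \<psi>_def fun_eq_iff)
  qed
  have "P.rot \<in> \<psi> ` K0" "P.tri \<in> \<psi> ` K0"
    using gen[OF u(1) P.rot_S u(2)] gen[OF v(1) P.tri_S v(2)] by (metis imageI)+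
  then have "P.S \<subseteq> \<psi> ` K0"
    unfolding P.S_def using \<psi>P.img_is_subgroup by (intro P.P.generate_subgroup_incl) auto
  then have \<psi>_sur: "\<psi> ` K0 = P.S" using \<psi>S by blast
  have KF: "K \<lhd> F" unfolding K_def by (rule common_kernel_normal[OF group_perm_group])
  have KK0: "K \<subseteq> K0" using f by (auto simp: K_def common_kernel_def K0_def)
  have K_norm: "K \<lhd> F\<lparr>carrier := K0\<rparr>" by (rule F.normal_restrict_supergroup[OF K0_sub KF KK0])
  have "\<psi> ` K \<lhd> P.SG"
    by (rule normal_image_surj[OF \<psi>.group_hom_axioms _ K_norm]) (use \<psi>_sur in simp)
  \<comment> \<open>If the common kernel acted trivially on the block, \<psi> on \<open>K0\<close>
    would be determined by the joint values. There are fewer than \<open>p\<close> of these, but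
    \<open>S\<close> has at least \<open>p\<close> elements.\<close>
  moreover have "\<psi> ` K \<noteq> {id}"
  proof
    assume triv: "\<psi> ` K = {id}"
    let ?J = "joint_values (perm_group \<Gamma>)"
    have eq: "\<psi> x = \<psi> y" if xy: "x \<in> K0" "y \<in> K0" "?J x = ?J y" for x y
    proof -
      have xF: "x \<in> carrier F" "y \<in> carrier F" using xy by (auto simp: K0_def)
      have k: "y \<cdot> inv\<^bsub>F\<^esub> x \<in> K" unfolding K_def by (rule joint_values_eq[OF group_perm_group xF xy(3)])
      have "\<psi> y = \<psi> ((y \<cdot> inv\<^bsub>F\<^esub> x) \<cdot> x)" using xF by (simp add: F.m_assoc)
      also have "\<dots> = \<psi> (y \<cdot> inv\<^bsub>F\<^esub> x) \<circ> \<psi> x" using k KK0 xy by (intro \<psi>_mult) auto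
      also have "\<psi> (y \<cdot> inv\<^bsub>F\<^esub> x) = id" using triv k by blast
      finally show ?thesis by simp
    qed
    have fin: "finite (?J ` carrier F)"
      using \<Gamma> by (intro finite_joint_values group_perm_group finite_perm_group)
    have JK: "?J ` K0 \<subseteq> ?J ` carrier F" by (auto simp: K0_def)
    have "\<psi> ` K0 = (\<psi> \<circ> inv_into K0 ?J) ` ?J ` K0"
    proof -
      have "\<psi> x = (\<psi> \<circ> inv_into K0 ?J) (?J x)" if "x \<in> K0" for x
        unfolding comp_def using that by (intro eq) (auto intro: inv_into_into simp: f_inv_into_f)
      then show ?thesis unfolding image_image by (rule image_cong[OF refl])
    qed
    then have "card P.S \<le> card (?J ` K0)"
      using card_image_le[of "?J ` K0"] finite_subset[OF JK fin] \<psi>_sur by metis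
    also have "\<dots> \<le> card (?J ` carrier F)" by (rule card_mono[OF fin JK])
    finally show False using large P.card_S_ge by simp
  qed
  ultimately have K_sur: "\<psi> ` K = P.S" by (rule P.S_simple)
  have K_sub: "subgroup K F" by (rule normal_imp_subgroup[OF KF])
  have "\<psi> \<in> hom (F\<lparr>carrier := K\<rparr>) P.SG" using \<psi>_mult \<psi>S KK0 by (auto simp: hom_def subset_iff)
  then have "group_hom (F\<lparr>carrier := K\<rparr>) P.SG \<psi>"
    using F.subgroup_imp_group[OF K_sub] P.SG.is_group by (simp add: group_hom_def group_hom_axioms_def)
  moreover obtain j where "j > 0" "\<forall>x\<in>carrier F. g ((\<phi> ^^ j) x) = g x"
    using admissible_periodic[OF group_perm_group _ g \<phi>] \<Gamma> finite_perm_group[of "\<Gamma> \<times> {..<p}"] by auto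
  then have "\<exists>j>0. \<forall>x\<in>K. \<psi> ((\<phi> ^^ j) x) = \<psi> x"
    using subgroup.subset[OF K_sub] by (intro exI[of _ j]) (auto simp: \<psi>_def fun_eq_iff)
  ultimately show ?thesis using K_sur unfolding K_def by blast
qed

text \<open>All primes share the same \<open>f\<close> on the same \<Gamma>, hence the same common
  kernel. So every prime above a fixed bound yields a simple quotient of this one subgroup.\<close>

theorem reidemeister_infinite_of_blocks:
  fixes \<Gamma> :: "'g set"
  assumes \<phi>: "\<phi> \<in> iso F F" and \<Gamma>: "finite \<Gamma>" "\<gamma> \<in> \<Gamma>" and f: "f \<in> admissible (perm_group \<Gamma>)"
    and blocks: "\<And>p. \<lbrakk>prime p; p \<ge> 5\<rbrakk> \<Longrightarrow> \<exists>g\<in>admissible (perm_group (\<Gamma> \<times> {..<p})).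
      (\<forall>x\<in>carrier F. \<exists>c\<in>prime_degree.S p. \<forall>y<p. g x (\<gamma>, y) = (f x \<gamma>, c y)) \<and>
      (\<exists>u\<in>carrier F. \<forall>y<p. g u (\<gamma>, y) = (\<gamma>, prime_degree.rot p y)) \<and>
      (\<exists>v\<in>carrier F. \<forall>y<p. g v (\<gamma>, y) = (\<gamma>, prime_degree.tri y))"
  shows "reidemeister_number F \<phi> = \<infinity>"
proof -
  define K where "K = common_kernel (perm_group \<Gamma>)"
  define N where "N = card (joint_values (perm_group \<Gamma>) ` carrier F)"
  have fin: "finite (joint_values (perm_group \<Gamma>) ` carrier F)"
    using \<Gamma> by (intro finite_joint_values group_perm_group finite_perm_group)
  have next_prime: "\<exists>q. (prime q \<and> 5 \<le> q \<and> N < q) \<and> m < q" for m :: nat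
  proof -
    obtain q where "prime q" "max m (max 5 N) < q" using bigger_prime by blast
    then show ?thesis by (intro exI[of _ q]) simp
  qed
  \<comment> \<open>The group of degree \<open>P (Suc n)\<close> has at least
    \<open>P (Suc n)\<close> elements, so this growth makes the orders strictly increasing.\<close>
  have "\<exists>P :: nat \<Rightarrow> nat. \<forall>n. (prime (P n) \<and> 5 \<le> P n \<and> N < P n) \<and> card (prime_degree.S (P n)) < P (Suc n)"
    by (rule dependent_nat_choice) (use next_prime in blast)+
  then obtain P :: "nat \<Rightarrow> nat" where P: "\<And>n. prime (P n)" "\<And>n. 5 \<le> P n" "\<And>n. N < P n"
    "\<And>n. card (prime_degree.S (P n)) < P (Suc n)" by blast
  have pd: "prime_degree (P n)" for n using P by unfold_locales
  have "\<exists>\<psi>. group_hom (F\<lparr>carrier := K\<rparr>) (prime_degree.SG (P n)) \<psi> \<and> \<psi> ` K = prime_degree.S (P n) \<and>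
    (\<exists>j>0. \<forall>x\<in>K. \<psi> ((\<phi> ^^ j) x) = \<psi> x)" for n
  proof -
    obtain g u v where g: "g \<in> admissible (perm_group (\<Gamma> \<times> {..<P n}))"
      "\<And>x. x \<in> carrier F \<Longrightarrow> \<exists>c\<in>prime_degree.S (P n). \<forall>y<P n. g x (\<gamma>, y) = (f x \<gamma>, c y)"
      "u \<in> carrier F" "\<And>y. y < P n \<Longrightarrow> g u (\<gamma>, y) = (\<gamma>, prime_degree.rot (P n) y)"
      "v \<in> carrier F" "\<And>y. y < P n \<Longrightarrow> g v (\<gamma>, y) = (\<gamma>, prime_degree.tri y)"
      using blocks[OF P(1,2), of n] by blast
    show ?thesis
      unfolding K_def
      by (rule block_homomorphism[OF \<phi> \<Gamma> f P(1,2) P(3)[unfolded N_def] g])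
  qed
  then obtain \<psi> where \<psi>: "\<And>n. group_hom (F\<lparr>carrier := K\<rparr>) (prime_degree.SG (P n)) (\<psi> n)"
    "\<And>n. \<psi> n ` K = prime_degree.S (P n)" "\<And>n. \<exists>j>0. \<forall>x\<in>K. \<psi> n ((\<phi> ^^ j) x) = \<psi> n x" by metis
  have K_sub: "subgroup K F" unfolding K_def by (rule normal_imp_subgroup[OF common_kernel_normal[OF group_perm_group]])
  have K_inv: "\<phi> ` K = K" unfolding K_def by (rule common_kernel_invariant[OF group_perm_group \<phi>])
  have KF: "K \<subseteq> carrier F" by (rule subgroup.subset[OF K_sub])
  have \<phi>K: "\<phi> \<in> iso (F\<lparr>carrier := K\<rparr>) (F\<lparr>carrier := K\<rparr>)"
    using \<phi> K_inv KF by (auto simp: iso_def hom_def bij_betw_def subset_iff intro: inj_on_subset)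
  have mono: "card (carrier (prime_degree.SG (P m))) < card (carrier (prime_degree.SG (P n)))" if "m < n" for m n
    using that
  proof (rule lift_Suc_mono_less[where f = "\<lambda>n. card (carrier (prime_degree.SG (P n)))", rotated])
    show "card (carrier (prime_degree.SG (P n))) < card (carrier (prime_degree.SG (P (Suc n))))" for n
      using P(4)[of n] prime_degree.card_S_ge[OF pd, of "Suc n"] by (simp add: prime_degree.SG_simps(1)[OF pd])
  qed
  have "\<exists>Y\<subseteq>carrier (F\<lparr>carrier := K\<rparr>). infinite Y \<and> (\<forall>y\<in>Y. \<forall>y'\<in>Y. y \<noteq> y' \<longrightarrow>
    \<not> (\<exists>g\<in>carrier (F\<lparr>carrier := K\<rparr>). y' = g \<otimes>\<^bsub>F\<lparr>carrier := K\<rparr>\<^esub> y \<otimes>\<^bsub>F\<lparr>carrier := K\<rparr>\<^esub> inv\<^bsub>F\<lparr>carrier := K\<rparr>\<^esub> (\<phi> g)))"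
    by (rule infinite_set_of_distinct_twisted_classes[where S = "\<lambda>n. prime_degree.SG (P n)" and \<psi> = \<psi>, OF \<phi>K])
      (simp_all add: \<psi> mono[unfolded prime_degree.SG_simps(1)[OF pd]] prime_degree.simple_nonabelian_SG[OF pd] prime_degree.finite_S[OF pd]
        prime_degree.twisted_one_class_not_everything[OF pd, unfolded prime_degree.SG_simps(1)[OF pd]]
        prime_degree.SG_simps(1)[OF pd] del: prime_degree.SG_simps(2,3))
  then obtain Y where Y: "Y \<subseteq> K" "infinite Y"
    "\<forall>y\<in>Y. \<forall>y'\<in>Y. y \<noteq> y' \<longrightarrow>
      \<not> (\<exists>g\<in>K. y' = g \<cdot> y \<cdot> inv\<^bsub>F\<lparr>carrier := K\<rparr>\<^esub> (\<phi> g))"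
    by auto
  have inv: "inv\<^bsub>F\<lparr>carrier := K\<rparr>\<^esub> (\<phi> g) = inv\<^bsub>F\<^esub> (\<phi> g)" if "g \<in> K" for g
    using F.m_inv_consistent[OF K_sub] K_inv that by blast
  show ?thesis
  proof (rule reidemeister_number_infinite[OF F.is_group \<phi> fin])
    show "g' \<cdot> inv\<^bsub>F\<^esub> g \<in> K" if "g \<in> carrier F" "g' \<in> carrier F"
      "joint_values (perm_group \<Gamma>) g = joint_values (perm_group \<Gamma>) g'" for g g'
      unfolding K_def by (rule joint_values_eq[OF group_perm_group that])
    show "Y \<subseteq> carrier F" "infinite Y" using Y KF by auto
    show "\<not> (\<exists>k\<in>K. y' = k \<cdot> y \<cdot> inv\<^bsub>F\<^esub> (\<phi> k))" if "y \<in> Y" "y' \<in> Y" "y \<noteq> y'" for y y'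
      using Y(3) that inv by auto
  qed
qed

end

section \<open>Actions of free products with large blocks\<close>

lemma permutes_of_inverse:
  assumes "\<And>x. f (g x) = x" "\<And>x. g (f x) = x" "\<And>x. x \<notin> A \<Longrightarrow> f x = x"
  shows "f permutes A"
  unfolding permutes_def using assms by metis

definition left_translation :: "('a, 'b) monoid_scheme \<Rightarrow> 'a \<Rightarrow> 'a \<Rightarrow> 'a"
  where "left_translation D d x = (if x \<in> carrier D then d \<otimes>\<^bsub>D\<^esub> x else x)"

lemma left_translation_hom:
  assumes "group D"
  shows "left_translation D \<in> hom D (perm_group (carrier D))"
proof (rule homI)
  interpret group D by fact
  fix d assume d: "d \<in> carrier D"
  have "left_translation D d permutes carrier D"
    by (rule permutes_of_inverse[where g = "left_translation D (inv\<^bsub>D\<^esub> d)"])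
      (use d in \<open>auto simp: left_translation_def inv_mult_cancel\<close>)
  then show "left_translation D d \<in> carrier (perm_group (carrier D))" by simp
  fix e assume e: "e \<in> carrier D"
  show "left_translation D (d \<otimes>\<^bsub>D\<^esub> e)
      = left_translation D d \<otimes>\<^bsub>perm_group (carrier D)\<^esub> left_translation D e"
    using d e by (auto simp: left_translation_def fun_eq_iff m_assoc)
qed

context factor_kernels
begin

lemma admissible_extension:
  assumes W: "group W" and h: "\<And>j. j \<in> I \<Longrightarrow> h j \<in> hom (G j) W"
    and kill: "\<And>j x. \<lbrakk>j \<in> I; \<not> infinite_cyclic (G j); x \<in> L j\<rbrakk> \<Longrightarrow> h j x = \<one>\<^bsub>W\<^esub>"
  shows "\<exists>f\<in>admissible W. \<forall>j\<in>I. \<forall>x\<in>carrier (G j). f (incl j x) = h j x"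
proof -
  obtain f where f: "f \<in> hom F W" "\<forall>j\<in>I. \<forall>x\<in>carrier (G j). f (incl j x) = h j x"
    using free_product_universal(1)[of I G W h, OF groups W h] unfolding F_def incl_def by blast
  then have "f \<in> admissible W" using kill L_subset unfolding admissible_def by (simp add: subset_iff)
  then show ?thesis using f(2) by blast
qed

text \<open>
  The action of \<open>F\<close> on \<open>\<Gamma>\<close> is lifted to \<open>\<Gamma> \<times> {..<p}\<close> by conjugating the trivial lift on the
  factor \<open>G j\<close> by \<open>s j\<close>; only the comparison between different factors is not a coboundary.
\<close>

lemma block_action:
  fixes \<Gamma> :: "'g set"
  assumes p: "prime p" "p \<ge> 5" and f: "f \<in> admissible (perm_group \<Gamma>)"
    and s: "\<And>j \<gamma>. s j \<gamma> \<in> prime_degree.S p"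
  shows "\<exists>g\<in>admissible (perm_group (\<Gamma> \<times> {..<p})).
    (\<forall>x\<in>carrier F. \<forall>\<gamma>\<in>\<Gamma>. \<exists>c\<in>prime_degree.S p. \<forall>y<p. g x (\<gamma>, y) = (f x \<gamma>, c y)) \<and>
    (\<forall>j\<in>I. \<forall>x\<in>carrier (G j). \<forall>\<gamma>\<in>\<Gamma>. \<forall>y<p. g (incl j x) (\<gamma>, y) =
      (f (incl j x) \<gamma>, s j (f (incl j x) \<gamma>) (inv_into UNIV (s j \<gamma>) y)))"
proof -
  interpret P: prime_degree p using p by unfold_locales
  interpret f: group_hom F "perm_group \<Gamma>" f by (rule admissible_hom[OF group_perm_group f])
  have s_inv: "inv_into UNIV (s j \<gamma>) (s j \<gamma> y) = y" "s j \<gamma> (inv_into UNIV (s j \<gamma>) y) = y" for j \<gamma> y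
    using permutes_inverses[OF P.S_permutes[OF s[of j \<gamma>]]] by auto
  have inv_S: "inv_into UNIV (s j \<gamma>) \<in> P.S" for j \<gamma>
    using P.SG.inv_closed[of "s j \<gamma>"] s[of j \<gamma>] by (simp add: P.inv_SG)
  have lt: "s j \<gamma> y < p \<longleftrightarrow> y < p" "inv_into UNIV (s j \<gamma>) y < p \<longleftrightarrow> y < p" for j \<gamma> y
    using P.S_lt s inv_S by blast+
  define h where "h j x = (\<lambda>(\<gamma>, y). if \<gamma> \<in> \<Gamma> \<and> y < p
    then (f (incl j x) \<gamma>, s j (f (incl j x) \<gamma>) (inv_into UNIV (s j \<gamma>) y)) else (\<gamma>, y))" for j x
  have f_perm: "f z \<gamma> \<in> \<Gamma> \<longleftrightarrow> \<gamma> \<in> \<Gamma>" if "z \<in> carrier F" for z \<gamma>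
    using f.hom_closed[OF that] permutes_in_image by fastforce
  have h_comp: "h j x (h j y z) = h j (x \<otimes>\<^bsub>G j\<^esub> y) z" if j: "j \<in> I" and xy: "x \<in> carrier (G j)" "y \<in> carrier (G j)" for j x y z
  proof -
    interpret e: group_hom "G j" F "incl j" by (rule incl_hom[OF j])
    have "f (incl j (x \<otimes>\<^bsub>G j\<^esub> y)) = f (incl j x) \<circ> f (incl j y)" using xy by simp
    then show ?thesis using f_perm xy by (cases z) (simp add: h_def lt s_inv)
  qed
  have h_one: "h j \<one>\<^bsub>G j\<^esub> z = z" if j: "j \<in> I" for j z
  proof -
    interpret e: group_hom "G j" F "incl j" by (rule incl_hom[OF j])
    have "f (incl j \<one>\<^bsub>G j\<^esub>) = id" using f.hom_one by simp
    then show ?thesis by (cases z) (simp add: h_def s_inv)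
  qed
  have "h j \<in> hom (G j) (perm_group (\<Gamma> \<times> {..<p}))" if j: "j \<in> I" for j
  proof (rule homI)
    interpret group "G j" by (rule groups[OF j])
    fix x assume x: "x \<in> carrier (G j)"
    have "h j x permutes \<Gamma> \<times> {..<p}"
    proof (rule permutes_of_inverse[where g = "h j (inv\<^bsub>G j\<^esub> x)"])
      show "h j x z = z" if "z \<notin> \<Gamma> \<times> {..<p}" for z using that by (cases z) (auto simp: h_def)
    qed (use x j in \<open>simp_all add: h_comp h_one\<close>)
    then show "h j x \<in> carrier (perm_group (\<Gamma> \<times> {..<p}))" by simp
    fix y assume y: "y \<in> carrier (G j)"
    show "h j (x \<otimes>\<^bsub>G j\<^esub> y) = h j x \<otimes>\<^bsub>perm_group (\<Gamma> \<times> {..<p})\<^esub> h j y"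
      using h_comp[OF j x y] by (simp add: fun_eq_iff)
  qed
  moreover have "h j x = \<one>\<^bsub>perm_group (\<Gamma> \<times> {..<p})\<^esub>" if "j \<in> I" "\<not> infinite_cyclic (G j)" "x \<in> L j" for j x
  proof -
    have "f (incl j x) = id" using f that by (auto simp: admissible_def)
    then show ?thesis by (auto simp: h_def fun_eq_iff s_inv)
  qed
  ultimately obtain g where g: "g \<in> admissible (perm_group (\<Gamma> \<times> {..<p}))"
    "\<And>j x. \<lbrakk>j \<in> I; x \<in> carrier (G j)\<rbrakk> \<Longrightarrow> g (incl j x) = h j x"
    using admissible_extension[OF group_perm_group, of h "\<Gamma> \<times> {..<p}"] by blast
  interpret g: group_hom F "perm_group (\<Gamma> \<times> {..<p})" g by (rule admissible_hom[OF group_perm_group g(1)])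
  have "\<forall>\<gamma>\<in>\<Gamma>. \<exists>c\<in>P.S. \<forall>y<p. g x (\<gamma>, y) = (f x \<gamma>, c y)" if "x \<in> carrier F" for x
    using that
  proof (induction x rule: F_induct)
    case one
    have "g [] = id" "f [] = id" using g.hom_one f.hom_one by (simp_all add: one_F)
    moreover have "id \<in> P.S" using P.SG.one_closed by simp
    ultimately show ?case by (auto intro!: bexI[of _ id])
  next
    case (mult j x w)
    show ?case
    proof
      fix \<gamma> assume \<gamma>: "\<gamma> \<in> \<Gamma>"
      obtain c where c: "c \<in> P.S" "\<forall>y<p. g w (\<gamma>, y) = (f w \<gamma>, c y)" using mult(4) \<gamma> by blast
      define d where "d = s j (f (incl j x) (f w \<gamma>)) \<circ> inv_into UNIV (s j (f w \<gamma>))"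
      have d: "d \<in> P.S" unfolding d_def by (rule P.S_comp[OF s inv_S])
      have ix: "incl j x \<in> carrier F" using incl_in_F mult by blast
      have "g (incl j x \<cdot> w) (\<gamma>, y) = (f (incl j x \<cdot> w) \<gamma>, (d \<circ> c) y)" if "y < p" for y
      proof -
        have "c y < p" using P.S_lt[OF c(1)] that by simp
        moreover have "f w \<gamma> \<in> \<Gamma>" using f_perm mult \<gamma> by blast
        ultimately show ?thesis
          using c that g(2)[OF mult(1,2)] ix mult(3) by (simp add: h_def d_def)
      qed
      then show "\<exists>c\<in>P.S. \<forall>y<p. g (incl j x \<cdot> w) (\<gamma>, y) = (f (incl j x \<cdot> w) \<gamma>, c y)"
        using P.S_comp[OF d c(1)] by blast
    qed
  qed
  moreover have "g (incl j x) (\<gamma>, y) = (f (incl j x) \<gamma>, s j (f (incl j x) \<gamma>) (inv_into UNIV (s j \<gamma>) y))"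
    if "j \<in> I" "x \<in> carrier (G j)" "\<gamma> \<in> \<Gamma>" "y < p" for j x \<gamma> y
    using g(2)[OF that(1,2)] that by (simp add: h_def)
  ultimately show ?thesis using g(1) by blast
qed

text \<open>The product of the two finite quotients acts on itself by translation. The hypotheses on
  \<open>x\<close> and \<open>x'\<close> give three different cosets of \<open>A\<close>, so the
  commutator loops of \<open>x\<close> and of \<open>x'\<close> with \<open>z\<close> pass through
  two different points, where \<open>rot\<close> and \<open>tri\<close> can be placed
  independently.\<close>

theorem reidemeister_infinite_of_large_quotient:
  assumes \<phi>: "\<phi> \<in> iso F F" and ab: "a \<in> I" "b \<in> I" "a \<noteq> b"
    and A: "A \<lhd> G a" "finite (rcosets\<^bsub>G a\<^esub> A)" "\<not> infinite_cyclic (G a) \<Longrightarrow> L a \<subseteq> A"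
    and B: "B \<lhd> G b" "finite (rcosets\<^bsub>G b\<^esub> B)" "\<not> infinite_cyclic (G b) \<Longrightarrow> L b \<subseteq> B"
    and x: "x \<in> carrier (G a)" "x \<notin> A" and x': "x' \<in> carrier (G a)" "x' \<notin> A" "x \<otimes>\<^bsub>G a\<^esub> inv\<^bsub>G a\<^esub> x' \<notin> A"
    and z: "z \<in> carrier (G b)" "z \<notin> B"
  shows "reidemeister_number F \<phi> = \<infinity>"
proof -
  interpret A: normal A "G a" by (rule A(1))
  interpret B: normal B "G b" by (rule B(1))
  define D where "D = (G a Mod A) \<times>\<times> (G b Mod B)"
  interpret D: group D unfolding D_def by (rule DirProd_group[OF A.factorgroup_is_group B.factorgroup_is_group])
  define k where "k j = (if j = a then \<lambda>g. (A #>\<^bsub>G a\<^esub> g, \<one>\<^bsub>G b Mod B\<^esub>)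
    else if j = b then \<lambda>g. (\<one>\<^bsub>G a Mod A\<^esub>, B #>\<^bsub>G b\<^esub> g) else (\<lambda>g. \<one>\<^bsub>D\<^esub>))" for j
  interpret QA: group "G a Mod A" by (rule A.factorgroup_is_group)
  interpret QB: group "G b Mod B" by (rule B.factorgroup_is_group)
  have k_hom: "k j \<in> hom (G j) D" if "j \<in> I" for j
    using A.r_coset_hom_Mod B.r_coset_hom_Mod QA.one_closed QB.one_closed QA.l_one QB.l_one D.one_closed D.l_one
    by (auto simp: k_def hom_def D_def DirProd_def)
  have fin: "finite (carrier D)"
    using A(2) B(2) by (simp add: D_def DirProd_def FactGroup_def)
  have h_hom: "left_translation D \<circ> k j \<in> hom (G j) (perm_group (carrier D))" if "j \<in> I" for j
    by (rule hom_compose[OF k_hom[OF that] left_translation_hom[OF D.is_group]])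
  have k_kill: "k j g = \<one>\<^bsub>D\<^esub>" if "j \<in> I" "\<not> infinite_cyclic (G j)" "g \<in> L j" for j g
    using that A(3) B(3) A.rcos_const[of g] B.rcos_const[of g] ab
    by (auto simp: k_def D_def DirProd_def FactGroup_def subset_iff)
  have "left_translation D \<one>\<^bsub>D\<^esub> = id" by (auto simp: left_translation_def fun_eq_iff)
  then obtain f where f: "f \<in> admissible (perm_group (carrier D))"
    and f_incl: "\<And>j g. \<lbrakk>j \<in> I; g \<in> carrier (G j)\<rbrakk> \<Longrightarrow> f (incl j g) = left_translation D (k j g)"
    using admissible_extension[OF group_perm_group h_hom] k_kill by auto
  define \<alpha> where "\<alpha> = A #>\<^bsub>G a\<^esub> x"
  define \<alpha>' where "\<alpha>' = A #>\<^bsub>G a\<^esub> x'"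
  define \<beta> where "\<beta> = B #>\<^bsub>G b\<^esub> z"
  have selfA: "t \<in> A #>\<^bsub>G a\<^esub> t" if "t \<in> carrier (G a)" for t
    by (rule A.rcos_self[OF that A.subgroup_axioms])
  have selfB: "t \<in> B #>\<^bsub>G b\<^esub> t" if "t \<in> carrier (G b)" for t
    by (rule B.rcos_self[OF that B.subgroup_axioms])
  have coset_neq: "A #>\<^bsub>G a\<^esub> t \<noteq> A" if "t \<in> carrier (G a)" "t \<notin> A" for t
    using that selfA[of t] by blast
  have ne: "\<alpha> \<noteq> A" "\<alpha>' \<noteq> A" "\<beta> \<noteq> B" "\<alpha> \<noteq> \<alpha>'"
  proof -
    show "\<alpha> \<noteq> A" "\<alpha>' \<noteq> A" using coset_neq x x' by (auto simp: \<alpha>_def \<alpha>'_def)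
    show "\<beta> \<noteq> B" using z selfB[of z] by (auto simp: \<beta>_def)
    show "\<alpha> \<noteq> \<alpha>'"
    proof
      assume "\<alpha> = \<alpha>'"
      then have "x \<in> A #>\<^bsub>G a\<^esub> x'" using selfA[OF x(1)] by (simp add: \<alpha>_def \<alpha>'_def)
      then obtain l where "l \<in> A" "x = l \<otimes>\<^bsub>G a\<^esub> x'" by (auto simp: r_coset_def)
      then have "x \<otimes>\<^bsub>G a\<^esub> inv\<^bsub>G a\<^esub> x' = l" using x' by (simp add: A.m_assoc)
      then show False using x' \<open>l \<in> A\<close> by simp
    qed
  qed
  show ?thesis
  proof (rule reidemeister_infinite_of_blocks[OF \<phi> fin D.one_closed f])
    fix p :: nat assume p: "prime p" "p \<ge> 5"
    interpret P: prime_degree p using p by unfold_locales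
    \<comment> \<open>Blocks are twisted only along the factor \<open>b\<close>, and only on
      arriving at or leaving one of the two points \<open>(\<alpha>, \<beta>)\<close> and
      \<open>(\<alpha>', \<beta>)\<close>.\<close>
    define s where "s j \<gamma> = (if j = b \<and> \<gamma> = (\<alpha>, \<beta>) then P.rot else if j = b \<and> \<gamma> = (\<alpha>', \<beta>) then P.tri else id)" for j \<gamma>
    have id_S: "id \<in> P.S" using P.SG.one_closed by simp
    then have s_S: "s j \<gamma> \<in> P.S" for j \<gamma> using P.rot_S P.tri_S by (simp add: s_def)
    obtain g where g: "g \<in> admissible (perm_group (carrier D \<times> {..<p}))"
      and g_blocks: "\<forall>x\<in>carrier F. \<forall>\<gamma>\<in>carrier D. \<exists>c\<in>P.S. \<forall>y<p. g x (\<gamma>, y) = (f x \<gamma>, c y)"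
      and g_incl: "\<forall>j\<in>I. \<forall>x\<in>carrier (G j). \<forall>\<gamma>\<in>carrier D. \<forall>y<p. g (incl j x) (\<gamma>, y) =
        (f (incl j x) \<gamma>, s j (f (incl j x) \<gamma>) (inv_into UNIV (s j \<gamma>) y))"
      using block_action[OF p f, of s] s_S by blast
    interpret g: group_hom F "perm_group (carrier D \<times> {..<p})" g by (rule admissible_hom[OF group_perm_group g])
    have one: "\<one>\<^bsub>D\<^esub> = (A, B)" by (simp add: D_def DirProd_def FactGroup_def)
    have holonomy: "\<exists>u\<in>carrier F. \<forall>y<p. g u (\<one>\<^bsub>D\<^esub>, y) = (\<one>\<^bsub>D\<^esub>, s b (A #>\<^bsub>G a\<^esub> t, \<beta>) y)"
      if t: "t \<in> carrier (G a)" "t \<notin> A" for t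
    proof -
      \<comment> \<open>Read from the right, this word walks around the square with corners
        \<open>(A, B)\<close>, \<open>(\<tau>, B)\<close>, \<open>(\<tau>, \<beta>)\<close> and
        \<open>(A, \<beta>)\<close>. It arrives at the third of these along \<open>b\<close>, which
        twists the block, and leaves it along \<open>a\<close>, which does not, so the twist is left
        over.\<close>
      let ?u = "incl b (inv\<^bsub>G b\<^esub> z) \<cdot> (incl a (inv\<^bsub>G a\<^esub> t) \<cdot> (incl b z \<cdot> incl a t))"
      define \<tau> where "\<tau> = A #>\<^bsub>G a\<^esub> t"
      have \<tau>: "\<tau> \<noteq> A" using coset_neq t by (simp add: \<tau>_def)
      have inc: "incl a t \<in> carrier F" "incl a (inv\<^bsub>G a\<^esub> t) \<in> carrier F" "incl b z \<in> carrier F" "incl b (inv\<^bsub>G b\<^esub> z) \<in> carrier F"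
        using incl_in_F ab t z by auto
      have mem: "A \<in> carrier (G a Mod A)" "B \<in> carrier (G b Mod B)" "\<tau> \<in> carrier (G a Mod A)" "\<beta> \<in> carrier (G b Mod B)"
        using QA.one_closed QB.one_closed t z
        by (auto simp: FactGroup_def \<tau>_def \<beta>_def RCOSETS_def)
      have inD: "(C, E) \<in> carrier D \<longleftrightarrow> C \<in> carrier (G a Mod A) \<and> E \<in> carrier (G b Mod B)" for C E
        by (simp add: D_def DirProd_def)
      have oneA: "\<one>\<^bsub>G a Mod A\<^esub> = A" "\<one>\<^bsub>G b Mod B\<^esub> = B" by (simp_all add: FactGroup_def)
      have ra: "A #>\<^bsub>G a\<^esub> g \<in> carrier (G a Mod A)" if "g \<in> carrier (G a)" for g
        using that by (auto simp: FactGroup_def RCOSETS_def)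
      have rb: "B #>\<^bsub>G b\<^esub> g \<in> carrier (G b Mod B)" if "g \<in> carrier (G b)" for g
        using that by (auto simp: FactGroup_def RCOSETS_def)
      have fa: "f (incl a g) (C, E) = ((A #>\<^bsub>G a\<^esub> g) \<otimes>\<^bsub>G a Mod A\<^esub> C, E)" if "g \<in> carrier (G a)" "(C, E) \<in> carrier D" for g C E
        using that f_incl[OF ab(1) that(1)] QB.l_one[of E] inD[of C E] by (simp add: left_translation_def k_def) (simp add: D_def DirProd_def)
      have fb: "f (incl b g) (C, E) = (C, (B #>\<^bsub>G b\<^esub> g) \<otimes>\<^bsub>G b Mod B\<^esub> E)" if "g \<in> carrier (G b)" "(C, E) \<in> carrier D" for g C E
        using that f_incl[OF ab(2) that(1)] QA.l_one[of C] inD[of C E] ab(3) by (simp add: left_translation_def k_def) (simp add: D_def DirProd_def)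
      have inva: "(A #>\<^bsub>G a\<^esub> inv\<^bsub>G a\<^esub> t) \<otimes>\<^bsub>G a Mod A\<^esub> \<tau> = A"
        using A.rcos_sum[of "inv\<^bsub>G a\<^esub> t" t] t A.coset_mult_one A.subset by (simp add: FactGroup_def \<tau>_def)
      have invb: "(B #>\<^bsub>G b\<^esub> inv\<^bsub>G b\<^esub> z) \<otimes>\<^bsub>G b Mod B\<^esub> \<beta> = B"
        using B.rcos_sum[of "inv\<^bsub>G b\<^esub> z" z] z B.coset_mult_one B.subset by (simp add: FactGroup_def \<beta>_def)
      have s1: "f (incl a t) (A, B) = (\<tau>, B)"
        using fa[OF t(1), of A B] mem inD QA.r_one[OF ra[OF t(1)]] by (simp add: oneA \<tau>_def)
      have s2: "f (incl b z) (\<tau>, B) = (\<tau>, \<beta>)"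
        using fb[OF z(1), of \<tau> B] mem inD QB.r_one[OF rb[OF z(1)]] by (simp add: oneA \<beta>_def)
      have s3: "f (incl a (inv\<^bsub>G a\<^esub> t)) (\<tau>, \<beta>) = (A, \<beta>)"
        using fa[of "inv\<^bsub>G a\<^esub> t" \<tau> \<beta>] mem inD t inva by simp
      have s4: "f (incl b (inv\<^bsub>G b\<^esub> z)) (A, \<beta>) = (A, B)"
        using fb[of "inv\<^bsub>G b\<^esub> z" A \<beta>] mem inD z invb by simp
      have sv: "s a \<gamma> = id" "s b (A, E) = id" "s b (C, B) = id" for \<gamma> C E
        using ab(3) ne by (auto simp: s_def)
      have "g ?u (\<one>\<^bsub>D\<^esub>, y) = (\<one>\<^bsub>D\<^esub>, s b (\<tau>, \<beta>) y)" if y: "y < p" for y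
      proof -
        have y': "s b (\<tau>, \<beta>) y < p" using P.S_lt[OF s_S] y by blast
        have "g (incl a t) ((A, B), y) = ((\<tau>, B), y)"
          using g_incl ab(1) t(1) y mem inD s1 by (simp add: sv)
        moreover have "g (incl b z) ((\<tau>, B), y) = ((\<tau>, \<beta>), s b (\<tau>, \<beta>) y)"
          using g_incl ab(2) z(1) y mem inD s2 by (simp add: sv)
        moreover have "g (incl a (inv\<^bsub>G a\<^esub> t)) ((\<tau>, \<beta>), s b (\<tau>, \<beta>) y) = ((A, \<beta>), s b (\<tau>, \<beta>) y)"
          using g_incl ab(1) t(1) y' mem inD s3 by (simp add: sv)
        moreover have "g (incl b (inv\<^bsub>G b\<^esub> z)) ((A, \<beta>), s b (\<tau>, \<beta>) y) = ((A, B), s b (\<tau>, \<beta>) y)"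
          using g_incl ab(2) z(1) y' mem inD s4 by (simp add: sv)
        ultimately show ?thesis using inc by (simp add: one)
      qed
      moreover have "?u \<in> carrier F" using inc by simp
      ultimately show ?thesis unfolding \<tau>_def by blast
    qed
    have "s b (\<alpha>, \<beta>) = P.rot" "s b (\<alpha>', \<beta>) = P.tri" using ne by (auto simp: s_def)
    then have "\<exists>u\<in>carrier F. \<forall>y<p. g u (\<one>\<^bsub>D\<^esub>, y) = (\<one>\<^bsub>D\<^esub>, P.rot y)"
      "\<exists>v\<in>carrier F. \<forall>y<p. g v (\<one>\<^bsub>D\<^esub>, y) = (\<one>\<^bsub>D\<^esub>, P.tri y)"
      using holonomy[OF x] holonomy[OF x'(1,2)] by (simp_all flip: \<alpha>_def \<alpha>'_def)
    then show "\<exists>g\<in>admissible (perm_group (carrier D \<times> {..<p})).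
        (\<forall>x\<in>carrier F. \<exists>c\<in>P.S. \<forall>y<p. g x (\<one>\<^bsub>D\<^esub>, y) = (f x \<one>\<^bsub>D\<^esub>, c y)) \<and>
        (\<exists>u\<in>carrier F. \<forall>y<p. g u (\<one>\<^bsub>D\<^esub>, y) = (\<one>\<^bsub>D\<^esub>, P.rot y)) \<and>
        (\<exists>v\<in>carrier F. \<forall>y<p. g v (\<one>\<^bsub>D\<^esub>, y) = (\<one>\<^bsub>D\<^esub>, P.tri y))"
      using g g_blocks D.one_closed by blast
  qed
qed

end

section \<open>Factors whose quotients have order two\<close>

definition index_at_most_two :: "'a set \<Rightarrow> ('a, 'b) monoid_scheme \<Rightarrow> bool"
  where "index_at_most_two N H \<longleftrightarrow>
    (\<forall>x\<in>carrier H - N. \<forall>y\<in>carrier H - N. x \<otimes>\<^bsub>H\<^esub> inv\<^bsub>H\<^esub> y \<in> N)"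

lemma index_two_hom:
  assumes H: "group H" and N: "subgroup N H" "index_at_most_two N H"
    and D: "group D" "r \<in> carrier D" "r \<otimes>\<^bsub>D\<^esub> r = \<one>\<^bsub>D\<^esub>"
  shows "(\<lambda>x. if x \<in> N then \<one>\<^bsub>D\<^esub> else r) \<in> hom H D"
proof (rule homI)
  interpret H: group H by fact
  interpret D: group D by fact
  interpret N: subgroup N H by fact
  show "(if x \<in> N then \<one>\<^bsub>D\<^esub> else r) \<in> carrier D" for x using D by simp
  fix x y assume xy: "x \<in> carrier H" "y \<in> carrier H"
  have inv: "inv\<^bsub>H\<^esub> z \<in> N \<longleftrightarrow> z \<in> N" if "z \<in> carrier H" for z
    using N.m_inv_closed[of z] N.m_inv_closed[of "inv\<^bsub>H\<^esub> z"] that by auto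
  have 1: "x \<otimes>\<^bsub>H\<^esub> y \<in> N \<longleftrightarrow> y \<in> N" if x: "x \<in> N"
  proof
    assume "x \<otimes>\<^bsub>H\<^esub> y \<in> N"
    from N.m_closed[OF N.m_inv_closed[OF x] this] show "y \<in> N" using xy by (simp add: H.inv_mult_cancel)
  qed (rule N.m_closed[OF x])
  have 2: "x \<otimes>\<^bsub>H\<^esub> y \<in> N \<longleftrightarrow> x \<in> N" if y: "y \<in> N"
  proof
    assume "x \<otimes>\<^bsub>H\<^esub> y \<in> N"
    from N.m_closed[OF this N.m_inv_closed[OF y]] show "x \<in> N" using xy by (simp add: H.m_assoc)
  qed (rule N.m_closed[OF _ y])
  have 3: "x \<otimes>\<^bsub>H\<^esub> y \<in> N" if "x \<notin> N" "y \<notin> N"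
  proof -
    have "x \<otimes>\<^bsub>H\<^esub> inv\<^bsub>H\<^esub> (inv\<^bsub>H\<^esub> y) \<in> N"
      using N(2) that xy inv[of y] unfolding index_at_most_two_def by blast
    then show ?thesis using xy by simp
  qed
  show "(if x \<otimes>\<^bsub>H\<^esub> y \<in> N then \<one>\<^bsub>D\<^esub> else r)
      = (if x \<in> N then \<one>\<^bsub>D\<^esub> else r) \<otimes>\<^bsub>D\<^esub> (if y \<in> N then \<one>\<^bsub>D\<^esub> else r)"
    using 1 2 3 D by auto
qed

context factor_kernels
begin

lemma L_subgroup: "j \<in> I \<Longrightarrow> subgroup (L j) (G j)"
  by (rule normal_imp_subgroup[OF L_normal])

text \<open>The group of order two acts on two points, and each of the three factors has an element
  that swaps them. Going out along \<open>b\<close> or along \<open>c\<close> and returning along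
  \<open>a\<close> gives two independent loops.\<close>

theorem reidemeister_infinite_of_three_involutions:
  assumes \<phi>: "\<phi> \<in> iso F F" and abc: "a \<in> I" "b \<in> I" "c \<in> I" "a \<noteq> b" "a \<noteq> c" "b \<noteq> c"
    and two: "\<And>j. j \<in> {a, b, c} \<Longrightarrow> index_at_most_two (L j) (G j) \<and> L j \<noteq> carrier (G j)"
  shows "reidemeister_number F \<phi> = \<infinity>"
proof -
  define D where "D = integer_mod_group 2"
  interpret D: group D by (simp add: D_def)
  have D: "carrier D = {0, 1}" "\<one>\<^bsub>D\<^esub> = 0" "1 \<otimes>\<^bsub>D\<^esub> 1 = 0" "0 \<otimes>\<^bsub>D\<^esub> 1 = 1" "1 \<otimes>\<^bsub>D\<^esub> 0 = 1" "0 \<otimes>\<^bsub>D\<^esub> 0 = 0"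
    by (auto simp: D_def carrier_integer_mod_group integer_mod_group_def)
  define k where "k j = (if j \<in> {a, b, c} then \<lambda>x. if x \<in> L j then \<one>\<^bsub>D\<^esub> else 1 else (\<lambda>x. \<one>\<^bsub>D\<^esub>))" for j
  have k_hom: "k j \<in> hom (G j) D" if j: "j \<in> I" for j
  proof (cases "j \<in> {a, b, c}")
    case True
    then show ?thesis
      using index_two_hom[OF groups[OF j] L_subgroup[OF j] _ D.is_group, of 1] two[OF True] D by (simp add: k_def)
  next
    case False
    then show ?thesis using D by (simp add: k_def hom_def)
  qed
  have h_hom: "left_translation D \<circ> k j \<in> hom (G j) (perm_group (carrier D))" if "j \<in> I" for j
    by (rule hom_compose[OF k_hom[OF that] left_translation_hom[OF D.is_group]])
  have k_kill: "k j x = \<one>\<^bsub>D\<^esub>" if "x \<in> L j" for j x using that by (simp add: k_def)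
  have "left_translation D \<one>\<^bsub>D\<^esub> = id" by (auto simp: left_translation_def fun_eq_iff)
  then obtain f where f: "f \<in> admissible (perm_group (carrier D))"
    and f_incl: "\<And>j g. \<lbrakk>j \<in> I; g \<in> carrier (G j)\<rbrakk> \<Longrightarrow> f (incl j g) = left_translation D (k j g)"
    using admissible_extension[OF group_perm_group h_hom] k_kill by auto
  have "\<exists>t\<in>carrier (G j). t \<notin> L j" if "j \<in> {a, b, c}" for j
    using two[OF that] L_subset[of j] that abc by blast
  then obtain t where t: "\<And>j. j \<in> {a, b, c} \<Longrightarrow> t j \<in> carrier (G j) \<and> t j \<notin> L j" by metis
  have swap: "f (incl j (t j)) 0 = 1" "f (incl j (t j)) 1 = 0" if "j \<in> {a, b, c}" for j
    using f_incl[of j "t j"] t[OF that] that abc D by (auto simp: k_def left_translation_def)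
  show ?thesis
  proof (rule reidemeister_infinite_of_blocks[OF \<phi> _ _ f, of "0"])
    show "finite (carrier D)" "0 \<in> carrier D" by (simp_all add: D)
    fix p :: nat assume p: "prime p" "p \<ge> 5"
    interpret P: prime_degree p using p by unfold_locales
    \<comment> \<open>Factor \<open>a\<close> is untwisted and serves as the common way back, so the
      two loops act as \<open>rot\<close> and \<open>tri\<close>.\<close>
    define s where "s j (\<gamma>::int) = (if j = b \<and> \<gamma> = 1 then P.rot else if j = c \<and> \<gamma> = 1 then P.tri else id)" for j \<gamma>
    have id_S: "id \<in> P.S" using P.SG.one_closed by simp
    then have s_S: "s j \<gamma> \<in> P.S" for j \<gamma> using P.rot_S P.tri_S by (simp add: s_def)
    obtain g where g: "g \<in> admissible (perm_group (carrier D \<times> {..<p}))"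
      and g_blocks: "\<forall>x\<in>carrier F. \<forall>\<gamma>\<in>carrier D. \<exists>c\<in>P.S. \<forall>y<p. g x (\<gamma>, y) = (f x \<gamma>, c y)"
      and g_incl: "\<forall>j\<in>I. \<forall>x\<in>carrier (G j). \<forall>\<gamma>\<in>carrier D. \<forall>y<p. g (incl j x) (\<gamma>, y) =
        (f (incl j x) \<gamma>, s j (f (incl j x) \<gamma>) (inv_into UNIV (s j \<gamma>) y))"
      using block_action[OF p f, of s] s_S by blast
    interpret g: group_hom F "perm_group (carrier D \<times> {..<p})" g by (rule admissible_hom[OF group_perm_group g])
    have holonomy: "\<exists>u\<in>carrier F. \<forall>y<p. g u (0, y) = (0, s j 1 y)" if j: "j \<in> {b, c}" for j
    proof -
      have jI: "j \<in> I" "j \<in> {a, b, c}" using j abc by auto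
      have inc: "incl a (t a) \<in> carrier F" "incl j (t j) \<in> carrier F"
        using incl_in_F abc(1) jI t by auto
      have "g (incl a (t a) \<cdot> incl j (t j)) (0, y) = (0, s j 1 y)" if y: "y < p" for y
      proof -
        have y': "s j 1 y < p" using P.S_lt[OF s_S] y by blast
        have "g (incl j (t j)) (0, y) = (1, s j 1 y)"
          using g_incl jI t[OF jI(2)] y swap[OF jI(2)] D by (simp add: s_def[of _ 0])
        moreover have "g (incl a (t a)) (1, s j 1 y) = (0, s j 1 y)"
          using g_incl abc t[of a] y' swap[of a] D by (simp add: s_def[of a])
        ultimately show ?thesis using inc by simp
      qed
      then show ?thesis using inc F.m_closed by blast
    qed
    have "s b 1 = P.rot" "s c 1 = P.tri" using abc by (auto simp: s_def)
    then have "\<exists>u\<in>carrier F. \<forall>y<p. g u (0, y) = (0, P.rot y)" "\<exists>v\<in>carrier F. \<forall>y<p. g v (0, y) = (0, P.tri y)"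
      using holonomy[of b] holonomy[of c] by simp_all
    moreover have "\<forall>x\<in>carrier F. \<exists>c\<in>P.S. \<forall>y<p. g x (0, y) = (f x 0, c y)"
      using g_blocks D(1) by blast
    ultimately show "\<exists>g\<in>admissible (perm_group (carrier D \<times> {..<p})).
        (\<forall>x\<in>carrier F. \<exists>c\<in>P.S. \<forall>y<p. g x (0, y) = (f x 0, c y)) \<and>
        (\<exists>u\<in>carrier F. \<forall>y<p. g u (0, y) = (0, P.rot y)) \<and>
        (\<exists>v\<in>carrier F. \<forall>y<p. g v (0, y) = (0, P.tri y))"
      using g by blast
  qed
qed

end

text \<open>The pair \<open>(e, n)\<close> stands for the isometry \<open>y \<mapsto> e * y + n\<close> of the integers.\<close>

definition infinite_dihedral :: "(int \<times> int) monoid"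
  where "infinite_dihedral = \<lparr>carrier = {(e, n). e = 1 \<or> e = -1},
    monoid.mult = (\<lambda>(e, n) (e', n'). (e * e', n + e * n')), one = (1, 0)\<rparr>"

lemma infinite_dihedral_simps [simp]:
  "(e, n) \<in> carrier infinite_dihedral \<longleftrightarrow> e = 1 \<or> e = -1"
  "(e, n) \<otimes>\<^bsub>infinite_dihedral\<^esub> (e', n') = (e * e', n + e * n')"
  "\<one>\<^bsub>infinite_dihedral\<^esub> = (1, 0)"
  by (simp_all add: infinite_dihedral_def)

lemma group_infinite_dihedral: "group infinite_dihedral"
proof (rule groupI)
  fix x assume "x \<in> carrier infinite_dihedral"
  then show "\<exists>y\<in>carrier infinite_dihedral. y \<otimes>\<^bsub>infinite_dihedral\<^esub> x = \<one>\<^bsub>infinite_dihedral\<^esub>"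
    by (cases x) (auto intro!: bexI[of _ "(fst x, - fst x * snd x)"])
qed (auto simp: algebra_simps)

lemma inv_infinite_dihedral:
  assumes "e = 1 \<or> e = -1"
  shows "inv\<^bsub>infinite_dihedral\<^esub> (e, n) = (e, - e * n)"
  by (rule group.inv_equality[OF group_infinite_dihedral]) (use assms in auto)

context factor_kernels
begin

text \<open>Modulo the subgroups \<open>L j\<close> the free product is the infinite dihedral group
  generated by two reflections. As no factor is infinite cyclic,
  \<open>\<rho> \<circ> \<phi>\<close> also vanishes on every \<open>L j\<close>, so \<phi> induces
  a map \<tau> of this quotient whose twisted classes can be computed.\<close>

theorem reidemeister_infinite_of_two_involutions:
  assumes \<phi>: "\<phi> \<in> iso F F" and ab: "a \<in> I" "b \<in> I" "a \<noteq> b"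
    and two: "\<And>j. j \<in> {a, b} \<Longrightarrow> index_at_most_two (L j) (G j) \<and> L j \<noteq> carrier (G j)"
    and others: "\<And>j. j \<in> I - {a, b} \<Longrightarrow> L j = carrier (G j)"
    and ncyc: "\<And>j. j \<in> I \<Longrightarrow> \<not> infinite_cyclic (G j)"
  shows "reidemeister_number F \<phi> = \<infinity>"
proof -
  let ?D = infinite_dihedral
  interpret D: group ?D by (rule group_infinite_dihedral)
  define k :: "'i \<Rightarrow> 'a \<Rightarrow> int \<times> int" where
    "k j x = (if j \<in> {a, b} \<and> x \<notin> L j then (-1, if j = a then 0 else 1) else (1, 0))" for j x
  have k_hom: "k j \<in> hom (G j) ?D" if j: "j \<in> I" for j
  proof (cases "j \<in> {a, b}")
    case True
    have "k j = (\<lambda>x. if x \<in> L j then \<one>\<^bsub>?D\<^esub> else (-1, if j = a then 0 else 1))"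
      using True by (auto simp: k_def fun_eq_iff)
    then show ?thesis
      using index_two_hom[OF groups[OF j] L_subgroup[OF j] _ D.is_group, of "(-1, if j = a then 0 else 1)"] two[OF True]
      by simp
  next
    case False
    then show ?thesis by (auto simp: k_def hom_def)
  qed
  obtain \<rho> where \<rho>: "\<rho> \<in> admissible ?D" and \<rho>_incl: "\<And>j x. \<lbrakk>j \<in> I; x \<in> carrier (G j)\<rbrakk> \<Longrightarrow> \<rho> (incl j x) = k j x"
    using admissible_extension[OF group_infinite_dihedral k_hom] by (auto simp: k_def)
  interpret r: group_hom F ?D \<rho> by (rule admissible_hom[OF group_infinite_dihedral \<rho>])
  have \<rho>': "\<rho> \<circ> \<phi> \<in> admissible ?D" by (rule admissible_comp[OF group_infinite_dihedral \<rho> \<phi>])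
  interpret r': group_hom F ?D "\<rho> \<circ> \<phi>" by (rule admissible_hom[OF group_infinite_dihedral \<rho>'])
  have "\<exists>t\<in>carrier (G j). t \<notin> L j" if "j \<in> {a, b}" for j
    using two[OF that] L_subset[of j] that ab by blast
  then obtain t where t: "\<And>j. j \<in> {a, b} \<Longrightarrow> t j \<in> carrier (G j) \<and> t j \<notin> L j" by metis
  have t_in: "incl j (t j) \<in> carrier F" if "j \<in> {a, b}" for j using incl_in_F t[OF that] that ab by auto
  have \<rho>t: "\<rho> (incl a (t a)) = (-1, 0)" "\<rho> (incl b (t b)) = (-1, 1)"
    using \<rho>_incl t ab by (auto simp: k_def)
  define r' where "r' j = \<rho> (\<phi> (incl j (t j)))" for j
  have r'_in: "r' j \<in> carrier ?D" if "j \<in> {a, b}" for j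
    using r'.hom_closed[OF t_in[OF that]] by (simp add: r'_def)
  have \<rho>'_L: "\<rho> (\<phi> (incl j x)) = (1, 0)" if "j \<in> I" "x \<in> L j" for j x
    using \<rho>' ncyc that by (auto simp: admissible_def)
  have \<rho>'_incl: "\<rho> (\<phi> (incl j x)) = (if j \<in> {a, b} \<and> x \<notin> L j then r' j else (1, 0))"
    if j: "j \<in> I" and x: "x \<in> carrier (G j)" for j x
  proof (cases "j \<in> {a, b} \<and> x \<notin> L j")
    case True
    interpret Gj: group "G j" by (rule groups[OF j])
    interpret e: group_hom "G j" F "incl j" by (rule incl_hom[OF j])
    have tj: "t j \<in> carrier (G j)" "t j \<notin> L j" using t True by auto
    define l where "l = x \<otimes>\<^bsub>G j\<^esub> inv\<^bsub>G j\<^esub> (t j)"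
    have l: "l \<in> L j" unfolding l_def using two[of j] True x tj by (auto simp: index_at_most_two_def)
    have lG: "l \<in> carrier (G j)" using l L_subset j by blast
    have "x = l \<otimes>\<^bsub>G j\<^esub> t j" using x tj by (simp add: l_def Gj.m_assoc)
    then have "incl j x = incl j l \<cdot> incl j (t j)" using lG tj by simp
    then have "\<rho> (\<phi> (incl j x)) = \<rho> (\<phi> (incl j l)) \<otimes>\<^bsub>?D\<^esub> r' j"
      using r'.hom_mult[of "incl j l" "incl j (t j)"] lG tj by (simp add: r'_def)
    also have "\<dots> = r' j" using \<rho>'_L[OF j l] D.l_one[OF r'_in[of j]] True by simp
    finally show ?thesis using True by simp
  next
    case False
    then have "x \<in> L j" using others[of j] j x by auto
    then show ?thesis using False \<rho>'_L[OF j] by simp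
  qed
  have sq: "r' j \<otimes>\<^bsub>?D\<^esub> r' j = (1, 0)" if j: "j \<in> {a, b}" for j
  proof -
    have jI: "j \<in> I" using j ab by auto
    interpret Gj: group "G j" by (rule groups[OF jI])
    interpret e: group_hom "G j" F "incl j" by (rule incl_hom[OF jI])
    interpret Lj: subgroup "L j" "G j" by (rule L_subgroup[OF jI])
    have tj: "t j \<in> carrier (G j)" "t j \<notin> L j" using t j by auto
    have "inv\<^bsub>G j\<^esub> (t j) \<notin> L j" using Lj.m_inv_closed[of "inv\<^bsub>G j\<^esub> (t j)"] tj by auto
    then have "t j \<otimes>\<^bsub>G j\<^esub> inv\<^bsub>G j\<^esub> (inv\<^bsub>G j\<^esub> (t j)) \<in> L j"
      using two[OF j] tj unfolding index_at_most_two_def by blast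
    then have "t j \<otimes>\<^bsub>G j\<^esub> t j \<in> L j" using tj by simp
    from \<rho>'_L[OF jI this] show ?thesis using r'.hom_mult[of "incl j (t j)" "incl j (t j)"] tj by (simp add: r'_def)
  qed
  have \<rho>_pow: "\<exists>x\<in>carrier F. \<rho> x = (1, int n)" for n
  proof (induction n)
    case 0
    then show ?case using r.hom_one by (intro bexI[of _ "\<one>\<^bsub>F\<^esub>"]) simp_all
  next
    case (Suc n)
    then obtain x where "x \<in> carrier F" "\<rho> x = (1, int n)" by blast
    then show ?case using t_in[of a] t_in[of b] \<rho>t
      by (intro bexI[of _ "(incl b (t b) \<cdot> incl a (t a)) \<cdot> x"]) simp_all
  qed
  have \<phi>_sur: "\<phi> ` carrier F = carrier F" using \<phi> by (auto simp: iso_def bij_betw_def)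
  have \<rho>'_pow: "\<exists>x\<in>carrier F. \<rho> (\<phi> x) = (1, int n)" for n
    using \<rho>_pow[of n] \<phi>_sur by (metis imageE)
  \<comment> \<open>Otherwise the image of \<open>\<rho> \<circ> \<phi>\<close> would have at most
    two elements, but the translations by 1 and 2 both occur besides the identity.\<close>
  have not_one: "r' j \<noteq> (1, 0)" if j: "j \<in> {a, b}" for j
  proof
    assume one: "r' j = (1, 0)"
    obtain i where i: "i \<in> {a, b}" "{a, b} = {i, j}" using j by auto
    have im: "\<rho> (\<phi> x) \<in> {(1, 0), r' i}" if "x \<in> carrier F" for x
      using that
    proof (induction x rule: F_induct)
      case one
      then show ?case using r'.hom_one by (simp add: one_F)
    next
      case (mult l x w)
      have "\<rho> (\<phi> (incl l x)) \<in> {(1, 0), r' i}" using \<rho>'_incl[OF mult(1,2)] one i(2) by auto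
      moreover have "\<rho> (\<phi> (incl l x \<cdot> w)) = \<rho> (\<phi> (incl l x)) \<otimes>\<^bsub>?D\<^esub> \<rho> (\<phi> w)"
        using r'.hom_mult[OF incl_in_F[OF mult(1,2)] mult(3)] by simp
      ultimately show ?case
        using mult(4) sq[OF i(1)] D.l_one[OF r'_in[OF i(1)]] D.r_one[OF r'_in[OF i(1)]] by auto
    qed
    obtain x y where "x \<in> carrier F" "\<rho> (\<phi> x) = (1, int 1)" "y \<in> carrier F" "\<rho> (\<phi> y) = (1, int 2)"
      using \<rho>'_pow by blast
    then have "r' i = (1, 1)" "r' i = (1, 2)" using im[of x] im[of y] by auto
    then show False by simp
  qed
  have reflection: "\<exists>n. r' j = (-1, n)" if j: "j \<in> {a, b}" for j
  proof -
    obtain e n where en: "r' j = (e, n)" by fastforce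
    then show ?thesis using r'_in[OF j] sq[OF j] not_one[OF j] by auto
  qed
  obtain m0 where m0: "r' a = (-1, m0)" using reflection by blast
  obtain m1 where m1: "r' b = (-1, m1)" using reflection by blast
  \<comment> \<open>The unit translation is the product of the two generating reflections, and its
    image is the translation by \<delta>. The values at the two reflections determine
    \<tau>.\<close>
  define \<delta> where "\<delta> = m1 - m0"
  define \<tau> :: "int \<times> int \<Rightarrow> int \<times> int" where "\<tau> = (\<lambda>(e, n). (e, if e = 1 then \<delta> * n else m0 + \<delta> * n))"
  have \<tau>: "\<rho> (\<phi> x) = \<tau> (\<rho> x)" if "x \<in> carrier F" for x
    using that
  proof (induction x rule: F_induct)
    case one
    then show ?case using r'.hom_one r.hom_one by (simp add: one_F \<tau>_def)
  next
    case (mult l x w)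
    obtain e n where en: "\<rho> w = (e, n)" by fastforce
    have e: "e = 1 \<or> e = -1" using r.hom_closed[OF mult(3)] en by simp
    have "\<rho> (\<phi> (incl l x \<cdot> w)) = \<rho> (\<phi> (incl l x)) \<otimes>\<^bsub>?D\<^esub> \<rho> (\<phi> w)"
      using r'.hom_mult[OF incl_in_F[OF mult(1,2)] mult(3)] by simp
    also have "\<dots> = \<tau> (k l x \<otimes>\<^bsub>?D\<^esub> \<rho> w)"
      using \<rho>'_incl[OF mult(1,2)] mult(4) en e m0 m1 ab(3)
      by (auto simp: k_def \<tau>_def \<delta>_def algebra_simps)
    also have "k l x \<otimes>\<^bsub>?D\<^esub> \<rho> w = \<rho> (incl l x \<cdot> w)"
      using r.hom_mult[OF incl_in_F[OF mult(1,2)] mult(3)] \<rho>_incl[OF mult(1,2)] by simp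
    finally show ?case .
  qed
  \<comment> \<open>Every translation in the image of \<open>\<rho> \<circ> \<phi>\<close> is by a
    multiple of \<delta>, and the translation by 1 is among them.\<close>
  have \<delta>: "\<delta> = 1 \<or> \<delta> = -1"
  proof -
    obtain x where x: "x \<in> carrier F" "\<rho> (\<phi> x) = (1, int 1)" using \<rho>'_pow by blast
    obtain e n where "\<rho> x = (e, n)" by fastforce
    then have "\<delta> * n = 1" using \<tau>[OF x(1)] x(2) by (auto simp: \<tau>_def split: if_splits)
    then show ?thesis by (simp add: zmult_eq_1_iff) blast
  qed
  \<comment> \<open>With \<delta> as sign, twisted conjugation by an element over a translation
    leaves the value under \<rho> unchanged, and by an element over a reflection it sends
    \<open>m\<close> to \<open>- m - \<delta> * m0\<close>.\<close>
  have ex: "\<exists>x\<in>carrier F. \<rho> x = (\<delta>, int n)" for n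
  proof -
    obtain x where x: "x \<in> carrier F" "\<rho> x = (1, int n)" using \<rho>_pow by blast
    then have "x \<cdot> incl a (t a) \<in> carrier F" "\<rho> (x \<cdot> incl a (t a)) = (-1, int n)"
      using t_in[of a] \<rho>t by simp_all
    then show ?thesis using x \<delta> by blast
  qed
  then obtain y where y: "\<And>n. y n \<in> carrier F" "\<And>n. \<rho> (y n) = (\<delta>, int n)" by metis
  \<comment> \<open>Beyond the absolute value of \<open>m0\<close> the reflected value is negative,
    so it cannot be the index of another member.\<close>
  define Y where "Y = y ` {nat \<bar>m0\<bar><..}"
  have "inj y"
  proof (rule injI)
    fix m n assume "y m = y n"
    then have "\<rho> (y m) = \<rho> (y n)" by (rule arg_cong)
    then show "m = n" unfolding y(2) by simp
  qed
  then have "inj_on y {nat \<bar>m0\<bar><..}" by (rule inj_on_subset) simp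
  then have "infinite Y" unfolding Y_def by (simp add: finite_image_iff infinite_Ioi)
  have same_class: "m = n \<or> int n = - int m - \<delta> * m0"
    if g: "g \<in> carrier F" and eq: "y n = g \<cdot> y m \<cdot> inv\<^bsub>F\<^esub> (\<phi> g)" for g m n
  proof -
    have \<phi>g: "\<phi> g \<in> carrier F" using \<phi>_sur g by blast
    obtain e i where ei: "\<rho> g = (e, i)" by fastforce
    have e: "e = 1 \<or> e = -1" using r.hom_closed[OF g] ei by simp
    have "\<rho> (y n) = \<rho> g \<otimes>\<^bsub>?D\<^esub> \<rho> (y m) \<otimes>\<^bsub>?D\<^esub> inv\<^bsub>?D\<^esub> (\<tau> (\<rho> g))"
      using g \<phi>g y(1)[of m] \<tau>[OF g] by (simp add: eq)
    then show ?thesis using e \<delta> unfolding ei y(2)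
      by (auto simp: \<tau>_def inv_infinite_dihedral algebra_simps)
  qed
  show ?thesis
  \<comment> \<open>Here the whole group serves as \<open>K\<close>, so a single label is
    enough.\<close>
  proof (rule reidemeister_number_infinite[OF F.is_group \<phi>, where \<Phi> = "\<lambda>_. ()" and K = "carrier F" and Y = Y])
    show "Y \<subseteq> carrier F" "infinite Y" using y(1) \<open>infinite Y\<close> by (auto simp: Y_def)
    fix u v assume uv: "u \<in> Y" "v \<in> Y" "u \<noteq> v"
    obtain m n where mn: "u = y m" "v = y n" "nat \<bar>m0\<bar> < m" "nat \<bar>m0\<bar> < n" using uv by (auto simp: Y_def)
    show "\<not> (\<exists>g\<in>carrier F. v = g \<cdot> u \<cdot> inv\<^bsub>F\<^esub> (\<phi> g))"
    proof
      assume "\<exists>g\<in>carrier F. v = g \<cdot> u \<cdot> inv\<^bsub>F\<^esub> (\<phi> g)"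
      then obtain g where g: "g \<in> carrier F" "y n = g \<cdot> y m \<cdot> inv\<^bsub>F\<^esub> (\<phi> g)"
        unfolding mn(1,2) by (elim bexE)
      have "m \<noteq> n"
      proof
        assume "m = n"
        then show False using uv(3) by (simp only: mn(1,2))
      qed
      then have "int n = - int m - \<delta> * m0" using same_class[OF g] by blast
      moreover have "\<bar>\<delta> * m0\<bar> = \<bar>m0\<bar>" using \<delta> by auto
      ultimately show False using mn(3,4) by linarith
    qed
  qed (simp_all add: F.is_group)
qed

end

section \<open>Characteristic subgroups of the factors\<close>

text \<open>\<open>reidemeister_infinite_of_large_quotient\<close> asks for three cosets, so the
  subgroup of cubes is taken; a generator and its inverse represent its two nontrivial
  cosets.\<close>

lemma infinite_cyclic_cubes:
  fixes Q :: "('a, 'b) monoid_scheme"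
  assumes "group Q" "infinite_cyclic Q"
  shows "\<exists>A x x'. A \<lhd> Q \<and> finite (rcosets\<^bsub>Q\<^esub> A) \<and> x \<in> carrier Q \<and> x' \<in> carrier Q \<and>
    x \<notin> A \<and> x' \<notin> A \<and> x \<otimes>\<^bsub>Q\<^esub> inv\<^bsub>Q\<^esub> x' \<notin> A"
proof -
  interpret Q: group Q by fact
  have cyc: "cyclic_group Q" and inf: "infinite (carrier Q)" using assms(2) by (auto simp: infinite_cyclic_def)
  obtain z where z: "z \<in> carrier Q" and zr: "carrier Q = range (\<lambda>n::int. z [^]\<^bsub>Q\<^esub> n)"
    using cyc by (auto simp: Q.cyclic_group)
  have "Q.ord z = 0"
    using Q.infinite_cyclic_subgroup_order[OF z] Q.carrier_subgroup_generated_by_singleton[OF z] zr inf by metis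
  then have z_inj: "z [^]\<^bsub>Q\<^esub> m = z [^]\<^bsub>Q\<^esub> n \<longleftrightarrow> m = n" for m n :: int
    using Q.int_pow_eq[OF z, of m n] by auto
  define A where "A = range (\<lambda>n::int. (z [^]\<^bsub>Q\<^esub> (3::int)) [^]\<^bsub>Q\<^esub> n)"
  have A_iff: "z [^]\<^bsub>Q\<^esub> n \<in> A \<longleftrightarrow> 3 dvd n" for n :: int
    using z by (auto simp: A_def Q.int_pow_pow z_inj dvd_def)
  have A_sub: "subgroup A Q" unfolding A_def using z by (intro Q.subgroup_of_powers) simp
  have A_norm: "A \<lhd> Q"
    using comm_group.normal_iff_subgroup[OF Q.cyclic_imp_abelian_group[OF cyc]] A_sub by blast
  have "rcosets\<^bsub>Q\<^esub> A \<subseteq> (\<lambda>r::int. A #>\<^bsub>Q\<^esub> (z [^]\<^bsub>Q\<^esub> r)) ` {0..<3}"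
  proof
    fix C assume "C \<in> rcosets\<^bsub>Q\<^esub> A"
    then obtain y where "y \<in> carrier Q" "C = A #>\<^bsub>Q\<^esub> y" by (auto simp: RCOSETS_def)
    then obtain n :: int where n: "C = A #>\<^bsub>Q\<^esub> (z [^]\<^bsub>Q\<^esub> n)" using zr by auto
    have "z [^]\<^bsub>Q\<^esub> n = z [^]\<^bsub>Q\<^esub> (3 * (n div 3)) \<otimes>\<^bsub>Q\<^esub> z [^]\<^bsub>Q\<^esub> (n mod 3)"
      using z by (simp flip: Q.int_pow_mult)
    then have "C = A #>\<^bsub>Q\<^esub> z [^]\<^bsub>Q\<^esub> (3 * (n div 3)) #>\<^bsub>Q\<^esub> z [^]\<^bsub>Q\<^esub> (n mod 3)"
      using n z Q.coset_mult_assoc[OF subgroup.subset[OF A_sub], of "z [^]\<^bsub>Q\<^esub> (3 * (n div 3))" "z [^]\<^bsub>Q\<^esub> (n mod 3)"] by simp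
    also have "A #>\<^bsub>Q\<^esub> z [^]\<^bsub>Q\<^esub> (3 * (n div 3)) = A"
      using A_iff[of "3 * (n div 3)"] z by (intro Q.coset_join2 A_sub) auto
    finally show "C \<in> (\<lambda>r::int. A #>\<^bsub>Q\<^esub> (z [^]\<^bsub>Q\<^esub> r)) ` {0..<3}" by auto
  qed
  then have fin: "finite (rcosets\<^bsub>Q\<^esub> A)" by (rule finite_subset) simp
  have "z [^]\<^bsub>Q\<^esub> (1::int) \<notin> A" "z [^]\<^bsub>Q\<^esub> (-1::int) \<notin> A" "z [^]\<^bsub>Q\<^esub> (2::int) \<notin> A"
    unfolding A_iff by presburger+
  moreover have "z [^]\<^bsub>Q\<^esub> (2::int) = z [^]\<^bsub>Q\<^esub> (1::int) \<otimes>\<^bsub>Q\<^esub> inv\<^bsub>Q\<^esub> (z [^]\<^bsub>Q\<^esub> (-1::int))"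
    using z Q.int_pow_mult[OF z, of 1 1] by (simp add: Q.int_pow_neg)
  ultimately show ?thesis
    using A_norm fin z by (intro exI[of _ A] exI[of _ "z [^]\<^bsub>Q\<^esub> (1::int)"] exI[of _ "z [^]\<^bsub>Q\<^esub> (-1::int)"]) auto
qed

lemma characteristic_subgroup_normal:
  assumes "group G" "characteristic_subgroup H G"
  shows "H \<lhd> G"
proof -
  interpret group G by fact
  have H: "subgroup H G" using assms(2) by (simp add: characteristic_subgroup_def)
  show ?thesis
  proof (rule normal_invI[OF H])
    fix x h assume xh: "x \<in> carrier G" "h \<in> H"
    let ?c = "\<lambda>y. x \<otimes>\<^bsub>G\<^esub> y \<otimes>\<^bsub>G\<^esub> inv\<^bsub>G\<^esub> x"
    have "bij_betw ?c (carrier G) (carrier G)"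
      by (rule bij_betw_byWitness[where f' = "\<lambda>y. inv\<^bsub>G\<^esub> x \<otimes>\<^bsub>G\<^esub> y \<otimes>\<^bsub>G\<^esub> x"])
        (use xh in \<open>auto simp: m_assoc inv_mult_cancel\<close>)
    then have "?c \<in> iso G G" using conj_hom[OF xh(1)] by (simp add: iso_def)
    then have "?c ` H = H" using assms(2) by (simp add: characteristic_subgroup_def)
    then show "x \<otimes>\<^bsub>G\<^esub> h \<otimes>\<^bsub>G\<^esub> inv\<^bsub>G\<^esub> x \<in> H" using xh by blast
  qed
qed

text \<open>Two isomorphisms differ by an automorphism of \<open>G\<close>, which preserves
  \<open>H\<close>. Hence it does not matter which isomorphism transports \<open>H\<close> to an
  isomorphic factor.\<close>

lemma characteristic_subgroup_image_unique:
  assumes "group G" "characteristic_subgroup H G" "\<theta> \<in> iso G G'" "\<theta>' \<in> iso G G'"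
  shows "\<theta> ` H = \<theta>' ` H"
proof -
  interpret group G by fact
  have HG: "H \<subseteq> carrier G" using assms(2) by (auto simp: characteristic_subgroup_def dest: subgroup.subset)
  let ?\<eta> = "inv_into (carrier G) \<theta>'"
  have "?\<eta> \<circ> \<theta> \<in> iso G G" by (rule iso_set_trans[OF assms(3) iso_set_sym[OF assms(4)]])
  then have eq: "(?\<eta> \<circ> \<theta>) ` H = H" using assms(2) unfolding characteristic_subgroup_def by blast
  have "\<theta>' (?\<eta> (\<theta> h)) = \<theta> h" if "h \<in> H" for h
    using that HG assms(3,4) by (intro f_inv_into_f) (auto simp: iso_def bij_betw_def)
  then have "\<theta>' ` (?\<eta> \<circ> \<theta>) ` H = \<theta> ` H" by (simp add: image_image)
  then show ?thesis by (simp only: eq)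
qed

lemma rcosets_iso_image:
  assumes "group G" "\<theta> \<in> iso G G'" "H \<subseteq> carrier G"
  shows "rcosets\<^bsub>G'\<^esub> (\<theta> ` H) = (\<lambda>C. \<theta> ` C) ` (rcosets\<^bsub>G\<^esub> H)"
proof -
  have hom: "\<theta> (x \<otimes>\<^bsub>G\<^esub> y) = \<theta> x \<otimes>\<^bsub>G'\<^esub> \<theta> y" if "x \<in> carrier G" "y \<in> carrier G" for x y
    using assms(2) that by (auto simp: iso_def hom_def)
  have sur: "carrier G' = \<theta> ` carrier G" using assms(2) by (auto simp: iso_def bij_betw_def)
  have "\<theta> ` H #>\<^bsub>G'\<^esub> \<theta> x = \<theta> ` (H #>\<^bsub>G\<^esub> x)" if "x \<in> carrier G" for x
    using that assms(3) hom by (auto simp: r_coset_def subset_iff image_iff)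
  then show ?thesis by (auto simp: RCOSETS_def sur)
qed

theorem theorem1:
  fixes k :: nat and G :: "nat \<Rightarrow> 'a monoid"
  assumes "k \<ge> 2"
    and "\<And>i. i \<in> {1..k} \<Longrightarrow> group (G i)"
    and "\<And>i. i \<in> {1..k} \<Longrightarrow> freely_indecomposable (G i)"
    and "\<And>i. i \<in> {1, 2} \<Longrightarrow>
      \<exists>H. characteristic_subgroup H (G i) \<and> H \<noteq> carrier (G i) \<and> finite (rcosets\<^bsub>G i\<^esub> H)"
  shows "R_infinity_property (free_product {1..k} G)"
proof -
  let ?I = "{1..k}"
  have I12: "1 \<in> ?I" "2 \<in> ?I" using assms(1) by auto
  note grp = assms(2)
  obtain H1 where H1: "characteristic_subgroup H1 (G 1)" "H1 \<noteq> carrier (G 1)" "finite (rcosets\<^bsub>G 1\<^esub> H1)"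
    using assms(4)[of 1] by blast
  obtain H2 where H2: "characteristic_subgroup H2 (G 2)" "H2 \<noteq> carrier (G 2)" "finite (rcosets\<^bsub>G 2\<^esub> H2)"
    using assms(4)[of 2] by blast
  \<comment> \<open>The given subgroups are transported to all isomorphic factors. If the factors 1
    and 2 are isomorphic, both receive an image of \<open>H1\<close>, as \<open>L_iso\<close>
    demands.\<close>
  define L where "L j = (if G 1 \<cong> G j then (SOME \<theta>. \<theta> \<in> iso (G 1) (G j)) ` H1
    else if G 2 \<cong> G j then (SOME \<theta>. \<theta> \<in> iso (G 2) (G j)) ` H2 else carrier (G j))" for j
  have some: "(SOME \<theta>. \<theta> \<in> iso (G i) (G j)) \<in> iso (G i) (G j)" if "G i \<cong> G j" for i j
    using that by (auto simp: is_iso_def some_in_eq)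
  have L1: "L j = \<theta> ` H1" if "\<theta> \<in> iso (G 1) (G j)" for j \<theta>
    using characteristic_subgroup_image_unique[OF grp[OF I12(1)] H1(1) some[OF is_isoI[OF that]] that]
      is_isoI[OF that] by (simp add: L_def)
  have L2: "L j = \<theta> ` H2" if "\<theta> \<in> iso (G 2) (G j)" "\<not> G 1 \<cong> G j" for j \<theta>
    using characteristic_subgroup_image_unique[OF grp[OF I12(2)] H2(1) some[OF is_isoI[OF that(1)]] that(1)]
      is_isoI[OF that(1)] that(2) by (simp add: L_def)
  have L3: "L j = carrier (G j)" if "\<not> G 1 \<cong> G j" "\<not> G 2 \<cong> G j" for j using that by (simp add: L_def)
  have image: "\<theta> ` H \<lhd> G j \<and> finite (rcosets\<^bsub>G j\<^esub> (\<theta> ` H)) \<and> \<theta> ` H \<noteq> carrier (G j)"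
    if H: "characteristic_subgroup H (G i)" "H \<noteq> carrier (G i)" "finite (rcosets\<^bsub>G i\<^esub> H)"
      and i: "i \<in> ?I" and j: "j \<in> ?I" and \<theta>: "\<theta> \<in> iso (G i) (G j)" for H i j \<theta>
  proof -
    have hom: "group_hom (G i) (G j) \<theta>"
      using \<theta> grp i j by (simp add: group_hom_def group_hom_axioms_def iso_def)
    have bij: "\<theta> ` carrier (G i) = carrier (G j)" "inj_on \<theta> (carrier (G i))"
      using \<theta> by (auto simp: iso_def bij_betw_def)
    have HG: "H \<subseteq> carrier (G i)" using H(1) by (auto simp: characteristic_subgroup_def dest: subgroup.subset)
    have "\<theta> ` H \<noteq> \<theta> ` carrier (G i)" using inj_on_image_eq_iff[OF bij(2) HG] H(2) by simp
    then show ?thesis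
      using normal_image_surj[OF hom bij(1) characteristic_subgroup_normal[OF grp[OF i] H(1)]]
        rcosets_iso_image[OF grp[OF i] \<theta> HG] H(3) bij(1) by simp
  qed
  have L_props: "L j \<lhd> G j \<and> finite (rcosets\<^bsub>G j\<^esub> (L j)) \<and> (j \<in> {1, 2} \<longrightarrow> L j \<noteq> carrier (G j))"
    if j: "j \<in> ?I" for j
  proof -
    interpret Gj: group "G j" by (rule grp[OF j])
    have refl: "(\<lambda>x. x) \<in> iso (G j) (G j)" by (rule iso_set_refl)
    consider \<theta> where "\<theta> \<in> iso (G 1) (G j)" | \<theta> where "\<theta> \<in> iso (G 2) (G j)" "\<not> G 1 \<cong> G j"
      | "\<not> G 1 \<cong> G j" "\<not> G 2 \<cong> G j" by (auto simp: is_iso_def)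
    then show ?thesis
    proof cases
      case 1
      then show ?thesis using image[OF H1 I12(1) j] L1 by simp
    next
      case 2
      then show ?thesis using image[OF H2 I12(2) j] L2 by simp
    next
      case 3
      have "rcosets\<^bsub>G j\<^esub> carrier (G j) \<subseteq> {carrier (G j)}"
        using Gj.coset_join2[OF _ Gj.subgroup_self] by (auto simp: RCOSETS_def)
      then have "finite (rcosets\<^bsub>G j\<^esub> carrier (G j))" by (rule finite_subset) simp
      moreover have "j \<noteq> 1" "j \<noteq> 2" using 3 is_isoI[OF refl] by auto
      ultimately show ?thesis using L3[OF 3] Gj.normal_self by simp
    qed
  qed
  have "free_product_of_groups ?I G" by (rule free_product_of_groups.intro[OF grp])
  moreover have "factor_kernels_axioms ?I G L"
  proof (rule factor_kernels_axioms.intro)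
    show "finite ?I" by simp
    show "freely_indecomposable (G j)" if "j \<in> ?I" for j using assms(3) that by blast
    show "L j \<lhd> G j" if "j \<in> ?I" for j using L_props that by blast
    show "finite (rcosets\<^bsub>G j\<^esub> L j)" if "j \<in> ?I" "\<not> infinite_cyclic (G j)" for j
      using L_props that by blast
    fix i j \<theta> assume ij: "i \<in> ?I" "j \<in> ?I" and \<theta>: "\<theta> \<in> iso (G i) (G j)"
    have iso: "G i \<cong> G j" "G j \<cong> G i" using is_isoI[OF \<theta>] group.iso_sym[OF grp[OF ij(1)]] by auto
    consider \<eta> where "\<eta> \<in> iso (G 1) (G i)" | \<eta> where "\<eta> \<in> iso (G 2) (G i)" "\<not> G 1 \<cong> G i"
      | "\<not> G 1 \<cong> G i" "\<not> G 2 \<cong> G i" by (auto simp: is_iso_def)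
    then show "\<theta> ` L i = L j"
    proof cases
      case 1
      then show ?thesis using L1[OF 1] L1[OF iso_set_trans[OF 1 \<theta>]] by (simp add: image_image)
    next
      case 2
      then have "\<not> G 1 \<cong> G j" using iso_trans[OF _ iso(2)] by blast
      then show ?thesis using L2[OF 2] L2[OF iso_set_trans[OF 2(1) \<theta>]] by (simp add: image_image)
    next
      case 3
      then have "\<not> G 1 \<cong> G j" "\<not> G 2 \<cong> G j" using iso_trans[OF _ iso(2)] by blast+
      then show ?thesis using L3 3 \<theta> by (simp add: iso_def bij_betw_def)
    qed
  qed
  ultimately interpret factor_kernels ?I G L by (rule factor_kernels.intro)
  have ne12: "L j \<noteq> carrier (G j)" if "j \<in> {1, 2}" for j
    using L_props[of j] that I12 by blast
  then have proper: "\<exists>z\<in>carrier (G j). z \<notin> L j" if "j \<in> {1, 2}" for j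
    using L_subset[of j] that I12 by blast
  have "reidemeister_number F \<phi> = \<infinity>" if \<phi>: "\<phi> \<in> iso F F" for \<phi>
  proof -
    have other: "\<exists>b\<in>?I. a \<noteq> b \<and> (\<exists>z\<in>carrier (G b). z \<notin> L b)" for a
    proof (cases "a = 1")
      case True
      then have "a \<noteq> 2" by simp
      then show ?thesis using proper[of 2] I12(2) by blast
    next
      case False
      then show ?thesis using proper[of 1] I12(1) by blast
    qed
    \<comment> \<open>The first two cases provide a factor with a quotient of order at least three,
      to be paired with factor 1 or 2. In the third, all quotients by \<open>L j\<close> have order
      at most two, and it matters whether a third one is nontrivial.\<close>
    consider (cyclic) a where "a \<in> ?I" "infinite_cyclic (G a)"
      | (large) a where "a \<in> ?I" "\<not> index_at_most_two (L a) (G a)"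
      | (small) "\<And>j. j \<in> ?I \<Longrightarrow> \<not> infinite_cyclic (G j)" "\<And>j. j \<in> ?I \<Longrightarrow> index_at_most_two (L j) (G j)"
      by blast
    then show ?thesis
    proof cases
      case cyclic
      obtain b z where b: "b \<in> ?I" "a \<noteq> b" "z \<in> carrier (G b)" "z \<notin> L b" using other by blast
      \<comment> \<open>Admissibility puts no condition on an infinite cyclic factor, so the
        subgroup of index three may take the place of \<open>L a\<close>.\<close>
      obtain A x x' where A: "A \<lhd> G a" "finite (rcosets\<^bsub>G a\<^esub> A)" "x \<in> carrier (G a)" "x' \<in> carrier (G a)"
        "x \<notin> A" "x' \<notin> A" "x \<otimes>\<^bsub>G a\<^esub> inv\<^bsub>G a\<^esub> x' \<notin> A"
        using infinite_cyclic_cubes[OF grp[OF cyclic(1)] cyclic(2)] by blast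
      show ?thesis
        by (rule reidemeister_infinite_of_large_quotient[OF \<phi> cyclic(1) b(1,2) A(1,2) _ _ _ _ A(3,5,4,6,7) b(3,4)])
          (use cyclic L_props[OF b(1)] in auto)
    next
      case large
      obtain b z where b: "b \<in> ?I" "a \<noteq> b" "z \<in> carrier (G b)" "z \<notin> L b" using other by blast
      obtain x x' where x: "x \<in> carrier (G a)" "x \<notin> L a" "x' \<in> carrier (G a)" "x' \<notin> L a"
        "x \<otimes>\<^bsub>G a\<^esub> inv\<^bsub>G a\<^esub> x' \<notin> L a"
        using large(2) by (auto simp: index_at_most_two_def)
      show ?thesis
        by (rule reidemeister_infinite_of_large_quotient[OF \<phi> large(1) b(1,2) _ _ _ _ _ _ x b(3,4)])
          (use L_props[OF b(1)] L_props[OF large(1)] in auto)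
    next
      case small
      show ?thesis
      proof (cases "\<exists>c\<in>?I - {1, 2}. L c \<noteq> carrier (G c)")
        case True
        then obtain c where c: "c \<in> ?I" "c \<noteq> 1" "c \<noteq> 2" "L c \<noteq> carrier (G c)" by blast
        have "index_at_most_two (L j) (G j) \<and> L j \<noteq> carrier (G j)" if "j \<in> {1, 2, c}" for j
          using that small(2) ne12 c I12 by blast
        then show ?thesis
          using reidemeister_infinite_of_three_involutions[OF \<phi> I12 c(1)] c(2,3) by simp
      next
        case False
        have "index_at_most_two (L j) (G j) \<and> L j \<noteq> carrier (G j)" if "j \<in> {1, 2}" for j
          using that small(2) ne12 I12 by blast
        then show ?thesis
          using reidemeister_infinite_of_two_involutions[OF \<phi> I12] False small(1) by simp
      qed
    qed
  qed
  then show ?thesis unfolding R_infinity_property_def F_def by blast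
qed

end
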